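(* For each $n$, let $A_1(n),\dots,A_k(n)$ and $B_1(n),\dots,B_\ell(n)$ be deterministic matrices in $M_n(\mathbb C)$ and let $U=U(n)$ be an $n\times n$ Haar unitary random matrix. Suppose that $((A_1(n),\dots,A_k(n)),\mathrm{Tr}_n)$ converges in distribution, as $n\to\infty$, to a $k$-tuple of trace class operators, and that $((B_1(n),\dots,B_\ell(n)),\mathrm{tr}_n)$ converges up to the first order to an $\ell$-tuple of elements in an infinitesimal non-commutative probability space. Let $\mathcal C$ be the unital ring of non-commutative $*$-polynomials in $x_1,\dots,x_k,y_1,\dots,y_\ell$ over $\mathbb C$. Then for any $P\in\mathcal C$ the limits $$\tau(P):=\lim_{n\to\infty}\mathrm{tr}_n(P(A_1,\dots,A_k,UB_1U^*,\dots,UB_\ell U^* )),$$ $$\tau'(P):=\lim_{n\to\infty}\frac{\mathrm{tr}_n(P(A_1,\dots,A_k,UB_1U^*,\dots,UB_\ell U^* ))-\tau(P)}{1/n}$$ exist almost surely, and thus $(\mathcal C,\tau',\tau)$ is an infinitesimal non-commutative probability space. Moreover, $\{x_i\}_{i=1}^k$ and $\{y_j\}_{j=1}^\ell$ are infinitesimally free with respect to $(\tau',\tau)$.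
   Context: $\mathrm{Tr}_n$ is the non-normalized trace on $M_n(\mathbb C)$, $\mathrm{tr}_n=\frac1n\mathrm{Tr}_n$. The $U(n)$ are defined on a common probability space and are distributed according to normalized Haar measure on the unitary group. Convergence in distribution of $((A_i(n))_i,\mathrm{Tr}_n)$ to trace class operators $(a_1,\dots,a_k)$ on a separable Hilbert space $H$: $\mathrm{Tr}_n(A_{i_1}(n)^{\varepsilon_1}\cdots A_{i_p}(n)^{\varepsilon_p})\to\mathrm{Tr}_H(a_{i_1}^{\varepsilon_1}\cdots a_{i_p}^{\varepsilon_p})$ for all $p\ge1$, all indices, $\varepsilon_j\in\{1,*\}$; similarly for other functionals. An infinitesimal non-commutative probability space $(\mathcal C,\tau',\tau)$ is a unital $*$-algebra $\mathcal C$ with a tracial state $\tau$ (linear, $\tau(1)=1$, $\tau(c^*c)\ge0$, $\tau(cd)=\tau(dc)$) and a tracial linear functional $\tau'$ with $\tau'(1_{\mathcal C})=0$. Convergence up to the first order: $((c_1(n),\dots,c_\ell(n)),\tau_n)$ converges up to the first order to $((c_1,\dots,c_\ell),(\tau',\tau))$ if it converges in distribution to $((c_1,\dots,c_\ell),\tau)$ and for every non-commutative $*$-polynomial $Q$, $\lim_{n\to\infty}n\,[\tau_n(Q(c_1(n),\dots,c_\ell(n)))-\tau(Q(c_1,\dots,c_\ell))]=\tau'(Q(c_1,\dots,c_\ell))$. Infinitesimal freeness: put $\tau_t=\tau+t\tau'$ for $t\in\mathbb R$. $*$-subalgebras $\mathcal A,\mathcal B$ of $\mathcal C$ (possibly not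 containing $1_{\mathcal C}$) are infinitesimally free if for all $m\ge1$, $a_1,\dots,a_m\in\mathcal A$, $b_1,\dots,b_m\in\mathcal B$, $\tau_t\big((a_1-\tau_t(a_1)1)(b_1-\tau_t(b_1)1)(a_2-\tau_t(a_2)1)\cdots(b_m-\tau_t(b_m)1)\big)=o(t)$ as $t\to0$. The sets $\{x_i\}$, $\{y_j\}$ are infinitesimally free if the $*$-algebras $\mathcal A$ of $*$-polynomials in the $x_i$ without constant term and $\mathcal B$ of $*$-polynomials in the $y_j$ (with constants) are. *)

theory Defs
  imports
    "HOL-Probability.Probability"
    "HOL-Library.Poly_Mapping"
    "HOL-Library.Landau_Symbols"
    "Jordan_Normal_Form.Schur_Decomposition"
begin

section \<open>Non-commutative *-polynomials\<close>

datatype 'v letter = Var 'v | Adj 'v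

primrec flip_letter :: "'v letter \<Rightarrow> 'v letter" where
  "flip_letter (Var v) = Adj v"
| "flip_letter (Adj v) = Var v"

primrec letter_val :: "('m \<Rightarrow> 'm) \<Rightarrow> ('v \<Rightarrow> 'm) \<Rightarrow> 'v letter \<Rightarrow> 'm" where
  "letter_val st x (Var v) = x v"
| "letter_val st x (Adj v) = st (x v)"

definition word_val ::
    "('m \<Rightarrow> 'm \<Rightarrow> 'm) \<Rightarrow> 'm \<Rightarrow> ('m \<Rightarrow> 'm) \<Rightarrow> ('v \<Rightarrow> 'm) \<Rightarrow> 'v letter list \<Rightarrow> 'm" where
  "word_val prd e st x w = foldr (\<lambda>l. prd (letter_val st x l)) w e"

text \<open>Words form the free monoid, written additively so that the convolution product of
  \<^typ>\<open>'a \<Rightarrow>\<^sub>0 'b\<close> becomes the product of non-commutative polynomials.\<close>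

instantiation list :: (type) monoid_add
begin

definition zero_list :: "'a list" where "zero_list = []"

definition plus_list :: "'a list \<Rightarrow> 'a list \<Rightarrow> 'a list" where "plus_list = (@)"

instance by standard (simp_all add: zero_list_def plus_list_def)

end

type_synonym 'v ncpoly = "'v letter list \<Rightarrow>\<^sub>0 complex"

definition ncp_var :: "'v \<Rightarrow> 'v ncpoly" where
  "ncp_var v = Poly_Mapping.single [Var v] 1"

definition ncp_scale :: "complex \<Rightarrow> 'v ncpoly \<Rightarrow> 'v ncpoly" where
  "ncp_scale c P = Poly_Mapping.map (\<lambda>z. c * z) P"

definition ncp_star :: "'v ncpoly \<Rightarrow> 'v ncpoly" where
  "ncp_star P = (\<Sum>w \<in> Poly_Mapping.keys P.
     Poly_Mapping.single (rev (map flip_letter w)) (cnj (Poly_Mapping.lookup P w)))"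


section \<open>Unital *-algebras and infinitesimal probability spaces\<close>

locale unital_star_algebra = vector_space scl
  for scl :: "complex \<Rightarrow> 'c::ring_1 \<Rightarrow> 'c" +
  fixes star :: "'c \<Rightarrow> 'c"
  assumes scl_mult_left: "scl z x * y = scl z (x * y)"
    and scl_mult_right: "x * scl z y = scl z (x * y)"
    and star_add: "star (x + y) = star x + star y"
    and star_scl: "star (scl z x) = scl (cnj z) (star x)"
    and star_mult: "star (x * y) = star y * star x"
    and star_star: "star (star x) = x"

definition ncp_eval ::
    "(complex \<Rightarrow> 'c::ring_1 \<Rightarrow> 'c) \<Rightarrow> ('c \<Rightarrow> 'c) \<Rightarrow> ('v \<Rightarrow> 'c) \<Rightarrow> 'v ncpoly \<Rightarrow> 'c" where
  "ncp_eval scl star x P =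
     (\<Sum>w \<in> Poly_Mapping.keys P. scl (Poly_Mapping.lookup P w) (word_val (*) 1 star x w))"

locale infinitesimal_ncps = unital_star_algebra scl star
  for scl :: "complex \<Rightarrow> 'c::ring_1 \<Rightarrow> 'c" and star :: "'c \<Rightarrow> 'c" +
  fixes \<tau>' \<tau> :: "'c \<Rightarrow> complex"
  assumes linear_\<tau>: "Vector_Spaces.linear scl (*) \<tau>"
    and \<tau>_one: "\<tau> 1 = 1"
    and \<tau>_positive: "\<tau> (star c * c) \<in> \<real> \<and> 0 \<le> Re (\<tau> (star c * c))"
    and \<tau>_tracial: "\<tau> (c * d) = \<tau> (d * c)"
    and linear_\<tau>': "Vector_Spaces.linear scl (*) \<tau>'"
    and \<tau>'_one: "\<tau>' 1 = 0"
    and \<tau>'_tracial: "\<tau>' (c * d) = \<tau>' (d * c)"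

text \<open>A list of pairs \<open>ps\<close> lists \<open>(a_1, b_1), ..., (a_m, b_m)\<close>, so that \<open>prod_list\<close> is the ordered
  alternating product of the centred elements.\<close>

definition inf_free ::
    "(complex \<Rightarrow> 'c::ring_1 \<Rightarrow> 'c) \<Rightarrow> ('c \<Rightarrow> complex) \<Rightarrow> ('c \<Rightarrow> complex) \<Rightarrow> 'c set \<Rightarrow> 'c set \<Rightarrow> bool" where
  "inf_free scl \<tau>' \<tau> \<A> \<B> \<longleftrightarrow>
     (let \<tau>t = (\<lambda>(t::real) c. \<tau> c + of_real t * \<tau>' c) in
      \<forall>ps. ps \<noteq> [] \<and> set ps \<subseteq> \<A> \<times> \<B> \<longrightarrow>
        (\<lambda>t. \<tau>t t (prod_list (map (\<lambda>(a, b). (a - scl (\<tau>t t a) 1) * (b - scl (\<tau>t t b) 1)) ps)))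
          \<in> o[at 0](\<lambda>t. of_real t))"

definition inf_free_families ::
    "(complex \<Rightarrow> 'c::ring_1 \<Rightarrow> 'c) \<Rightarrow> ('c \<Rightarrow> 'c) \<Rightarrow> ('c \<Rightarrow> complex) \<Rightarrow> ('c \<Rightarrow> complex)
      \<Rightarrow> ('i \<Rightarrow> 'c) \<Rightarrow> ('j \<Rightarrow> 'c) \<Rightarrow> bool" where
  "inf_free_families scl star \<tau>' \<tau> x y \<longleftrightarrow>
     inf_free scl \<tau>' \<tau> {ncp_eval scl star x P | P. Poly_Mapping.lookup P [] = 0}
       (range (ncp_eval scl star y))"


section \<open>Trace class operators on a complex Hilbert space\<close>

text \<open>The real inner product, and with it the norm and the topology, is the real part of the
  complex one, which is linear in its second argument. Separability is expressed by the sort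
  \<^class>\<open>second_countable_topology\<close>.\<close>

class complex_hilbert_space = real_inner + complete_space +
  fixes scaleC :: "complex \<Rightarrow> 'a \<Rightarrow> 'a"
    and cinner :: "'a \<Rightarrow> 'a \<Rightarrow> complex"
  assumes scaleC_of_real: "scaleC (of_real r) x = r *\<^sub>R x"
    and scaleC_add_right: "scaleC c (x + y) = scaleC c x + scaleC c y"
    and scaleC_add_left: "scaleC (c + d) x = scaleC c x + scaleC d x"
    and scaleC_scaleC: "scaleC c (scaleC d x) = scaleC (c * d) x"
    and cinner_commute: "cinner x y = cnj (cinner y x)"
    and cinner_add_right: "cinner x (y + z) = cinner x y + cinner x z"
    and cinner_scaleC_right: "cinner x (scaleC c y) = c * cinner x y"
    and inner_eq_Re_cinner: "inner x y = Re (cinner x y)"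

definition bounded_op :: "('h::complex_hilbert_space \<Rightarrow> 'h) \<Rightarrow> bool" where
  "bounded_op a \<longleftrightarrow> bounded_linear a \<and> (\<forall>c x. a (scaleC c x) = scaleC c (a x))"

text \<open>For bounded operators the descriptions below denote unique objects: the adjoint by the
  Riesz representation theorem, \<open>op_abs a\<close> as the positive square root of \<open>a\<^sup>* a\<close>.\<close>

definition op_adj :: "('h::complex_hilbert_space \<Rightarrow> 'h) \<Rightarrow> 'h \<Rightarrow> 'h" where
  "op_adj a = (THE b. \<forall>x y. cinner (a x) y = cinner x (b y))"

definition positive_op :: "('h::complex_hilbert_space \<Rightarrow> 'h) \<Rightarrow> bool" where
  "positive_op a \<longleftrightarrow> bounded_op a \<and> (\<forall>x. cinner x (a x) \<in> \<real> \<and> 0 \<le> Re (cinner x (a x)))"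

definition op_abs :: "('h::complex_hilbert_space \<Rightarrow> 'h) \<Rightarrow> 'h \<Rightarrow> 'h" where
  "op_abs a = (THE b. positive_op b \<and> b \<circ> b = op_adj a \<circ> a)"

definition orthonormal_basis :: "'h::complex_hilbert_space set \<Rightarrow> bool" where
  "orthonormal_basis E \<longleftrightarrow>
     (\<forall>e\<in>E. \<forall>f\<in>E. cinner e f = (if e = f then 1 else 0)) \<and>
     (\<forall>x. (\<forall>e\<in>E. cinner e x = 0) \<longrightarrow> x = 0)"

text \<open>Neither the trace class condition nor the trace depends on the basis.\<close>

definition trace_class :: "('h::complex_hilbert_space \<Rightarrow> 'h) \<Rightarrow> bool" where
  "trace_class a \<longleftrightarrow> bounded_op a \<and>
     (\<exists>E. orthonormal_basis E \<and> (\<lambda>e. cinner e (op_abs a e)) summable_on E)"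

definition op_trace :: "('h::complex_hilbert_space \<Rightarrow> 'h) \<Rightarrow> complex" where
  "op_trace a = infsum (\<lambda>e. cinner e (a e)) (SOME E. orthonormal_basis E)"


section \<open>Matrices and modes of convergence\<close>

definition mat_trace :: "complex mat \<Rightarrow> complex" where
  "mat_trace X = (\<Sum>i<dim_row X. X $$ (i, i))"

definition mat_ntrace :: "complex mat \<Rightarrow> complex" where
  "mat_ntrace X = mat_trace X / of_nat (dim_row X)"

definition mat_word :: "nat \<Rightarrow> ('v \<Rightarrow> complex mat) \<Rightarrow> 'v letter list \<Rightarrow> complex mat" where
  "mat_word n = word_val (*) (1\<^sub>m n) mat_adjoint"

definition ncp_mat :: "nat \<Rightarrow> ('v \<Rightarrow> complex mat) \<Rightarrow> 'v ncpoly \<Rightarrow> complex mat" where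
  "ncp_mat n X P = mat n n (\<lambda>ij. \<Sum>w \<in> Poly_Mapping.keys P.
     Poly_Mapping.lookup P w * (mat_word n X w) $$ ij)"

definition conv_in_distr_Tr ::
    "(nat \<Rightarrow> 'i \<Rightarrow> complex mat) \<Rightarrow> ('i \<Rightarrow> 'h::complex_hilbert_space \<Rightarrow> 'h) \<Rightarrow> bool" where
  "conv_in_distr_Tr A a \<longleftrightarrow> (\<forall>w. w \<noteq> [] \<longrightarrow>
     (\<lambda>n. mat_trace (mat_word n (A n) w)) \<longlonglongrightarrow> op_trace (word_val (\<circ>) id op_adj a w))"

definition conv_in_distr_tr ::
    "(nat \<Rightarrow> 'j \<Rightarrow> complex mat) \<Rightarrow> ('c::ring_1 \<Rightarrow> 'c) \<Rightarrow> ('c \<Rightarrow> complex) \<Rightarrow> ('j \<Rightarrow> 'c) \<Rightarrow> bool" where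
  "conv_in_distr_tr B star \<tau> b \<longleftrightarrow> (\<forall>w. w \<noteq> [] \<longrightarrow>
     (\<lambda>n. mat_ntrace (mat_word n (B n) w)) \<longlonglongrightarrow> \<tau> (word_val (*) 1 star b w))"

definition conv_first_order ::
    "(nat \<Rightarrow> 'j \<Rightarrow> complex mat) \<Rightarrow> (complex \<Rightarrow> 'c::ring_1 \<Rightarrow> 'c) \<Rightarrow> ('c \<Rightarrow> 'c)
      \<Rightarrow> ('c \<Rightarrow> complex) \<Rightarrow> ('c \<Rightarrow> complex) \<Rightarrow> ('j \<Rightarrow> 'c) \<Rightarrow> bool" where
  "conv_first_order B scl star \<tau>' \<tau> b \<longleftrightarrow> conv_in_distr_tr B star \<tau> b \<and>
     (\<forall>Q. (\<lambda>n. of_nat n * (mat_ntrace (ncp_mat n (B n) Q) - \<tau> (ncp_eval scl star b Q)))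
            \<longlonglongrightarrow> \<tau>' (ncp_eval scl star b Q))"


definition conj_family ::
    "('i \<Rightarrow> complex mat) \<Rightarrow> ('j \<Rightarrow> complex mat) \<Rightarrow> complex mat \<Rightarrow> 'i + 'j \<Rightarrow> complex mat" where
  "conj_family A B V = case_sum A (\<lambda>j. V * B j * mat_adjoint V)"


section \<open>Haar unitary random matrices\<close>

definition unitary_group :: "nat \<Rightarrow> complex mat set" where
  "unitary_group n = {V \<in> carrier_mat n n.
     V * mat_adjoint V = 1\<^sub>m n \<and> mat_adjoint V * V = 1\<^sub>m n}"

text \<open>The Borel sigma-algebra of the unitary group, pulled back from the space of
  \<open>n\<times>n\<close> arrays of complex entries; the type of matrices carries no topology.\<close>

definition borel_unitary :: "nat \<Rightarrow> complex mat measure" where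
  "borel_unitary n = vimage_algebra (unitary_group n)
     (\<lambda>V. \<lambda>ij \<in> {..<n} \<times> {..<n}. V $$ ij) (Pi\<^sub>M ({..<n} \<times> {..<n}) (\<lambda>_. borel))"

text \<open>Left invariance suffices: the unitary group is compact, so this measure is unique and
  also right invariant.\<close>

definition normalized_haar :: "nat \<Rightarrow> complex mat measure \<Rightarrow> bool" where
  "normalized_haar n \<mu> \<longleftrightarrow> prob_space \<mu> \<and> sets \<mu> = sets (borel_unitary n) \<and>
     (\<forall>V \<in> unitary_group n. distr \<mu> (borel_unitary n) (\<lambda>W. V * W) = \<mu>)"

definition haar_unitary :: "nat \<Rightarrow> 'w measure \<Rightarrow> ('w \<Rightarrow> complex mat) \<Rightarrow> bool" where
  "haar_unitary n M U \<longleftrightarrow> U \<in> measurable M (borel_unitary n) \<and>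
     normalized_haar n (distr M (borel_unitary n) U)"

end

theory Submission
  imports Defs
begin

text \<open>The left invariance of Haar measure under reflections \<open>1 + z P\<close>, expanded to first order in \<open>z\<close>,
  gives Schwinger--Dyson equations for the tensors
  \<open>T(y, b) = E (\<Prod>i. (U W\<^sub>i U\<^sup>*)(y\<^sub>i, b\<^sub>i))\<close>. When all \<open>W\<^sub>i\<close> have trace zero they show by
  induction that \<open>T\<close> behaves like a combination of permutation tensors with coefficients of order
  \<open>n^(-N/2)\<close>, where \<open>N\<close> is the number of factors. Pairing with matrices \<open>A\<^sub>i\<close> whose Frobenius norms
  and traces are bounded, which is all that is needed of the convergence to trace class operators,
  each permutation tensor contributes a bounded amount. Hence the fourth moment of
  \<open>Tr(A\<^sub>1 U W\<^sub>1 U\<^sup>* \<dots> A\<^sub>m U W\<^sub>m U\<^sup>*)\<close> is summable in \<open>n\<close>; the operator norms of the \<open>W\<^sub>i\<close>, which may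
  grow, are at most of order \<open>n^(1/8)\<close> because their normalized moments are bounded. So these
  traces tend to zero almost surely, and centring the \<open>W\<^sub>i\<close> gives the limit of every mixed word.
  For infinitesimal freeness, \<open>\<tau>\<close> vanishes on the ideal generated by the \<open>x\<^sub>i\<close> and, by the same
  limit, \<open>\<tau>'\<close> vanishes on the alternating products with centred factors.\<close>

section \<open>The Frobenius norm\<close>

text \<open>The \<open>B j\<close> are controlled through normalized moments only, so their operator
  norms may be unbounded; this obstacle fixes the constants. Bounded normalized traces of the fourth
  power of \<open>mat_adjoint W * W\<close> give operator norms of order \<open>n^(1/8)\<close>, so
  a pair \<open>(A, W)\<close> contributes \<open>n^(1/8 - 1/2) = n^(-3/8)\<close>. For a single
  pair a second moment of order \<open>n^(-3/4)\<close> is not summable, whereas the fourth, of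
  order \<open>n^(-3/2)\<close>, is. Permutation coefficients are never computed. The tensor is
  tested against all linear functionals with a common bound on permutation tensors; this class is
  stable under permuting indices, so the permuted terms of the Schwinger--Dyson equation are bounded
  by the same supremum. A contraction creates a product \<open>W k * W p\<close>, whose trace need
  not vanish. Its scalar part removes two matrices at the price of one factor \<open>1 / n\<close>,
  whence the rate \<open>n^(-1/2)\<close> per matrix. In the freeness statement the delicate case is
  a single pair \<open>(a, b)\<close>: there \<open>\<tau>\<close> of the centred product carries
  just one factor \<open>t\<close>, and the missing decay comes from the centring of
  \<open>b\<close>.\<close>

lemma mult_entry:
  assumes "X \<in> carrier_mat n n" "Y \<in> carrier_mat n n" "i < n" "j < n"
  shows "(X * Y) $$ (i, j) = (\<Sum>k<n. X $$ (i, k) * Y $$ (k, j))"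
  using assms by (auto simp: scalar_prod_def lessThan_atLeast0)

lemma adjoint_dim [simp]:
  "dim_row (mat_adjoint X) = dim_col X" "dim_col (mat_adjoint X) = dim_row X"
  by (simp_all add: mat_adjoint_def)

lemma adjoint_carrier [simp]:
  "X \<in> carrier_mat n n \<Longrightarrow> mat_adjoint X \<in> carrier_mat n n"
  by auto

lemma adjoint_entry [simp]:
  "\<lbrakk>i < dim_col X; j < dim_row X\<rbrakk> \<Longrightarrow> mat_adjoint X $$ (i, j) = cnj (X $$ (j, i))"
  by (simp add: mat_adjoint_def mat_of_rows_index)

lemma adjoint_mult:
  fixes X Y :: "complex mat"
  assumes "X \<in> carrier_mat n n" "Y \<in> carrier_mat n n"
  shows "mat_adjoint (X * Y) = mat_adjoint Y * mat_adjoint X"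
proof (rule eq_matI)
  fix i j assume "i < dim_row (mat_adjoint Y * mat_adjoint X)"
    "j < dim_col (mat_adjoint Y * mat_adjoint X)"
  then have ij: "i < n" "j < n" using assms by auto
  have "mat_adjoint (X * Y) $$ (i, j) = cnj ((X * Y) $$ (j, i))" using assms ij by auto
  also have "\<dots> = (\<Sum>k<n. cnj (X $$ (j, k) * Y $$ (k, i)))"
    using assms ij by (simp add: mult_entry[of _ n] del: index_mult_mat(1))
  also have "\<dots> = (\<Sum>k<n. mat_adjoint Y $$ (i, k) * mat_adjoint X $$ (k, j))"
    using assms ij by (intro sum.cong) auto
  also have "\<dots> = (mat_adjoint Y * mat_adjoint X) $$ (i, j)"
    using assms ij by (intro mult_entry[symmetric]) auto
  finally show "mat_adjoint (X * Y) $$ (i, j) = (mat_adjoint Y * mat_adjoint X) $$ (i, j)" .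
qed (use assms in auto)

lemma adjoint_adjoint [simp]: "mat_adjoint (mat_adjoint X) = (X :: complex mat)"
  by (intro eq_matI) auto

lemma adjoint_one [simp]: "mat_adjoint (1\<^sub>m n) = (1\<^sub>m n :: complex mat)"
  by (intro eq_matI) auto

lemma mat_trace_def':
  "X \<in> carrier_mat n n \<Longrightarrow> mat_trace X = (\<Sum>i<n. X $$ (i, i))"
  by (simp add: mat_trace_def)

lemma mat_trace_mult:
  "\<lbrakk>X \<in> carrier_mat n n; Y \<in> carrier_mat n n\<rbrakk> \<Longrightarrow>
    mat_trace (X * Y) = (\<Sum>i<n. \<Sum>k<n. X $$ (i, k) * Y $$ (k, i))"
  by (simp add: mat_trace_def'[of _ n] mult_entry[of _ n] del: index_mult_mat(1))

lemma mat_trace_comm: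
  assumes "X \<in> carrier_mat n n" "Y \<in> carrier_mat n n"
  shows "mat_trace (X * Y) = mat_trace (Y * X)"
  unfolding mat_trace_mult[OF assms] mat_trace_mult[OF assms(2,1)]
  by (subst sum.swap) (simp add: mult.commute)

lemma mat_trace_add:
  "\<lbrakk>X \<in> carrier_mat n n; Y \<in> carrier_mat n n\<rbrakk> \<Longrightarrow>
    mat_trace (X + Y) = mat_trace X + mat_trace Y"
  by (simp add: mat_trace_def'[of _ n] sum.distrib)

lemma mat_trace_smult:
  "X \<in> carrier_mat n n \<Longrightarrow> mat_trace (c \<cdot>\<^sub>m X) = c * mat_trace X"
  by (simp add: mat_trace_def'[of _ n] sum_distrib_left)

lemma mat_trace_one: "mat_trace (1\<^sub>m n) = of_nat n"
  by (simp add: mat_trace_def'[of _ n])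

text \<open>The Hilbert--Schmidt norm. It stays bounded on words in the \<open>A i\<close> because
  their unnormalized traces converge, it is submultiplicative, and it controls traces of
  products.\<close>

definition frob :: "complex mat \<Rightarrow> real" where
  "frob X = L2_set (\<lambda>p. cmod (X $$ p)) ({..<dim_row X} \<times> {..<dim_col X})"

lemma frob_nonneg [simp]: "0 \<le> frob X"
  by (simp add: frob_def L2_set_nonneg)

lemma frob_carrier:
  "X \<in> carrier_mat n n \<Longrightarrow> frob X = L2_set (\<lambda>p. cmod (X $$ p)) ({..<n} \<times> {..<n})"
  by (simp add: frob_def)

lemma frob_sq:
  "X \<in> carrier_mat n n \<Longrightarrow> (frob X)\<^sup>2 = (\<Sum>i<n. \<Sum>j<n. (cmod (X $$ (i, j)))\<^sup>2)"
  by (simp add: frob_carrier L2_set_def sum_nonneg sum.cartesian_product case_prod_unfold)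

lemma frob_add:
  assumes "X \<in> carrier_mat n n" "Y \<in> carrier_mat n n"
  shows "frob (X + Y) \<le> frob X + frob Y"
proof -
  have "frob (X + Y) \<le> L2_set (\<lambda>p. cmod (X $$ p) + cmod (Y $$ p)) ({..<n} \<times> {..<n})"
    using assms
    by (auto simp: frob_carrier[of _ n] intro!: L2_set_mono norm_triangle_ineq)
  also have "\<dots> \<le> frob X + frob Y"
    using assms by (simp add: frob_carrier[of _ n] L2_set_triangle_ineq)
  finally show ?thesis .
qed

lemma frob_smult:
  assumes "X \<in> carrier_mat n n"
  shows "frob (c \<cdot>\<^sub>m X) = cmod c * frob X"
proof -
  have "(frob (c \<cdot>\<^sub>m X))\<^sup>2 = (cmod c * frob X)\<^sup>2"
    using assms
    by (simp add: frob_sq[of _ n] norm_mult power_mult_distrib sum_distrib_left)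
  then show ?thesis by (simp add: power2_eq_iff_nonneg)
qed

lemma frob_adjoint:
  assumes "X \<in> carrier_mat n n"
  shows "frob (mat_adjoint X) = frob X"
proof -
  have "(frob (mat_adjoint X))\<^sup>2 = (\<Sum>i<n. \<Sum>j<n. (cmod (X $$ (j, i)))\<^sup>2)"
    using assms by (simp add: frob_sq[of _ n] adjoint_entry)
  also have "\<dots> = (frob X)\<^sup>2"
    using assms by (subst sum.swap) (simp add: frob_sq[of _ n])
  finally show ?thesis by (simp add: power2_eq_iff_nonneg)
qed

lemma frob_one: "frob (1\<^sub>m n) = sqrt n"
proof -
  have "(frob (1\<^sub>m n))\<^sup>2 = (\<Sum>i<n. \<Sum>j<n. if i = j then 1 else 0)"
    unfolding frob_sq[OF one_carrier_mat] by (intro sum.cong) auto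
  then have "(frob (1\<^sub>m n))\<^sup>2 = real n" by simp
  then show ?thesis by (metis frob_nonneg real_sqrt_unique)
qed

text \<open>Cauchy--Schwarz for the Hilbert--Schmidt pairing. Consequently only the trace of a
  single matrix needs a bound of its own; traces of longer products are covered by Frobenius
  norms.\<close>

lemma mat_trace_mult_le:
  assumes "X \<in> carrier_mat n n" "Y \<in> carrier_mat n n"
  shows "cmod (mat_trace (X * Y)) \<le> frob X * frob Y"
proof -
  let ?P = "{..<n} \<times> {..<n}"
  have "mat_trace (X * Y) = (\<Sum>p\<in>?P. X $$ p * mat_adjoint (mat_adjoint Y) $$ (snd p, fst p))"
    using assms
    by (simp add: mat_trace_mult[of _ n] adjoint_adjoint sum.cartesian_product
        case_prod_unfold)
  also have "\<dots> = (\<Sum>p\<in>?P. X $$ p * cnj (mat_adjoint Y $$ p))"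
    using assms by (intro sum.cong) (auto simp: adjoint_entry)
  also have "cmod \<dots> \<le> (\<Sum>p\<in>?P. \<bar>cmod (X $$ p)\<bar> * \<bar>cmod (mat_adjoint Y $$ p)\<bar>)"
    by (intro sum_norm_le) (simp add: norm_mult)
  also have "\<dots> \<le> frob X * frob (mat_adjoint Y)"
    unfolding frob_carrier[OF assms(1)] frob_carrier[OF adjoint_carrier[OF assms(2)]]
    by (rule L2_set_mult_ineq)
  finally show ?thesis using assms by (simp add: frob_adjoint[of _ n])
qed

lemma frob_mult:
  assumes "X \<in> carrier_mat n n" "Y \<in> carrier_mat n n"
  shows "frob (X * Y) \<le> frob X * frob Y"
proof -
  have "(frob (X * Y))\<^sup>2 = (\<Sum>i<n. \<Sum>j<n. (cmod (\<Sum>k<n. X $$ (i, k) * Y $$ (k, j)))\<^sup>2)"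
    using assms by (simp add: frob_sq[of _ n] mult_entry[of _ n] del: index_mult_mat(1))
  also have "\<dots> \<le> (\<Sum>i<n. \<Sum>j<n. (\<Sum>k<n. (cmod (X $$ (i, k)))\<^sup>2) * (\<Sum>k<n. (cmod (Y $$ (k, j)))\<^sup>2))"
  proof (intro sum_mono)
    fix i j
    have "(cmod (\<Sum>k<n. X $$ (i, k) * Y $$ (k, j)))\<^sup>2
        \<le> (\<Sum>k<n. cmod (X $$ (i, k)) * cmod (Y $$ (k, j)))\<^sup>2"
      by (intro power_mono) (auto intro!: sum_norm_le simp: norm_mult)
    also have "\<dots> \<le> (\<Sum>k<n. (cmod (X $$ (i, k)))\<^sup>2) * (\<Sum>k<n. (cmod (Y $$ (k, j)))\<^sup>2)"
      by (rule Cauchy_Schwarz_ineq_sum)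
    finally show "(cmod (\<Sum>k<n. X $$ (i, k) * Y $$ (k, j)))\<^sup>2
      \<le> (\<Sum>k<n. (cmod (X $$ (i, k)))\<^sup>2) * (\<Sum>k<n. (cmod (Y $$ (k, j)))\<^sup>2)" .
  qed
  also have "\<dots> = (\<Sum>i<n. \<Sum>k<n. (cmod (X $$ (i, k)))\<^sup>2) * (\<Sum>j<n. \<Sum>k<n. (cmod (Y $$ (k, j)))\<^sup>2)"
    by (simp add: sum_product)
  also have "(\<Sum>j<n. \<Sum>k<n. (cmod (Y $$ (k, j)))\<^sup>2) = (frob Y)\<^sup>2"
    using assms by (subst sum.swap) (simp add: frob_sq[of _ n])
  also have "(\<Sum>i<n. \<Sum>k<n. (cmod (X $$ (i, k)))\<^sup>2) * (frob Y)\<^sup>2 = (frob X * frob Y)\<^sup>2"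
    using assms by (simp add: frob_sq[of _ n] power_mult_distrib)
  finally show ?thesis by (rule power2_le_imp_le) simp
qed

lemma mat_trace_adjoint_mult:
  assumes "X \<in> carrier_mat n n"
  shows "mat_trace (mat_adjoint X * X) = complex_of_real ((frob X)\<^sup>2)"
proof -
  have *: "cnj z * z = complex_of_real ((cmod z)\<^sup>2)" for z
    by (metis complex_norm_square mult.commute)
  show ?thesis
    using assms
    by (simp add: mat_trace_mult[of _ n] adjoint_entry * frob_sq[of _ n]
        del: of_real_power) (subst sum.swap, simp)
qed

text \<open>An operator norm bound, phrased as a bound for left multiplication on matrices with the
  Frobenius norm, which has the same norm. \<open>0 \<le> c\<close> is explicit because for
  \<open>n = 0\<close> the inequality does not imply it.\<close>

definition op_bounded :: "nat \<Rightarrow> real \<Rightarrow> complex mat \<Rightarrow> bool" where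
  "op_bounded n c W \<longleftrightarrow> W \<in> carrier_mat n n \<and> 0 \<le> c \<and>
     (\<forall>X \<in> carrier_mat n n. frob (W * X) \<le> c * frob X)"

lemma op_bounded_carrier: "op_bounded n c W \<Longrightarrow> W \<in> carrier_mat n n"
  by (simp add: op_bounded_def)

lemma op_bounded_nonneg: "op_bounded n c W \<Longrightarrow> 0 \<le> c"
  by (simp add: op_bounded_def)

lemma op_boundedD: "\<lbrakk>op_bounded n c W; X \<in> carrier_mat n n\<rbrakk> \<Longrightarrow> frob (W * X) \<le> c * frob X"
  by (simp add: op_bounded_def)

lemma op_bounded_mono: "\<lbrakk>op_bounded n c W; c \<le> d\<rbrakk> \<Longrightarrow> op_bounded n d W"
  unfolding op_bounded_def by (meson frob_nonneg mult_right_mono order_trans)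

lemma op_bounded_mult:
  assumes "op_bounded n c V" "op_bounded n d W"
  shows "op_bounded n (c * d) (V * W)"
  unfolding op_bounded_def
proof (intro conjI ballI)
  note carr = op_bounded_carrier[OF assms(1)] op_bounded_carrier[OF assms(2)]
  note nn = op_bounded_nonneg[OF assms(1)] op_bounded_nonneg[OF assms(2)]
  show "V * W \<in> carrier_mat n n" "0 \<le> c * d" using carr nn by auto
  fix X :: "complex mat" assume X: "X \<in> carrier_mat n n"
  have "frob (V * W * X) = frob (V * (W * X))" using carr X by (simp add: assoc_mult_mat[of _ n n])
  also have "\<dots> \<le> c * frob (W * X)" using carr X by (intro op_boundedD[OF assms(1)]) auto
  also have "\<dots> \<le> c * (d * frob X)"
    using X nn by (intro mult_left_mono op_boundedD[OF assms(2)]) auto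
  finally show "frob (V * W * X) \<le> c * d * frob X" by simp
qed

lemma op_bounded_add:
  assumes "op_bounded n c V" "op_bounded n d W"
  shows "op_bounded n (c + d) (V + W)"
  unfolding op_bounded_def
proof (intro conjI ballI)
  note carr = op_bounded_carrier[OF assms(1)] op_bounded_carrier[OF assms(2)]
  show "V + W \<in> carrier_mat n n" "0 \<le> c + d"
    using carr op_bounded_nonneg[OF assms(1)] op_bounded_nonneg[OF assms(2)] by auto
  fix X :: "complex mat" assume X: "X \<in> carrier_mat n n"
  have "frob ((V + W) * X) = frob (V * X + W * X)"
    using carr X by (simp add: add_mult_distrib_mat[of _ n n])
  also have "\<dots> \<le> frob (V * X) + frob (W * X)" using carr X by (intro frob_add) auto
  also have "\<dots> \<le> c * frob X + d * frob X"
    using X by (intro add_mono op_boundedD[OF assms(1)] op_boundedD[OF assms(2)])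
  finally show "frob ((V + W) * X) \<le> (c + d) * frob X" by (simp add: distrib_right)
qed

lemma op_bounded_smult:
  assumes "op_bounded n c W"
  shows "op_bounded n (cmod z * c) (z \<cdot>\<^sub>m W)"
  unfolding op_bounded_def
proof (intro conjI ballI)
  note carr = op_bounded_carrier[OF assms]
  show "z \<cdot>\<^sub>m W \<in> carrier_mat n n" "0 \<le> cmod z * c"
    using carr op_bounded_nonneg[OF assms] by auto
  fix X :: "complex mat" assume X: "X \<in> carrier_mat n n"
  have "frob ((z \<cdot>\<^sub>m W) * X) = frob (z \<cdot>\<^sub>m (W * X))"
    using carr X by (simp add: mult_smult_assoc_mat[of _ n n])
  also have "\<dots> = cmod z * frob (W * X)" using carr X by (intro frob_smult) auto
  also have "\<dots> \<le> cmod z * (c * frob X)"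
    using X by (intro mult_left_mono op_boundedD[OF assms]) auto
  finally show "frob ((z \<cdot>\<^sub>m W) * X) \<le> cmod z * c * frob X" by simp
qed

lemma op_bounded_one: "op_bounded n 1 (1\<^sub>m n)"
  by (auto simp: op_bounded_def)

text \<open>The trace is the pairing of the identity with \<open>W\<close> times the identity; each
  identity has Frobenius norm \<open>sqrt n\<close>.\<close>

lemma op_bounded_trace:
  assumes "op_bounded n c W"
  shows "cmod (mat_trace W) \<le> c * n"
proof -
  have "cmod (mat_trace W) = cmod (mat_trace (1\<^sub>m n * (W * 1\<^sub>m n)))"
    using op_bounded_carrier[OF assms] by simp
  also have "\<dots> \<le> frob (1\<^sub>m n) * frob (W * 1\<^sub>m n)"
    using op_bounded_carrier[OF assms] by (intro mat_trace_mult_le[of _ n]) auto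
  also have "\<dots> \<le> sqrt n * (c * sqrt n)"
    unfolding frob_one[symmetric] by (intro mult_left_mono op_boundedD[OF assms]) auto
  finally show ?thesis by (simp add: mult.left_commute)
qed

lemma op_bounded_ntrace:
  assumes "op_bounded n c W"
  shows "cmod (mat_ntrace W) \<le> c"
proof (cases "n = 0")
  case True
  then show ?thesis
    using op_bounded_carrier[OF assms] op_bounded_nonneg[OF assms]
    by (simp add: mat_ntrace_def mat_trace_def)
next
  case False
  then show ?thesis
    using op_bounded_trace[OF assms] op_bounded_carrier[OF assms]
    by (simp add: mat_ntrace_def norm_divide divide_le_eq)
qed

definition centre :: "complex mat \<Rightarrow> complex mat" where
  "centre W = W + (- mat_ntrace W) \<cdot>\<^sub>m 1\<^sub>m (dim_row W)"

lemma centre_carrier: "W \<in> carrier_mat n n \<Longrightarrow> centre W \<in> carrier_mat n n"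
  by (auto simp: centre_def)

lemma centre_trace: "W \<in> carrier_mat n n \<Longrightarrow> mat_trace (centre W) = 0"
  by (cases "n = 0")
    (simp_all add: centre_def mat_trace_add[of _ n] mat_trace_smult[of _ n] mat_trace_one
      mat_ntrace_def mat_trace_def'[of _ 0])

lemma centre_decomp:
  "W \<in> carrier_mat n n \<Longrightarrow> W = centre W + mat_ntrace W \<cdot>\<^sub>m 1\<^sub>m n"
  by (intro eq_matI) (auto simp: centre_def)

lemma op_bounded_centre:
  assumes "op_bounded n c W"
  shows "op_bounded n (2 * c) (centre W)"
proof -
  have "op_bounded n (c + cmod (- mat_ntrace W) * 1) (W + (- mat_ntrace W) \<cdot>\<^sub>m 1\<^sub>m n)"
    by (intro op_bounded_add op_bounded_smult assms op_bounded_one)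
  then show ?thesis
    using op_bounded_ntrace[OF assms] op_bounded_carrier[OF assms]
    by (auto simp: centre_def intro: op_bounded_mono)
qed

text \<open>The Cauchy--Schwarz estimate of the squared norm of \<open>Y * X\<close> by the norms of
  \<open>X\<close> and \<open>mat_adjoint Y * Y * X\<close> is used twice, for \<open>Y = W\<close>
  and for \<open>Y = mat_adjoint W * W\<close>; submultiplicativity finishes. Going up to the fourth
  power keeps the loss small when only moments are known.\<close>

lemma op_bounded_of_moment:
  assumes W: "W \<in> carrier_mat n n"
    and c: "0 \<le> c" "frob (mat_adjoint W * W * (mat_adjoint W * W)) \<le> c ^ 4"
  shows "op_bounded n c W"
  unfolding op_bounded_def
proof (intro conjI ballI)
  fix X :: "complex mat" assume X: "X \<in> carrier_mat n n"
  define H where "H = mat_adjoint W * W"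
  have H: "H \<in> carrier_mat n n" using W unfolding H_def by (intro mult_carrier_mat[of _ n n]) auto
  have step: "(frob (Y * X))\<^sup>2 \<le> frob X * frob (mat_adjoint Y * Y * X)"
    if Y: "Y \<in> carrier_mat n n" for Y
  proof -
    have "mat_adjoint (Y * X) * (Y * X) = mat_adjoint X * (mat_adjoint Y * Y * X)"
      using X Y by (simp add: adjoint_mult[of _ n] assoc_mult_mat[of _ n n _ n _ n])
    then have "complex_of_real ((frob (Y * X))\<^sup>2) = mat_trace (mat_adjoint X * (mat_adjoint Y * Y * X))"
      using X Y mat_trace_adjoint_mult[of "Y * X" n] by simp
    then have "(frob (Y * X))\<^sup>2 = cmod (mat_trace (mat_adjoint X * (mat_adjoint Y * Y * X)))"
      by (metis norm_of_real abs_of_nonneg zero_le_power2)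
    also have "\<dots> \<le> frob (mat_adjoint X) * frob (mat_adjoint Y * Y * X)"
      using X Y by (intro mat_trace_mult_le[of _ n]) auto
    finally show ?thesis using X by (simp add: frob_adjoint)
  qed
  have adjH: "mat_adjoint H = H" using W by (simp add: H_def adjoint_mult[of _ n] adjoint_adjoint)
  have "(frob (W * X)) ^ 4 = ((frob (W * X))\<^sup>2)\<^sup>2" by simp
  also have "\<dots> \<le> (frob X * frob (H * X))\<^sup>2"
    using step[OF W] unfolding H_def by (intro power_mono) auto
  also have "\<dots> = (frob X)\<^sup>2 * (frob (H * X))\<^sup>2" by (simp add: power_mult_distrib)
  also have "\<dots> \<le> (frob X)\<^sup>2 * (frob X * frob (H * H * X))"
    using step[OF H] unfolding adjH by (intro mult_left_mono) auto
  also have "\<dots> \<le> (frob X)\<^sup>2 * (frob X * (c ^ 4 * frob X))"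
  proof -
    have "frob (H * H * X) \<le> frob (H * H) * frob X" using H X by (intro frob_mult) auto
    also have "\<dots> \<le> c ^ 4 * frob X" using c(2) by (intro mult_right_mono) (auto simp: H_def)
    finally show ?thesis by (intro mult_left_mono) auto
  qed
  also have "\<dots> = (c * frob X) ^ 4" by (simp add: power_mult_distrib power2_eq_square power4_eq_xxxx)
  finally show "frob (W * X) \<le> c * frob X"
    using c(1) by (metis frob_nonneg mult_nonneg_nonneg power_mono_iff zero_less_numeral)
qed (use assms in auto)

section \<open>Schwinger--Dyson equations for Haar unitary matrices\<close>

abbreviation conj_mat :: "complex mat \<Rightarrow> complex mat \<Rightarrow> complex mat" where
  "conj_mat V W \<equiv> V * W * mat_adjoint V"

lemma unitary_groupD:
  assumes "V \<in> unitary_group n"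
  shows "V \<in> carrier_mat n n" "V * mat_adjoint V = 1\<^sub>m n" "mat_adjoint V * V = 1\<^sub>m n"
  using assms by (auto simp: unitary_group_def)

lemma conj_mat_carrier [simp]:
  "\<lbrakk>V \<in> carrier_mat n n; W \<in> carrier_mat n n\<rbrakk> \<Longrightarrow> conj_mat V W \<in> carrier_mat n n"
  by auto

lemma conj_mat_mult:
  assumes "V \<in> unitary_group n" "W \<in> carrier_mat n n" "W' \<in> carrier_mat n n"
  shows "conj_mat V W * conj_mat V W' = conj_mat V (W * W')"
proof -
  note V = unitary_groupD[OF assms(1)]
  have "conj_mat V W * conj_mat V W' = V * W * (mat_adjoint V * V) * W' * mat_adjoint V"
    using V(1) assms by (simp add: assoc_mult_mat[of _ n n _ n _ n] mult_carrier_mat[of _ n n])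
  then show ?thesis
    using V assms by (simp add: assoc_mult_mat[of _ n n _ n _ n] mult_carrier_mat[of _ n n])
qed

lemma conj_mat_one: "V \<in> unitary_group n \<Longrightarrow> conj_mat V (1\<^sub>m n) = 1\<^sub>m n"
  using unitary_groupD[of V n] by simp

lemma conj_mat_add:
  "\<lbrakk>V \<in> carrier_mat n n; W \<in> carrier_mat n n; W' \<in> carrier_mat n n\<rbrakk> \<Longrightarrow>
    conj_mat V (W + W') = conj_mat V W + conj_mat V W'"
  by (simp add: mult_add_distrib_mat[of _ n n _ n] add_mult_distrib_mat[of _ n n _ _ n]
      mult_carrier_mat[of _ n n])

lemma conj_mat_smult:
  "\<lbrakk>V \<in> carrier_mat n n; W \<in> carrier_mat n n\<rbrakk> \<Longrightarrow>
    conj_mat V (c \<cdot>\<^sub>m W) = c \<cdot>\<^sub>m conj_mat V W"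
  by (simp add: mult_smult_distrib[of _ n n] mult_smult_assoc_mat[of _ n n _ n])

lemma conj_mat_adjoint:
  "\<lbrakk>V \<in> carrier_mat n n; W \<in> carrier_mat n n\<rbrakk> \<Longrightarrow>
    mat_adjoint (conj_mat V W) = conj_mat V (mat_adjoint W)"
  by (simp add: adjoint_mult[of _ n] assoc_mult_mat[of _ n n _ n _ n] mult_carrier_mat[of _ n n])

lemma conj_mat_trace:
  assumes "V \<in> unitary_group n" "W \<in> carrier_mat n n"
  shows "mat_trace (conj_mat V W) = mat_trace W"
proof -
  note V = unitary_groupD[OF assms(1)]
  have "mat_trace (conj_mat V W) = mat_trace (mat_adjoint V * (V * W))"
    using V assms by (intro mat_trace_comm[of _ n]) auto
  also have "mat_adjoint V * (V * W) = (mat_adjoint V * V) * W"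
    using V(1) assms by (intro assoc_mult_mat[symmetric]) auto
  finally show ?thesis using V assms by simp
qed

lemma entry_le_frob:
  assumes "X \<in> carrier_mat n n" "i < n" "j < n"
  shows "cmod (X $$ (i, j)) \<le> frob X"
  unfolding frob_carrier[OF assms(1)] using assms by (intro member_le_L2_set) auto

lemma frob_unitary:
  assumes "V \<in> unitary_group n"
  shows "frob V = sqrt n"
proof -
  have "complex_of_real ((frob V)\<^sup>2) = of_real (real n)"
    using mat_trace_adjoint_mult[of V n] unitary_groupD[OF assms] by (simp add: mat_trace_one)
  then have "(frob V)\<^sup>2 = real n" by (simp only: of_real_eq_iff)
  then show ?thesis by (metis frob_nonneg real_sqrt_unique)
qed

lemma frob_conj_mat:
  assumes "V \<in> unitary_group n" "W \<in> carrier_mat n n"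
  shows "frob (conj_mat V W) \<le> n * frob W"
proof -
  note V = unitary_groupD[OF assms(1)]
  have "frob (conj_mat V W) \<le> frob (V * W) * frob (mat_adjoint V)"
    using V assms by (intro frob_mult[of _ n]) auto
  also have "\<dots> \<le> (frob V * frob W) * frob V"
    using V assms by (auto simp: frob_adjoint[of _ n] intro!: mult_right_mono frob_mult[of _ n])
  finally show ?thesis by (simp add: frob_unitary[OF assms(1)] mult.commute mult.left_commute)
qed

lemma unitary_mult:
  assumes "R \<in> unitary_group n" "V \<in> unitary_group n"
  shows "R * V \<in> unitary_group n"
proof -
  note R = unitary_groupD[OF assms(1)] and V = unitary_groupD[OF assms(2)]
  have "R * V * (mat_adjoint V * mat_adjoint R) = R * (V * mat_adjoint V) * mat_adjoint R"
    using R(1) V(1) by (simp add: assoc_mult_mat[of _ n n _ n _ n] mult_carrier_mat[of _ n n])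
  moreover have "mat_adjoint V * mat_adjoint R * (R * V) = mat_adjoint V * (mat_adjoint R * R) * V"
    using R(1) V(1) by (simp add: assoc_mult_mat[of _ n n _ n _ n] mult_carrier_mat[of _ n n])
  ultimately show ?thesis
    using R V by (auto simp: unitary_group_def adjoint_mult[of _ n])
qed

lemma space_borel_unitary [simp]: "space (borel_unitary n) = unitary_group n"
  by (simp add: borel_unitary_def)

lemma measurable_unitary_entry:
  assumes "i < n" "j < n"
  shows "(\<lambda>V. V $$ (i, j)) \<in> borel_measurable (borel_unitary n)"
proof -
  let ?f = "\<lambda>V :: complex mat. \<lambda>ij \<in> {..<n} \<times> {..<n}. V $$ ij"
  have "?f \<in> measurable (borel_unitary n) (Pi\<^sub>M ({..<n} \<times> {..<n}) (\<lambda>_. borel))"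
    unfolding borel_unitary_def by (rule measurable_vimage_algebra1) (auto simp: space_PiM)
  moreover have "(\<lambda>x. x (i, j)) \<in> measurable (Pi\<^sub>M ({..<n} \<times> {..<n}) (\<lambda>_. borel)) borel"
    using assms by (intro measurable_component_singleton) auto
  ultimately have "(\<lambda>V. ?f V (i, j)) \<in> borel_measurable (borel_unitary n)"
    by (rule measurable_compose)
  then show ?thesis using assms by simp
qed

lemma measurable_unitaryI:
  assumes "\<And>x. x \<in> space N \<Longrightarrow> g x \<in> unitary_group n"
    and "\<And>i j. \<lbrakk>i < n; j < n\<rbrakk> \<Longrightarrow> (\<lambda>x. g x $$ (i, j)) \<in> borel_measurable N"
  shows "g \<in> measurable N (borel_unitary n)"
  unfolding borel_unitary_def
  by (rule measurable_vimage_algebra2) (use assms in \<open>auto intro!: measurable_restrict\<close>)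

lemma measurable_unitary_mult:
  assumes "R \<in> unitary_group n"
  shows "(\<lambda>V. R * V) \<in> measurable (borel_unitary n) (borel_unitary n)"
proof (rule measurable_unitaryI)
  fix i j assume ij: "i < n" "j < n"
  have "(\<lambda>V. \<Sum>k<n. R $$ (i, k) * V $$ (k, j)) \<in> borel_measurable (borel_unitary n)"
    using ij by (intro borel_measurable_sum borel_measurable_times measurable_unitary_entry) auto
  then show "(\<lambda>V. (R * V) $$ (i, j)) \<in> borel_measurable (borel_unitary n)"
    using ij unitary_groupD(1)[OF assms]
    by (subst measurable_cong[of _ _ "\<lambda>V. \<Sum>k<n. R $$ (i, k) * V $$ (k, j)"])
      (auto dest!: unitary_groupD(1) simp: mult_entry[of _ n] simp del: index_mult_mat(1))
qed (use assms unitary_mult in auto)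

lemma conj_mat_entry:
  assumes "V \<in> carrier_mat n n" "W \<in> carrier_mat n n" "i < n" "j < n"
  shows "conj_mat V W $$ (i, j) = (\<Sum>l<n. (\<Sum>k<n. V $$ (i, k) * W $$ (k, l)) * cnj (V $$ (j, l)))"
  using assms
  by (subst mult_entry[of _ n]) (auto simp: mult_entry[of _ n] simp del: index_mult_mat(1) intro!: sum.cong)

lemma measurable_conj_mat_entry:
  assumes "W \<in> carrier_mat n n" "i < n" "j < n"
  shows "(\<lambda>V. conj_mat V W $$ (i, j)) \<in> borel_measurable (borel_unitary n)"
proof -
  have "(\<lambda>V. \<Sum>l<n. (\<Sum>k<n. V $$ (i, k) * W $$ (k, l)) * cnj (V $$ (j, l)))
      \<in> borel_measurable (borel_unitary n)"
    using assms
    by (intro borel_measurable_sum borel_measurable_times measurable_unitary_entry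
        borel_measurable_const measurable_compose[OF measurable_unitary_entry]
        borel_measurable_continuous_onI continuous_intros) auto
  then show ?thesis
    by (subst measurable_cong[OF conj_mat_entry]) (use assms unitary_groupD(1) in auto)
qed

section \<open>Mixed moments and first-order expansions\<close>

definition mixed_moment ::
    "complex mat measure \<Rightarrow> 'i set \<Rightarrow> ('i \<Rightarrow> complex mat) \<Rightarrow> ('i \<Rightarrow> nat) \<Rightarrow> ('i \<Rightarrow> nat) \<Rightarrow> complex" where
  "mixed_moment \<mu> I W y b = (\<integral>V. (\<Prod>i\<in>I. conj_mat V (W i) $$ (y i, b i)) \<partial>\<mu>)"

text \<open>An expansion uniform on the unitary group, along the circle \<open>|1 + z| = 1\<close>
  only. On this circle \<open>cnj z\<close> is \<open>- z\<close> up to \<open>|z|^2\<close>, so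
  expressions in \<open>z\<close> and its conjugate still have a single coefficient
  \<open>\<psi>1\<close>.\<close>

definition first_order ::
    "nat \<Rightarrow> (complex \<Rightarrow> complex mat \<Rightarrow> complex) \<Rightarrow> (complex mat \<Rightarrow> complex) \<Rightarrow> (complex mat \<Rightarrow> complex) \<Rightarrow> bool" where
  "first_order n \<psi> \<psi>0 \<psi>1 \<longleftrightarrow> (\<exists>K\<ge>0. \<forall>V \<in> unitary_group n. cmod (\<psi>0 V) \<le> K \<and> cmod (\<psi>1 V) \<le> K \<and>
     (\<forall>z. cmod (1 + z) = 1 \<longrightarrow> cmod z \<le> 1 \<longrightarrow> cmod (\<psi> z V - \<psi>0 V - z * \<psi>1 V) \<le> K * (cmod z)\<^sup>2))"

lemma first_order_const: "first_order n (\<lambda>z V. 1) (\<lambda>V. 1) (\<lambda>V. 0)"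
  unfolding first_order_def by (rule exI[of _ 1]) auto

lemma first_order_mult:
  assumes "first_order n \<psi> \<psi>0 \<psi>1" "first_order n \<xi> \<xi>0 \<xi>1"
  shows "first_order n (\<lambda>z V. \<psi> z V * \<xi> z V) (\<lambda>V. \<psi>0 V * \<xi>0 V) (\<lambda>V. \<psi>1 V * \<xi>0 V + \<psi>0 V * \<xi>1 V)"
proof -
  from assms(1) obtain K where K: "0 \<le> K" and *: "\<And>V. V \<in> unitary_group n \<Longrightarrow> cmod (\<psi>0 V) \<le> K"
    "\<And>V. V \<in> unitary_group n \<Longrightarrow> cmod (\<psi>1 V) \<le> K"
    "\<And>V z. \<lbrakk>V \<in> unitary_group n; cmod (1 + z) = 1; cmod z \<le> 1\<rbrakk> \<Longrightarrow>
       cmod (\<psi> z V - \<psi>0 V - z * \<psi>1 V) \<le> K * (cmod z)\<^sup>2"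
    unfolding first_order_def by auto
  from assms(2) obtain L where L: "0 \<le> L" and **: "\<And>V. V \<in> unitary_group n \<Longrightarrow> cmod (\<xi>0 V) \<le> L"
    "\<And>V. V \<in> unitary_group n \<Longrightarrow> cmod (\<xi>1 V) \<le> L"
    "\<And>V z. \<lbrakk>V \<in> unitary_group n; cmod (1 + z) = 1; cmod z \<le> 1\<rbrakk> \<Longrightarrow>
       cmod (\<xi> z V - \<xi>0 V - z * \<xi>1 V) \<le> L * (cmod z)\<^sup>2"
    unfolding first_order_def by auto
  show ?thesis
    unfolding first_order_def
  \<comment> \<open>The remainder of the product splits into four terms, bounded by
    \<open>1\<close>, \<open>2\<close>, \<open>2\<close> and \<open>1\<close> times
    \<open>K * L * |z|^2\<close>; the factors \<open>2\<close> bound a value plus its first-order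
    term for \<open>|z| \<le> 1\<close>.\<close>
  proof (intro exI[of _ "6 * (K * L)"] conjI ballI allI impI)
    show "0 \<le> 6 * (K * L)" using K L by simp
    fix V assume V: "V \<in> unitary_group n"
    note a = *(1)[OF V] *(2)[OF V] and b = **(1)[OF V] **(2)[OF V]
    have KL: "0 \<le> K * L" using K L by simp
    show "cmod (\<psi>0 V * \<xi>0 V) \<le> 6 * (K * L)"
      using mult_mono[OF a(1) b(1) K norm_ge_zero] KL by (simp add: norm_mult)
    show "cmod (\<psi>1 V * \<xi>0 V + \<psi>0 V * \<xi>1 V) \<le> 6 * (K * L)"
      using mult_mono[OF a(2) b(1) K norm_ge_zero] mult_mono[OF a(1) b(2) K norm_ge_zero] KL
        norm_triangle_ineq[of "\<psi>1 V * \<xi>0 V" "\<psi>0 V * \<xi>1 V"] by (simp add: norm_mult)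
    fix z assume z: "cmod (1 + z) = 1" "cmod z \<le> 1"
    define r where "r = \<psi> z V - \<psi>0 V - z * \<psi>1 V"
    define s where "s = \<xi> z V - \<xi>0 V - z * \<xi>1 V"
    let ?q = "(cmod z)\<^sup>2"
    have r: "cmod r \<le> K * ?q" using *(3)[OF V z] by (simp add: r_def)
    have s: "cmod s \<le> L * ?q" using **(3)[OF V z] by (simp add: s_def)
    have q: "0 \<le> ?q" "?q \<le> 1" using z by (auto simp: power_le_one)
    have pr: "cmod z * cmod (\<psi>1 V) \<le> K" using z(2) a(2) K
      by (metis mult_mono mult_1 norm_ge_zero zero_le_one)
    have pr': "cmod (\<psi>0 V + z * \<psi>1 V) \<le> 2 * K"
      using norm_triangle_ineq[of "\<psi>0 V" "z * \<psi>1 V"] a(1) pr by (simp add: norm_mult)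
    have ps: "cmod z * cmod (\<xi>1 V) \<le> L" using z(2) b(2) L
      by (metis mult_mono mult_1 norm_ge_zero zero_le_one)
    have ps': "cmod (\<xi>0 V + z * \<xi>1 V) \<le> 2 * L"
      using norm_triangle_ineq[of "\<xi>0 V" "z * \<xi>1 V"] b(1) ps by (simp add: norm_mult)
    have eq: "\<psi> z V * \<xi> z V - \<psi>0 V * \<xi>0 V - z * (\<psi>1 V * \<xi>0 V + \<psi>0 V * \<xi>1 V)
      = z\<^sup>2 * (\<psi>1 V * \<xi>1 V) + (\<psi>0 V + z * \<psi>1 V) * s + r * (\<xi>0 V + z * \<xi>1 V) + r * s"
      by (simp add: r_def s_def algebra_simps power2_eq_square)
    have 1: "cmod (z\<^sup>2 * (\<psi>1 V * \<xi>1 V)) \<le> ?q * (K * L)"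
      using mult_mono[OF a(2) b(2) K norm_ge_zero] by (simp add: norm_mult norm_power mult_left_mono)
    have 2: "cmod ((\<psi>0 V + z * \<psi>1 V) * s) \<le> (2 * K) * (L * ?q)"
      using mult_mono[OF pr' s] K by (simp add: norm_mult)
    have 3: "cmod (r * (\<xi>0 V + z * \<xi>1 V)) \<le> (K * ?q) * (2 * L)"
      using mult_mono[OF r ps'] K by (simp add: norm_mult)
    have "cmod (r * s) \<le> (K * ?q) * (L * ?q)"
      using mult_mono[OF r s] K by (simp add: norm_mult)
    also have "\<dots> = (K * L * ?q) * ?q" by simp
    also have "\<dots> \<le> (K * L * ?q) * 1" using KL q by (intro mult_left_mono) auto
    finally have 4: "cmod (r * s) \<le> K * L * ?q" by simp
    have "cmod (z\<^sup>2 * (\<psi>1 V * \<xi>1 V) + (\<psi>0 V + z * \<psi>1 V) * s + r * (\<xi>0 V + z * \<xi>1 V) + r * s)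
      \<le> ?q * (K * L) + (2 * K) * (L * ?q) + (K * ?q) * (2 * L) + K * L * ?q"
      by (intro order_trans[OF norm_triangle_ineq] add_mono 1 2 3 4)
    also have "\<dots> = 6 * (K * L) * ?q" by simp
    finally show "cmod (\<psi> z V * \<xi> z V - \<psi>0 V * \<xi>0 V - z * (\<psi>1 V * \<xi>0 V + \<psi>0 V * \<xi>1 V))
      \<le> 6 * (K * L) * ?q" unfolding eq .
  qed
qed

lemma first_order_prod:
  assumes "finite I" "\<And>i. i \<in> I \<Longrightarrow> first_order n (\<psi> i) (\<psi>0 i) (\<psi>1 i)"
  shows "first_order n (\<lambda>z V. \<Prod>i\<in>I. \<psi> i z V) (\<lambda>V. \<Prod>i\<in>I. \<psi>0 i V)
    (\<lambda>V. \<Sum>i\<in>I. \<psi>1 i V * (\<Prod>j\<in>I - {i}. \<psi>0 j V))"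
  using assms
proof (induction I rule: finite_induct)
  case empty
  then show ?case by (simp add: first_order_const)
next
  case (insert a I)
  have "(\<Sum>i\<in>insert a I. \<psi>1 i V * (\<Prod>j\<in>insert a I - {i}. \<psi>0 j V))
    = \<psi>1 a V * (\<Prod>i\<in>I. \<psi>0 i V) + \<psi>0 a V * (\<Sum>i\<in>I. \<psi>1 i V * (\<Prod>j\<in>I - {i}. \<psi>0 j V))" for V
  proof -
    have "(\<Prod>j\<in>insert a I - {i}. \<psi>0 j V) = \<psi>0 a V * (\<Prod>j\<in>I - {i}. \<psi>0 j V)" if "i \<in> I" for i
    proof -
      have "insert a I - {i} = insert a (I - {i})" using insert.hyps that by auto
      then show ?thesis using insert.hyps by simp
    qed
    then have "(\<Sum>i\<in>I. \<psi>1 i V * (\<Prod>j\<in>insert a I - {i}. \<psi>0 j V))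
      = \<psi>0 a V * (\<Sum>i\<in>I. \<psi>1 i V * (\<Prod>j\<in>I - {i}. \<psi>0 j V))"
      by (simp add: sum_distrib_left mult.left_commute)
    moreover have "insert a I - {a} = I" using insert.hyps by auto
    ultimately show ?thesis using insert.hyps by simp
  qed
  moreover have "first_order n (\<lambda>z V. \<psi> a z V * (\<Prod>i\<in>I. \<psi> i z V)) (\<lambda>V. \<psi>0 a V * (\<Prod>i\<in>I. \<psi>0 i V))
    (\<lambda>V. \<psi>1 a V * (\<Prod>i\<in>I. \<psi>0 i V) + \<psi>0 a V * (\<Sum>i\<in>I. \<psi>1 i V * (\<Prod>j\<in>I - {i}. \<psi>0 j V)))"
    using insert by (intro first_order_mult) auto
  ultimately show ?case using insert.hyps by simp
qed

text \<open>An entry of the commutator of \<open>Z\<close> and \<open>Y\<close>. Keeping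
  \<open>Z\<close> as a function of two indices lets linear combinations and matrix units be
  inserted directly.\<close>

definition entry_commutator ::
    "nat \<Rightarrow> (nat \<Rightarrow> nat \<Rightarrow> complex) \<Rightarrow> complex mat \<Rightarrow> nat \<Rightarrow> nat \<Rightarrow> complex" where
  "entry_commutator n Z Y r s = (\<Sum>c<n. Z r c * Y $$ (c, s)) - (\<Sum>c<n. Y $$ (r, c) * Z c s)"

lemma entry_commutator_mat:
  assumes "Y \<in> carrier_mat n n" "r < n" "s < n"
  shows "entry_commutator n Z Y r s = (mat n n (\<lambda>(r, s). Z r s) * Y) $$ (r, s) - (Y * mat n n (\<lambda>(r, s). Z r s)) $$ (r, s)"
  using assms by (simp add: entry_commutator_def mult_entry[of _ n] del: index_mult_mat(1))

lemma entry_commutator_unit: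
  assumes "p < n" "q < n"
  shows "entry_commutator n (\<lambda>r s. if r = p \<and> s = q then 1 else 0) Y r s
    = (if r = p then Y $$ (q, s) else 0) - (if s = q then Y $$ (r, p) else 0)"
proof -
  have "(\<Sum>c<n. (if r = p \<and> c = q then 1 else 0) * Y $$ (c, s))
      = (\<Sum>c<n. if c = q then (if r = p then Y $$ (q, s) else 0) else 0)"
    by (intro sum.cong) auto
  moreover have "(\<Sum>c<n. Y $$ (r, c) * (if c = p \<and> s = q then 1 else 0))
      = (\<Sum>c<n. if c = p then (if s = q then Y $$ (r, p) else 0) else 0)"
    by (intro sum.cong) auto
  ultimately show ?thesis using assms by (simp add: entry_commutator_def)
qed

text \<open>For a projection \<open>P\<close> and \<open>|1 + z| = 1\<close>, the matrix \<open>1 + z P\<close> is unitary, and conjugation by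
  it is the identity plus \<open>z [P, -]\<close> up to terms of order \<open>|z|^2\<close>, because \<open>cnj z = - z - |z|^2\<close>.\<close>

lemma reflection:
  fixes P :: "complex mat"
  assumes P: "P \<in> carrier_mat n n" "mat_adjoint P = P" "P * P = P" and z: "cmod (1 + z) = 1"
  shows "1\<^sub>m n + z \<cdot>\<^sub>m P \<in> unitary_group n"
    and "Y \<in> carrier_mat n n \<Longrightarrow> r < n \<Longrightarrow> s < n \<Longrightarrow>
      conj_mat (1\<^sub>m n + z \<cdot>\<^sub>m P) Y $$ (r, s) - Y $$ (r, s) - z * ((P * Y) $$ (r, s) - (Y * P) $$ (r, s))
        = of_real ((cmod z)\<^sup>2) * ((P * Y * P) $$ (r, s) - (Y * P) $$ (r, s))"
proof -
  let ?R = "1\<^sub>m n + z \<cdot>\<^sub>m P"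
  have adj: "mat_adjoint ?R = 1\<^sub>m n + cnj z \<cdot>\<^sub>m P"
  proof (rule eq_matI)
    fix i j assume "i < dim_row (1\<^sub>m n + cnj z \<cdot>\<^sub>m P)" "j < dim_col (1\<^sub>m n + cnj z \<cdot>\<^sub>m P)"
    then have ij: "i < n" "j < n" using P by auto
    then have "cnj (P $$ (j, i)) = P $$ (i, j)"
      using P(1) adjoint_entry[of i P j] unfolding P(2) by auto
    then show "mat_adjoint ?R $$ (i, j) = (1\<^sub>m n + cnj z \<cdot>\<^sub>m P) $$ (i, j)"
      using P(1) ij by auto
  qed (use P in auto)
  have "(cmod (1 + z))\<^sup>2 = 1" using z by simp
  then have "(1 + z) * cnj (1 + z) = 1" by (simp add: complex_norm_square[symmetric] del: complex_cnj_add)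
  then have zz: "z + cnj z + z * cnj z = 0" by (simp add: algebra_simps)
  \<comment> \<open>As \<open>P\<close> is idempotent, matrices \<open>1 + x P\<close> are closed
    under multiplication. For \<open>x = z\<close> and \<open>y = cnj z\<close> the resulting
    coefficient vanishes by \<open>zz\<close>.\<close>
  have prod: "(1\<^sub>m n + x \<cdot>\<^sub>m P) * (1\<^sub>m n + y \<cdot>\<^sub>m P) = 1\<^sub>m n + (x + y + x * y) \<cdot>\<^sub>m P" for x y
    using P(1,3)
    by (simp add: mult_add_distrib_mat[of _ n n _ n] add_mult_distrib_mat[of _ n n _ _ n]
        mult_carrier_mat[of _ n n] mult_smult_distrib[of _ n n _ n] mult_smult_assoc_mat[of _ n n _ n])
      (intro eq_matI, auto simp: algebra_simps)
  have zero: "1\<^sub>m n + (0::complex) \<cdot>\<^sub>m P = 1\<^sub>m n" using P(1) by (intro eq_matI) auto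
  show "?R \<in> unitary_group n"
    using P(1) zz by (simp add: unitary_group_def adj prod zero) (simp add: add.commute mult.commute zero)
  assume Y: "Y \<in> carrier_mat n n" and rs: "r < n" "s < n"
  have PY: "P * Y \<in> carrier_mat n n" "Y * P \<in> carrier_mat n n" "P * Y * P \<in> carrier_mat n n"
    using P Y by auto
  have "conj_mat ?R Y = (Y + z \<cdot>\<^sub>m (P * Y)) + cnj z \<cdot>\<^sub>m (Y * P + z \<cdot>\<^sub>m (P * Y * P))"
    unfolding adj using P Y PY
    by (simp add: mult_add_distrib_mat[of _ n n _ n] add_mult_distrib_mat[of _ n n _ _ n]
        mult_smult_distrib[of _ n n _ n] mult_smult_assoc_mat[of _ n n _ n])
  then have "conj_mat ?R Y $$ (r, s) = Y $$ (r, s) + z * (P * Y) $$ (r, s)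
      + cnj z * ((Y * P) $$ (r, s) + z * (P * Y * P) $$ (r, s))"
    using P Y PY rs by (simp del: index_mult_mat(1))
  then have e: "conj_mat ?R Y $$ (r, s) = Y $$ (r, s) + z * (P * Y) $$ (r, s)
      + cnj z * (Y * P) $$ (r, s) + cnj z * z * (P * Y * P) $$ (r, s)"
    by (simp add: algebra_simps)
  have "z * cnj z = of_real ((cmod z)\<^sup>2)" by (simp add: complex_norm_square[symmetric])
  then have c: "cnj z * z = of_real ((cmod z)\<^sup>2)" "cnj z = - z - of_real ((cmod z)\<^sup>2)"
    using zz by (simp_all add: algebra_simps add_eq_0_iff)
  show "conj_mat ?R Y $$ (r, s) - Y $$ (r, s) - z * ((P * Y) $$ (r, s) - (Y * P) $$ (r, s))
      = of_real ((cmod z)\<^sup>2) * ((P * Y * P) $$ (r, s) - (Y * P) $$ (r, s))"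
    unfolding e c(1) unfolding c(2) by (simp add: algebra_simps)
qed

text \<open>The witness is \<open>cis t - 1\<close> for small \<open>t\<close>; the restriction
  \<open>0 < t < pi\<close> makes \<open>sin t\<close> positive and hence \<open>z\<close>
  nonzero.\<close>

lemma small_reflection_coefficient:
  assumes "0 < e"
  shows "\<exists>z. cmod (1 + z) = 1 \<and> 0 < cmod z \<and> cmod z \<le> e"
proof -
  have "((\<lambda>t. cis t - 1) \<longlongrightarrow> cis 0 - 1) (at_right 0)"
    by (intro tendsto_intros continuous_within_tendsto_compose')
      (auto simp: cis.code intro!: tendsto_eq_intros)
  then have "\<forall>\<^sub>F t in at_right 0. cmod (cis t - 1) < e"
    using assms by (auto simp: tendsto_iff)
  moreover have "\<forall>\<^sub>F t in at_right (0::real). t \<in> {0<..<pi}"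
    by (rule eventually_at_right_real) simp
  ultimately have "\<forall>\<^sub>F t in at_right 0. cmod (cis t - 1) < e \<and> t \<in> {0<..<pi}"
    by (rule eventually_conj)
  then obtain t where t: "cmod (cis t - 1) < e" "0 < t" "t < pi"
    using eventually_happens'[OF trivial_limit_at_right_real] by fastforce
  have "sin t > 0" using t by (intro sin_gt_zero) auto
  then have "cis t \<noteq> 1" by (auto simp: complex_eq_iff)
  then show ?thesis using t by (intro exI[of _ "cis t - 1"]) auto
qed

section \<open>Integration with respect to Haar measure\<close>

locale haar_measure =
  fixes n :: nat and \<mu> :: "complex mat measure"
  assumes normalized: "normalized_haar n \<mu>"
begin

lemma prob: "prob_space \<mu>" and sets_eq [measurable_cong]: "sets \<mu> = sets (borel_unitary n)"
  and invariant: "V \<in> unitary_group n \<Longrightarrow> distr \<mu> (borel_unitary n) (\<lambda>W. V * W) = \<mu>"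
  using normalized by (auto simp: normalized_haar_def)

lemma space_eq: "space \<mu> = unitary_group n"
  using sets_eq_imp_space_eq[OF sets_eq] by simp

lemma measurable_eq: "measurable \<mu> N = measurable (borel_unitary n) N"
  by (rule measurable_cong_sets[OF sets_eq refl])

lemma integral_translate:
  fixes f :: "complex mat \<Rightarrow> complex"
  assumes "R \<in> unitary_group n" "f \<in> borel_measurable (borel_unitary n)"
  shows "(\<integral>V. f (R * V) \<partial>\<mu>) = (\<integral>V. f V \<partial>\<mu>)"
proof -
  have "(\<integral>V. f V \<partial>\<mu>) = (\<integral>V. f V \<partial>(distr \<mu> (borel_unitary n) (\<lambda>W. R * W)))"
    using invariant[OF assms(1)] by simp
  also have "\<dots> = (\<integral>V. f (R * V) \<partial>\<mu>)"
    using assms by (intro integral_distr) (simp_all add: measurable_eq measurable_unitary_mult)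
  finally show ?thesis by simp
qed

lemma integrable_bounded:
  fixes f :: "complex mat \<Rightarrow> complex"
  assumes "f \<in> borel_measurable (borel_unitary n)" "\<And>V. V \<in> unitary_group n \<Longrightarrow> cmod (f V) \<le> K"
  shows "integrable \<mu> f"
proof -
  interpret prob_space \<mu> by (rule prob)
  show ?thesis
    by (rule integrable_const_bound[where B = K]) (use assms in \<open>auto simp: measurable_eq space_eq\<close>)
qed

lemma integral_norm_le:
  fixes f :: "complex mat \<Rightarrow> complex"
  assumes "f \<in> borel_measurable (borel_unitary n)" "\<And>V. V \<in> unitary_group n \<Longrightarrow> cmod (f V) \<le> K"
  shows "cmod (\<integral>V. f V \<partial>\<mu>) \<le> K"
proof -
  interpret prob_space \<mu> by (rule prob)
  have "cmod (\<integral>V. f V \<partial>\<mu>) \<le> (\<integral>V. cmod (f V) \<partial>\<mu>)" by simp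
  also have "\<dots> \<le> (\<integral>V. K \<partial>\<mu>)"
    using assms by (intro integral_mono integrable_norm integrable_bounded[OF assms]) (auto simp: space_eq)
  finally show ?thesis by (simp add: prob_space)
qed

text \<open>Integrating the expansion, the values at \<open>z\<close> and at \<open>0\<close>
  cancel, so \<open>z\<close> times the integral of \<open>\<psi>1\<close> equals a remainder of
  size at most \<open>K * |z|^2\<close>. Division by \<open>|z|\<close> and arbitrarily small
  admissible \<open>z\<close> give zero.\<close>

lemma first_order_integral_zero:
  assumes fo: "first_order n \<psi> \<psi>0 \<psi>1"
    and meas: "\<And>z. cmod (1 + z) = 1 \<Longrightarrow> \<psi> z \<in> borel_measurable (borel_unitary n)"
      "\<psi>0 \<in> borel_measurable (borel_unitary n)" "\<psi>1 \<in> borel_measurable (borel_unitary n)"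
    and inv: "\<And>z. cmod (1 + z) = 1 \<Longrightarrow> (\<integral>V. \<psi> z V \<partial>\<mu>) = (\<integral>V. \<psi>0 V \<partial>\<mu>)"
  shows "(\<integral>V. \<psi>1 V \<partial>\<mu>) = 0"
proof -
  from fo obtain K where K: "0 \<le> K" and b0: "\<And>V. V \<in> unitary_group n \<Longrightarrow> cmod (\<psi>0 V) \<le> K"
    and b1: "\<And>V. V \<in> unitary_group n \<Longrightarrow> cmod (\<psi>1 V) \<le> K"
    and b2: "\<And>V z. \<lbrakk>V \<in> unitary_group n; cmod (1 + z) = 1; cmod z \<le> 1\<rbrakk> \<Longrightarrow>
       cmod (\<psi> z V - \<psi>0 V - z * \<psi>1 V) \<le> K * (cmod z)\<^sup>2"
    unfolding first_order_def by auto
  have bound: "cmod (\<integral>V. \<psi>1 V \<partial>\<mu>) \<le> K * cmod z"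
    if z: "cmod (1 + z) = 1" "0 < cmod z" "cmod z \<le> 1" for z
  proof -
    let ?r = "\<lambda>V. \<psi> z V - \<psi>0 V - z * \<psi>1 V"
    have mr: "?r \<in> borel_measurable (borel_unitary n)" using meas z by auto
    have int: "integrable \<mu> ?r" "integrable \<mu> \<psi>0" "integrable \<mu> \<psi>1"
      using b2[OF _ z(1,3)] b0 b1 mr meas by (auto intro: integrable_bounded)
    then have "integrable \<mu> (\<lambda>V. ?r V + \<psi>0 V + z * \<psi>1 V)"
      by (intro Bochner_Integration.integrable_add integrable_mult_right)
    moreover have "(\<lambda>V. ?r V + \<psi>0 V + z * \<psi>1 V) = \<psi> z" by (rule ext) simp
    ultimately have int': "integrable \<mu> (\<psi> z)" by simp
    have "(\<integral>V. ?r V \<partial>\<mu>) = - z * (\<integral>V. \<psi>1 V \<partial>\<mu>)"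
      using int int' inv[OF z(1)] by simp
    then have "cmod z * cmod (\<integral>V. \<psi>1 V \<partial>\<mu>) = cmod (\<integral>V. ?r V \<partial>\<mu>)"
      by (simp add: norm_mult)
    also have "\<dots> \<le> K * (cmod z)\<^sup>2" using b2[OF _ z(1,3)] mr by (intro integral_norm_le)
    finally show ?thesis using z(2) by (simp add: power2_eq_square)
  qed
  have "cmod (\<integral>V. \<psi>1 V \<partial>\<mu>) \<le> 0 + e" if e: "0 < e" for e
  proof -
    have "0 < min 1 (e / (K + 1))" using e K by simp
    then obtain z where z: "cmod (1 + z) = 1" "0 < cmod z" "cmod z \<le> min 1 (e / (K + 1))"
      using small_reflection_coefficient by blast
    have "K * cmod z \<le> (K + 1) * (e / (K + 1))" using z K by (intro mult_mono) auto
    then show ?thesis using bound[OF z(1,2)] z K by simp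
  qed
  then have "cmod (\<integral>V. \<psi>1 V \<partial>\<mu>) \<le> 0" by (rule field_le_epsilon)
  then show ?thesis by simp
qed

end

definition bounded_measurable :: "nat \<Rightarrow> (complex mat \<Rightarrow> complex) \<Rightarrow> bool" where
  "bounded_measurable n f \<longleftrightarrow> f \<in> borel_measurable (borel_unitary n) \<and>
     (\<exists>K. \<forall>V \<in> unitary_group n. cmod (f V) \<le> K)"

lemma bounded_measurable_const: "bounded_measurable n (\<lambda>V. c)"
  by (auto simp: bounded_measurable_def)

lemma bounded_measurable_add:
  assumes "bounded_measurable n f" "bounded_measurable n g"
  shows "bounded_measurable n (\<lambda>V. f V + g V)"
proof -
  from assms obtain K L where "\<And>V. V \<in> unitary_group n \<Longrightarrow> cmod (f V) \<le> K"
    "\<And>V. V \<in> unitary_group n \<Longrightarrow> cmod (g V) \<le> L"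
    by (auto simp: bounded_measurable_def)
  then have "\<forall>V \<in> unitary_group n. cmod (f V + g V) \<le> K + L"
    by (auto intro: norm_triangle_le add_mono)
  then show ?thesis using assms by (auto simp: bounded_measurable_def)
qed

lemma bounded_measurable_mult:
  assumes "bounded_measurable n f" "bounded_measurable n g"
  shows "bounded_measurable n (\<lambda>V. f V * g V)"
proof -
  from assms obtain K L where *: "\<And>V. V \<in> unitary_group n \<Longrightarrow> cmod (f V) \<le> K"
    "\<And>V. V \<in> unitary_group n \<Longrightarrow> cmod (g V) \<le> L"
    by (auto simp: bounded_measurable_def)
  have "\<forall>V \<in> unitary_group n. cmod (f V * g V) \<le> K * L"
    using * by (auto simp: norm_mult intro!: mult_mono intro: order_trans[OF norm_ge_zero])
  then show ?thesis using assms by (auto simp: bounded_measurable_def)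
qed

lemma bounded_measurable_sum:
  assumes "\<And>i. i \<in> I \<Longrightarrow> bounded_measurable n (f i)"
  shows "bounded_measurable n (\<lambda>V. \<Sum>i\<in>I. f i V)"
  using assms
  by (induction I rule: infinite_finite_induct) (auto intro: bounded_measurable_const bounded_measurable_add)

lemma bounded_measurable_prod:
  assumes "\<And>i. i \<in> I \<Longrightarrow> bounded_measurable n (f i)"
  shows "bounded_measurable n (\<lambda>V. \<Prod>i\<in>I. f i V)"
  using assms
  by (induction I rule: infinite_finite_induct) (auto intro: bounded_measurable_const bounded_measurable_mult)

lemma conj_mat_entry_le:
  assumes "V \<in> unitary_group n" "W \<in> carrier_mat n n" "i < n" "j < n"
  shows "cmod (conj_mat V W $$ (i, j)) \<le> n * frob W"
  using assms unitary_groupD(1)[OF assms(1)]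
  by (intro order_trans[OF entry_le_frob frob_conj_mat]) auto

lemma bounded_measurable_conj_mat_entry:
  assumes "W \<in> carrier_mat n n" "i < n" "j < n"
  shows "bounded_measurable n (\<lambda>V. conj_mat V W $$ (i, j))"
  using assms measurable_conj_mat_entry[OF assms] conj_mat_entry_le[OF _ assms]
  by (auto simp: bounded_measurable_def)

lemma bounded_measurable_diff:
  assumes "bounded_measurable n f" "bounded_measurable n g"
  shows "bounded_measurable n (\<lambda>V. f V - g V)"
  using bounded_measurable_add[OF assms(1) bounded_measurable_mult[OF bounded_measurable_const[of n "-1"] assms(2)]]
  by simp

lemma bounded_measurable_commutator:
  assumes "W \<in> carrier_mat n n" "r < n" "s < n"
  shows "bounded_measurable n (\<lambda>V. entry_commutator n Z (conj_mat V W) r s)"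
  unfolding entry_commutator_def using assms
  by (intro bounded_measurable_diff bounded_measurable_sum bounded_measurable_mult
      bounded_measurable_const bounded_measurable_conj_mat_entry) auto

lemma first_order_conj_mat_entry:
  assumes P: "P \<in> carrier_mat n n" "mat_adjoint P = P" "P * P = P"
    and W: "W \<in> carrier_mat n n" and rs: "r < n" "s < n"
  shows "first_order n (\<lambda>z V. conj_mat (1\<^sub>m n + z \<cdot>\<^sub>m P) (conj_mat V W) $$ (r, s))
    (\<lambda>V. conj_mat V W $$ (r, s))
    (\<lambda>V. (P * conj_mat V W) $$ (r, s) - (conj_mat V W * P) $$ (r, s))"
proof -
  define w where "w = n * frob W"
  define p where "p = frob P"
  define K where "K = w + 2 * w * p + p * w * p + w * p"
  have w: "0 \<le> w" and p: "0 \<le> p" by (auto simp: w_def p_def)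
  have K: "w \<le> K" "p * w + w * p \<le> K" "p * w * p + w * p \<le> K" "0 \<le> K"
    using w p by (auto simp: K_def)
  show ?thesis
    unfolding first_order_def
  proof (intro exI[of _ K] conjI ballI allI impI K)
    fix V assume V: "V \<in> unitary_group n"
    define Y where "Y = conj_mat V W"
    have Y: "Y \<in> carrier_mat n n" using W unitary_groupD(1)[OF V] by (simp add: Y_def)
    have fY: "frob Y \<le> w" unfolding Y_def w_def by (rule frob_conj_mat[OF V W])
    have PY: "frob (P * Y) \<le> p * w"
      using frob_mult[OF P(1) Y] fY unfolding p_def by (meson frob_nonneg mult_left_mono order_trans)
    have YP: "frob (Y * P) \<le> w * p"
      using frob_mult[OF Y P(1)] fY unfolding p_def by (meson frob_nonneg mult_right_mono order_trans)
    have PYP: "frob (P * Y * P) \<le> p * w * p"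
      using frob_mult[of "P * Y" n P] P(1) Y PY unfolding p_def
      by (meson frob_nonneg mult_right_mono mult_carrier_mat order_trans)
    have ent: "cmod (X $$ (r, s)) \<le> c" if "X \<in> carrier_mat n n" "frob X \<le> c" for X c
      using entry_le_frob[OF that(1) rs] that(2) by simp
    have carr: "P * Y \<in> carrier_mat n n" "Y * P \<in> carrier_mat n n" "P * Y * P \<in> carrier_mat n n"
      using P Y by auto
    show "cmod (conj_mat V W $$ (r, s)) \<le> K"
      using ent[OF Y fY] K unfolding Y_def by linarith
    show "cmod ((P * conj_mat V W) $$ (r, s) - (conj_mat V W * P) $$ (r, s)) \<le> K"
      unfolding Y_def[symmetric]
      using norm_triangle_ineq4[of "(P * Y) $$ (r, s)" "(Y * P) $$ (r, s)"]
        ent[OF carr(1) PY] ent[OF carr(2) YP] K by linarith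
    fix z assume z: "cmod (1 + z) = 1" "cmod z \<le> 1"
    have "cmod ((P * Y * P) $$ (r, s) - (Y * P) $$ (r, s)) \<le> K"
      using norm_triangle_ineq4[of "(P * Y * P) $$ (r, s)" "(Y * P) $$ (r, s)"]
        ent[OF carr(3) PYP] ent[OF carr(2) YP] K by linarith
    then have "(cmod z)\<^sup>2 * cmod ((P * Y * P) $$ (r, s) - (Y * P) $$ (r, s)) \<le> (cmod z)\<^sup>2 * K"
      by (intro mult_left_mono) auto
    then show "cmod (conj_mat (1\<^sub>m n + z \<cdot>\<^sub>m P) (conj_mat V W) $$ (r, s) - conj_mat V W $$ (r, s)
        - z * ((P * conj_mat V W) $$ (r, s) - (conj_mat V W * P) $$ (r, s))) \<le> K * (cmod z)\<^sup>2"
      unfolding Y_def[symmetric] reflection(2)[OF P z(1) Y rs]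
      by (simp add: norm_mult norm_power mult.commute del: of_real_power)
  qed
qed

section \<open>Infinitesimal invariance and the Schwinger--Dyson equation\<close>

context haar_measure
begin

lemma integrable_bounded_measurable: "bounded_measurable n f \<Longrightarrow> integrable \<mu> f"
  by (auto simp: bounded_measurable_def intro: integrable_bounded)

text \<open>The derivative of the product of entries when the unitary moves in direction
  \<open>Z\<close>. Reflections realize it for projections only, but the formula is linear in
  \<open>Z\<close> and makes sense for every \<open>Z\<close>.\<close>

definition generator where
  "generator I W a b Z = (\<lambda>V. \<Sum>k\<in>I. entry_commutator n Z (conj_mat V (W k)) (a k) (b k)
     * (\<Prod>j\<in>I - {k}. conj_mat V (W j) $$ (a j, b j)))"

context
  fixes I :: "'i set" and W :: "'i \<Rightarrow> complex mat" and a b :: "'i \<Rightarrow> nat"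
  assumes I: "finite I" and W: "\<And>i. i \<in> I \<Longrightarrow> W i \<in> carrier_mat n n"
    and ab: "\<And>i. i \<in> I \<Longrightarrow> a i < n" "\<And>i. i \<in> I \<Longrightarrow> b i < n"
begin

lemma bounded_measurable_generator: "bounded_measurable n (generator I W a b Z)"
  unfolding generator_def using W ab
  by (intro bounded_measurable_sum bounded_measurable_mult bounded_measurable_prod
      bounded_measurable_commutator bounded_measurable_conj_mat_entry) auto

text \<open>\<open>P\<close> below is the rank-one projection onto the unit vector \<open>v\<close>.
  Conjugation by \<open>1 + z P\<close> merely translates the integration variable, so by invariance
  the first-order coefficient integrates to zero.\<close>

lemma integral_generator_projection:
  assumes v: "(\<Sum>k<n. v k * cnj (v k)) = 1"
  shows "(\<integral>V. generator I W a b (\<lambda>r s. v r * cnj (v s)) V \<partial>\<mu>) = 0"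
proof -
  define P where "P = mat n n (\<lambda>(r, s). v r * cnj (v s))"
  have P: "P \<in> carrier_mat n n" by (simp add: P_def)
  have Padj: "mat_adjoint P = P" by (intro eq_matI) (auto simp: P_def)
  have PP: "P * P = P"
  proof (rule eq_matI)
    fix i j assume "i < dim_row P" "j < dim_col P"
    then have ij: "i < n" "j < n" using P by auto
    have "(P * P) $$ (i, j) = (\<Sum>k<n. (v i * cnj (v j)) * (v k * cnj (v k)))"
      using ij by (subst mult_entry[OF P P]) (auto simp: P_def intro!: sum.cong)
    also have "\<dots> = P $$ (i, j)" unfolding sum_distrib_left[symmetric] v using ij by (simp add: P_def)
    finally show "(P * P) $$ (i, j) = P $$ (i, j)" .
  qed (use P in auto)
  define \<psi> where "\<psi> i z V = conj_mat (1\<^sub>m n + z \<cdot>\<^sub>m P) (conj_mat V (W i)) $$ (a i, b i)" for i z V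
  define \<psi>0 where "\<psi>0 i V = conj_mat V (W i) $$ (a i, b i)" for i V
  define \<psi>1 where "\<psi>1 i V = (P * conj_mat V (W i)) $$ (a i, b i) - (conj_mat V (W i) * P) $$ (a i, b i)" for i V
  have fo: "first_order n (\<lambda>z V. \<Prod>i\<in>I. \<psi> i z V) (\<lambda>V. \<Prod>i\<in>I. \<psi>0 i V)
    (\<lambda>V. \<Sum>i\<in>I. \<psi>1 i V * (\<Prod>j\<in>I - {i}. \<psi>0 j V))"
    unfolding \<psi>_def \<psi>0_def \<psi>1_def
    by (intro first_order_prod first_order_conj_mat_entry I P Padj PP W ab)
  have gen: "(\<Sum>i\<in>I. \<psi>1 i V * (\<Prod>j\<in>I - {i}. \<psi>0 j V)) = generator I W a b (\<lambda>r s. v r * cnj (v s)) V"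
    if "V \<in> unitary_group n" for V
    unfolding generator_def \<psi>0_def \<psi>1_def P_def using W ab unitary_groupD(1)[OF that]
    by (intro sum.cong refl arg_cong2[where f = "(*)"]) (simp add: entry_commutator_mat)
  have translate: "\<psi> i z V = conj_mat ((1\<^sub>m n + z \<cdot>\<^sub>m P) * V) (W i) $$ (a i, b i)"
    if "V \<in> unitary_group n" "i \<in> I" for i z V
  proof -
    have R: "1\<^sub>m n + z \<cdot>\<^sub>m P \<in> carrier_mat n n" using P by auto
    show ?thesis
      unfolding \<psi>_def using R W[OF that(2)] unitary_groupD(1)[OF that(1)]
      by (simp add: adjoint_mult[of _ n] assoc_mult_mat[of _ n n _ n _ n] mult_carrier_mat[of _ n n])
  qed
  have m0: "(\<lambda>V. \<Prod>i\<in>I. \<psi>0 i V) \<in> borel_measurable (borel_unitary n)"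
    unfolding \<psi>0_def using W ab by (intro borel_measurable_prod measurable_conj_mat_entry) auto
  have tr: "(\<Prod>i\<in>I. \<psi> i z V) = (\<Prod>i\<in>I. \<psi>0 i ((1\<^sub>m n + z \<cdot>\<^sub>m P) * V))"
    if "V \<in> unitary_group n" for z V
    using translate[OF that] by (simp add: \<psi>0_def)
  have "(\<integral>V. (\<Sum>i\<in>I. \<psi>1 i V * (\<Prod>j\<in>I - {i}. \<psi>0 j V)) \<partial>\<mu>) = 0"
  proof (rule first_order_integral_zero[OF fo])
    fix z :: complex assume z: "cmod (1 + z) = 1"
    note R = reflection(1)[OF P Padj PP z]
    show "(\<lambda>V. \<Prod>i\<in>I. \<psi> i z V) \<in> borel_measurable (borel_unitary n)"
      by (subst measurable_cong[OF tr]) (use measurable_compose[OF measurable_unitary_mult[OF R] m0] in auto)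
    have "(\<integral>V. (\<Prod>i\<in>I. \<psi> i z V) \<partial>\<mu>) = (\<integral>V. (\<Prod>i\<in>I. \<psi>0 i ((1\<^sub>m n + z \<cdot>\<^sub>m P) * V)) \<partial>\<mu>)"
      by (intro Bochner_Integration.integral_cong refl tr) (simp add: space_eq)
    also have "\<dots> = (\<integral>V. (\<Prod>i\<in>I. \<psi>0 i V) \<partial>\<mu>)"
      by (rule integral_translate[OF R m0])
    finally show "(\<integral>V. (\<Prod>i\<in>I. \<psi> i z V) \<partial>\<mu>) = (\<integral>V. (\<Prod>i\<in>I. \<psi>0 i V) \<partial>\<mu>)" .
  next
    show "(\<lambda>V. \<Sum>i\<in>I. \<psi>1 i V * (\<Prod>j\<in>I - {i}. \<psi>0 j V)) \<in> borel_measurable (borel_unitary n)"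
      by (subst measurable_cong[OF gen])
        (use bounded_measurable_generator in \<open>auto simp: bounded_measurable_def\<close>)
  qed (rule m0)
  moreover have "(\<integral>V. (\<Sum>i\<in>I. \<psi>1 i V * (\<Prod>j\<in>I - {i}. \<psi>0 j V)) \<partial>\<mu>)
      = (\<integral>V. generator I W a b (\<lambda>r s. v r * cnj (v s)) V \<partial>\<mu>)"
    by (intro Bochner_Integration.integral_cong refl gen) (simp add: space_eq)
  ultimately show ?thesis by simp
qed

lemma generator_linear:
  "generator I W a b (\<lambda>r s. c * Z r s + Z' r s) V = c * generator I W a b Z V + generator I W a b Z' V"
  by (simp add: generator_def entry_commutator_def sum_distrib_left sum.distrib algebra_simps sum_subtractf)

lemma integral_generator_linear:
  "(\<integral>V. generator I W a b (\<lambda>r s. c * Z r s + Z' r s) V \<partial>\<mu>)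
    = c * (\<integral>V. generator I W a b Z V \<partial>\<mu>) + (\<integral>V. generator I W a b Z' V \<partial>\<mu>)"
  unfolding generator_linear
  by (simp add: integrable_bounded_measurable[OF bounded_measurable_generator])

text \<open>Polarization: rank-one projections span all matrices over the complex numbers and the
  integral is linear in \<open>Z\<close>, so the identity passes to matrix units, which are not
  self-adjoint off the diagonal.\<close>

lemma integral_generator_unit:
  assumes pq: "p < n" "q < n"
  shows "(\<integral>V. generator I W a b (\<lambda>r s. if r = p \<and> s = q then 1 else 0) V \<partial>\<mu>) = 0"
proof -
  let ?G = "\<lambda>Z. \<integral>V. generator I W a b Z V \<partial>\<mu>"
  let ?E = "\<lambda>p q r s. if r = p \<and> s = q then 1 else (0::complex)"
  have diag: "?G (?E p p) = 0" if p: "p < n" for p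
  proof -
    let ?v = "\<lambda>k. if k = p then 1 else (0::complex)"
    have "(\<Sum>k<n. ?v k * cnj (?v k)) = (\<Sum>k<n. if k = p then 1 else 0)"
      by (intro sum.cong) auto
    then have "?G (\<lambda>r s. ?v r * cnj (?v s)) = 0"
      using p by (intro integral_generator_projection) simp
    moreover have "(\<lambda>r s. ?v r * cnj (?v s)) = ?E p p" by (auto simp: fun_eq_iff)
    ultimately show ?thesis by simp
  qed
  show ?thesis
  proof (cases "p = q")
    case False
    define v where "v \<zeta> k = (if k = p then 1 else if k = q then \<zeta> else 0) / of_real (sqrt 2)" for \<zeta> :: complex and k
    have s2: "complex_of_real (sqrt 2) * complex_of_real (sqrt 2) = 2"
      by (metis of_real_mult of_real_numeral real_sqrt_mult_self abs_numeral)
    have proj: "?G (\<lambda>r s. v \<zeta> r * cnj (v \<zeta> s)) = 0" if "\<zeta> * cnj \<zeta> = 1" for \<zeta>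
    proof (rule integral_generator_projection)
      have "(\<Sum>k<n. v \<zeta> k * cnj (v \<zeta> k)) = (\<Sum>k<n. (if k = p then 1/2 else 0) + (if k = q then 1/2 else 0))"
        using False that by (intro sum.cong) (auto simp: v_def s2)
      also have "\<dots> = 1" using pq by (simp add: sum.distrib)
      finally show "(\<Sum>k<n. v \<zeta> k * cnj (v \<zeta> k)) = 1" .
    qed
    \<comment> \<open>The projection onto \<open>v \<zeta>\<close> is half of
      \<open>E p p + E q q + cnj \<zeta> E p q + \<zeta> E q p\<close>. Adding the one for
      \<open>\<zeta> = 1\<close> to \<open>\<i>\<close> times the one for
      \<open>\<zeta> = \<i>\<close> cancels \<open>E q p\<close> and leaves \<open>E p q\<close>
      plus \<open>(1 + \<i>) / 2\<close> times the diagonal part, which \<open>?c\<close>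
      removes.\<close>
    let ?c = "- (1 + \<i>) / 2"
    \<comment> \<open>The nesting and the final \<open>0\<close> give the sum the shape
      \<open>c * Z + Z'\<close> at each level, so \<open>integral_generator_linear\<close> rewrites
      it repeatedly.\<close>
    have "?E p q = (\<lambda>r s. 1 * (v 1 r * cnj (v 1 s)) + (\<i> * (v \<i> r * cnj (v \<i> s))
        + (?c * ?E p p r s + (?c * ?E q q r s + 0))))"
      using False by (intro ext) (auto simp: v_def s2 field_simps)
    then have "?G (?E p q) = ?G (\<lambda>r s. 1 * (v 1 r * cnj (v 1 s)) + (\<i> * (v \<i> r * cnj (v \<i> s))
        + (?c * ?E p p r s + (?c * ?E q q r s + 0))))"
      by (rule arg_cong)
    also have "\<dots> = 1 * ?G (\<lambda>r s. v 1 r * cnj (v 1 s)) + (\<i> * ?G (\<lambda>r s. v \<i> r * cnj (v \<i> s))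
        + (?c * ?G (?E p p) + (?c * ?G (?E q q) + ?G (\<lambda>r s. 0))))"
      by (simp only: integral_generator_linear)
    also have "?G (\<lambda>r s. 0) = 0" by (simp add: generator_def entry_commutator_def)
    also have "?G (\<lambda>r s. v 1 r * cnj (v 1 s)) = 0" by (rule proj) simp
    also have "?G (\<lambda>r s. v \<i> r * cnj (v \<i> s)) = 0" by (rule proj) simp
    finally show ?thesis using pq by (simp add: diag)
  qed (use diag pq in simp)
qed

end

text \<open>The row index \<open>y p\<close> is replaced by \<open>i\<close>, and the identities for
  the matrix units at \<open>(i, y p)\<close> are summed over \<open>i < n\<close>. The derivative
  of factor \<open>p\<close> reproduces the product \<open>n\<close> times. The derivative of
  another factor \<open>k\<close> either exchanges the row indices of \<open>p\<close> and
  \<open>k\<close>, or joins the two factors to one entry of the conjugate of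
  \<open>W k * W p\<close>, with row index \<open>y k\<close> and column index
  \<open>b p\<close>.\<close>

lemma schwinger_dyson:
  fixes I :: "'i set" and W :: "'i \<Rightarrow> complex mat" and y b :: "'i \<Rightarrow> nat"
  assumes I: "finite I" and p: "p \<in> I" and W: "\<And>i. i \<in> I \<Longrightarrow> W i \<in> carrier_mat n n"
    and y: "\<And>i. i \<in> I \<Longrightarrow> y i < n" and b: "\<And>i. i \<in> I \<Longrightarrow> b i < n"
    and tr: "mat_trace (W p) = 0"
  shows "of_nat n * mixed_moment \<mu> I W y b =
    (\<Sum>k\<in>I - {p}. (if y p = b k then
        mixed_moment \<mu> (I - {p}) (W(k := W k * W p)) y (b \<circ> Transposition.transpose p k) else 0)
      - mixed_moment \<mu> I W (y \<circ> Transposition.transpose p k) b)"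
proof -
  let ?a = "\<lambda>i. y(p := i)"
  let ?E = "\<lambda>i r s. if r = i \<and> s = y p then 1 else (0::complex)"
  let ?M = "\<lambda>V I W y b. \<Prod>i\<in>I. conj_mat V (W i) $$ (y i, b i)"
  let ?T = "\<lambda>V k. (if y p = b k then ?M V (I - {p}) (W(k := W k * W p)) y (b \<circ> Transposition.transpose p k) else 0)
      - ?M V I W (y \<circ> Transposition.transpose p k) b"
  have a: "?a i k < n" if "i < n" "k \<in> I" for i k using y that by simp
  have point: "(\<Sum>i<n. generator I W (?a i) b (?E i) V) = of_nat n * ?M V I W y b - (\<Sum>k\<in>I - {p}. ?T V k)"
    if V: "V \<in> unitary_group n" for V
  proof -
    define Y where "Y k = conj_mat V (W k)" for k
    have Y: "Y k \<in> carrier_mat n n" if "k \<in> I" for k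
      using W[OF that] unitary_groupD(1)[OF V] by (simp add: Y_def)
    define D where "D i k = (if ?a i k = i then Y k $$ (y p, b k) else 0)
      - (if b k = y p then Y k $$ (?a i k, i) else 0)" for i k
    have gen: "generator I W (?a i) b (?E i) V = (\<Sum>k\<in>I. D i k * (\<Prod>j\<in>I - {k}. Y j $$ (?a i j, b j)))"
      if "i < n" for i
      unfolding generator_def entry_commutator_unit[OF that y[OF p]] D_def Y_def ..
    \<comment> \<open>Besides \<open>n\<close> copies of the product, factor \<open>p\<close> yields
      the trace of its conjugated matrix when \<open>b p = y p\<close>; this is where trace zero
      enters.\<close>
    have head: "(\<Sum>i<n. D i p * (\<Prod>j\<in>I - {p}. Y j $$ (?a i j, b j))) = of_nat n * ?M V I W y b"
    proof -
      have "(\<Prod>j\<in>I - {p}. Y j $$ (?a i j, b j)) = (\<Prod>j\<in>I - {p}. Y j $$ (y j, b j))" for i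
        by (intro prod.cong) auto
      moreover have "(\<Sum>i<n. D i p) = of_nat n * Y p $$ (y p, b p)"
      proof -
        have "(\<Sum>i<n. Y p $$ (i, i)) = 0"
          using mat_trace_def'[OF Y[OF p]] conj_mat_trace[OF V W[OF p]] tr by (simp add: Y_def)
        then show ?thesis by (cases "b p = y p") (simp_all add: D_def sum_subtractf)
      qed
      moreover have "?M V I W y b = Y p $$ (y p, b p) * (\<Prod>j\<in>I - {p}. Y j $$ (y j, b j))"
        unfolding Y_def by (rule prod.remove[OF I p])
      ultimately show ?thesis by (simp add: sum_distrib_right[symmetric])
    qed
    \<comment> \<open>For \<open>k \<noteq> p\<close> the index \<open>i\<close> survives only in
      factor \<open>p\<close> and in the differentiated factor \<open>k\<close>: one term fixes
      \<open>i = y k\<close>, the other sums over \<open>i\<close> and is a matrix product.\<close>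
    have tail: "(\<Sum>i<n. D i k * (\<Prod>j\<in>I - {k}. Y j $$ (?a i j, b j))) = - ?T V k" if k: "k \<in> I - {p}" for k
    proof -
      define Q where "Q = (\<Prod>j\<in>I - {p, k}. Y j $$ (y j, b j))"
      have 1: "(\<Prod>j\<in>I - {k}. Y j $$ (?a i j, b j)) = Y p $$ (i, b p) * Q" for i
      proof -
        have "(\<Prod>j\<in>I - {k}. Y j $$ (?a i j, b j))
            = Y p $$ (?a i p, b p) * (\<Prod>j\<in>I - {k} - {p}. Y j $$ (?a i j, b j))"
          using I p k by (intro prod.remove) auto
        also have "(\<Prod>j\<in>I - {k} - {p}. Y j $$ (?a i j, b j)) = Q"
          unfolding Q_def by (intro prod.cong) auto
        finally show ?thesis by simp
      qed
      have 2: "?M V I W (y \<circ> Transposition.transpose p k) b = Y p $$ (y k, b p) * Y k $$ (y p, b k) * Q"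
      proof -
        have "?M V I W (y \<circ> Transposition.transpose p k) b = Y p $$ (y k, b p) *
            (\<Prod>j\<in>I - {p}. Y j $$ ((y \<circ> Transposition.transpose p k) j, b j))"
          unfolding Y_def using I p by (subst prod.remove[of _ p]) auto
        also have "(\<Prod>j\<in>I - {p}. Y j $$ ((y \<circ> Transposition.transpose p k) j, b j)) = Y k $$ (y p, b k) *
            (\<Prod>j\<in>I - {p} - {k}. Y j $$ ((y \<circ> Transposition.transpose p k) j, b j))"
          using I k by (subst prod.remove[of _ k]) auto
        also have "(\<Prod>j\<in>I - {p} - {k}. Y j $$ ((y \<circ> Transposition.transpose p k) j, b j)) = Q"
          unfolding Q_def by (intro prod.cong) (auto simp: Transposition.transpose_def)
        finally show ?thesis by simp
      qed
      have 3: "?M V (I - {p}) (W(k := W k * W p)) y (b \<circ> Transposition.transpose p k) = (Y k * Y p) $$ (y k, b p) * Q"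
      proof -
        have "?M V (I - {p}) (W(k := W k * W p)) y (b \<circ> Transposition.transpose p k)
          = conj_mat V (W k * W p) $$ (y k, b p) *
            (\<Prod>j\<in>I - {p} - {k}. conj_mat V ((W(k := W k * W p)) j) $$ (y j, (b \<circ> Transposition.transpose p k) j))"
          using I k by (subst prod.remove[of _ k]) auto
        also have "(\<Prod>j\<in>I - {p} - {k}. conj_mat V ((W(k := W k * W p)) j) $$ (y j, (b \<circ> Transposition.transpose p k) j)) = Q"
          unfolding Q_def Y_def by (intro prod.cong) (auto simp: Transposition.transpose_def)
        finally show ?thesis
          unfolding Y_def using conj_mat_mult[OF V W W, of k p] k p by simp
      qed
      have "(\<Sum>i<n. D i k * (\<Prod>j\<in>I - {k}. Y j $$ (?a i j, b j)))
        = (\<Sum>i<n. (if i = y k then Y k $$ (y p, b k) * Y p $$ (y k, b p) * Q else 0)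
            - (if b k = y p then Y k $$ (y k, i) * Y p $$ (i, b p) else 0) * Q)"
        unfolding 1 using k by (intro sum.cong) (auto simp: D_def algebra_simps)
      also have "\<dots> = Y k $$ (y p, b k) * Y p $$ (y k, b p) * Q
          - (if b k = y p then (Y k * Y p) $$ (y k, b p) else 0) * Q"
        using k y b p mult_entry[OF Y Y, of k p "y k" "b p"]
        by (simp add: sum_subtractf sum_distrib_right[symmetric] del: index_mult_mat(1))
      finally show ?thesis unfolding 2 3 by (auto simp: algebra_simps)
    qed
    have "(\<Sum>i<n. generator I W (?a i) b (?E i) V)
      = (\<Sum>k\<in>I. \<Sum>i<n. D i k * (\<Prod>j\<in>I - {k}. Y j $$ (?a i j, b j)))"
      by (subst sum.swap) (simp add: gen)
    also have "\<dots> = of_nat n * ?M V I W y b + (\<Sum>k\<in>I - {p}. - ?T V k)"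
      by (subst sum.remove[OF I p]) (simp only: head tail cong: sum.cong)
    finally show ?thesis unfolding sum_negf diff_conv_add_uminus .
  qed
  have bm: "bounded_measurable n (\<lambda>V. ?M V J W' y' b')"
    if "\<And>i. i \<in> J \<Longrightarrow> W' i \<in> carrier_mat n n" "\<And>i. i \<in> J \<Longrightarrow> y' i < n" "\<And>i. i \<in> J \<Longrightarrow> b' i < n" for J W' y' b'
    using that by (intro bounded_measurable_prod bounded_measurable_conj_mat_entry)
  have tau: "Transposition.transpose p k i \<in> I" if "k \<in> I" "i \<in> I" for k i
    using that p by (auto simp: Transposition.transpose_def)
  have bm1: "integrable \<mu> (\<lambda>V. ?M V I W y b)"
    using W y b by (intro integrable_bounded_measurable bm) auto
  have bm2: "integrable \<mu> (\<lambda>V. ?M V I W (y \<circ> Transposition.transpose p k) b)" if "k \<in> I" for k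
    using W y b tau that by (intro integrable_bounded_measurable bm) auto
  have bm3: "integrable \<mu> (\<lambda>V. ?M V (I - {p}) (W(k := W k * W p)) y (b \<circ> Transposition.transpose p k))" if "k \<in> I" for k
    using W y b tau that p
    by (intro integrable_bounded_measurable bm) (auto intro!: mult_carrier_mat[of _ n n])
  have bm4: "integrable \<mu> (\<lambda>V. generator I W (?a i) b (?E i) V)" if "i < n" for i
    using a[OF that] by (intro integrable_bounded_measurable bounded_measurable_generator I W b)
  have bmT: "integrable \<mu> (\<lambda>V. ?T V k)" if "k \<in> I" for k
    using bm2[OF that] bm3[OF that] by (cases "y p = b k") simp_all
  have "0 = (\<Sum>i<n. \<integral>V. generator I W (?a i) b (?E i) V \<partial>\<mu>)"
    using a y[OF p] by (intro sum.neutral[symmetric] ballI integral_generator_unit I W b) auto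
  also have "\<dots> = (\<integral>V. (\<Sum>i<n. generator I W (?a i) b (?E i) V) \<partial>\<mu>)"
    using bm4 by (intro Bochner_Integration.integral_sum[symmetric]) auto
  also have "\<dots> = (\<integral>V. of_nat n * ?M V I W y b - (\<Sum>k\<in>I - {p}. ?T V k) \<partial>\<mu>)"
    by (intro Bochner_Integration.integral_cong refl point) (simp add: space_eq)
  also have "\<dots> = of_nat n * (\<integral>V. ?M V I W y b \<partial>\<mu>) - (\<Sum>k\<in>I - {p}. \<integral>V. ?T V k \<partial>\<mu>)"
    using bm1 bmT by (subst Bochner_Integration.integral_diff) (auto intro!: Bochner_Integration.integrable_sum)
  also have "(\<Sum>k\<in>I - {p}. \<integral>V. ?T V k \<partial>\<mu>) = (\<Sum>k\<in>I - {p}. (if y p = b k then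
        mixed_moment \<mu> (I - {p}) (W(k := W k * W p)) y (b \<circ> Transposition.transpose p k) else 0)
      - mixed_moment \<mu> I W (y \<circ> Transposition.transpose p k) b)"
    using bm2 bm3 by (intro sum.cong refl) (auto simp: mixed_moment_def)
  finally show ?thesis unfolding mixed_moment_def by simp
qed

end

section \<open>Bounds for mixed moments\<close>

definition index_delta :: "'i set \<Rightarrow> ('i \<Rightarrow> 'i) \<Rightarrow> ('i \<Rightarrow> nat) \<Rightarrow> ('i \<Rightarrow> nat) \<Rightarrow> complex" where
  "index_delta I \<sigma> y b = (\<Prod>i\<in>I. if y i = b (\<sigma> i) then 1 else 0)"

text \<open>The bound by \<open>D\<close> serves only to make a supremum finite; the bound by \<open>E\<close> on permutation tensors is the one that enters the estimate.\<close>

definition controlled ::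
    "nat \<Rightarrow> 'i set \<Rightarrow> real \<Rightarrow> real \<Rightarrow> ((('i \<Rightarrow> nat) \<Rightarrow> ('i \<Rightarrow> nat) \<Rightarrow> complex) \<Rightarrow> complex) \<Rightarrow> bool" where
  "controlled n I D E \<Phi> \<longleftrightarrow>
     (\<forall>c f g. \<Phi> (\<lambda>y b. c * f y b + g y b) = c * \<Phi> f + \<Phi> g) \<and>
     (\<forall>f K. (\<forall>y b. (\<forall>i\<in>I. y i < n \<and> b i < n) \<longrightarrow> cmod (f y b) \<le> K) \<longrightarrow> cmod (\<Phi> f) \<le> D * K) \<and>
     (\<forall>\<sigma>. \<sigma> permutes I \<longrightarrow> cmod (\<Phi> (index_delta I \<sigma>)) \<le> E)"

lemma controlled_linear:
  assumes "controlled n I D E \<Phi>"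
  shows "\<Phi> (\<lambda>y b. c * f y b + g y b) = c * \<Phi> f + \<Phi> g"
  using conjunct1[OF assms[unfolded controlled_def], THEN spec, THEN spec, THEN spec, of c f g] .

lemma controlled_bound:
  assumes "controlled n I D E \<Phi>"
    and "\<And>y b. (\<And>i. i \<in> I \<Longrightarrow> y i < n) \<Longrightarrow> (\<And>i. i \<in> I \<Longrightarrow> b i < n) \<Longrightarrow> cmod (f y b) \<le> K"
  shows "cmod (\<Phi> f) \<le> D * K"
proof -
  have "(\<forall>y b. (\<forall>i\<in>I. y i < n \<and> b i < n) \<longrightarrow> cmod (f y b) \<le> K) \<longrightarrow> cmod (\<Phi> f) \<le> D * K"
    using conjunct1[OF conjunct2[OF assms(1)[unfolded controlled_def]], THEN spec, THEN spec, of f K] .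
  moreover have "\<forall>y b. (\<forall>i\<in>I. y i < n \<and> b i < n) \<longrightarrow> cmod (f y b) \<le> K"
    using assms(2) by simp
  ultimately show ?thesis by (rule mp)
qed

lemma controlled_delta:
  assumes "controlled n I D E \<Phi>" "\<sigma> permutes I"
  shows "cmod (\<Phi> (index_delta I \<sigma>)) \<le> E"
  using conjunct2[OF conjunct2[OF assms(1)[unfolded controlled_def]]] assms(2) by simp

lemma controlled_nonneg: "controlled n I D E \<Phi> \<Longrightarrow> 0 \<le> E"
  using controlled_delta[OF _ permutes_id] by (rule order_trans[OF norm_ge_zero])

lemma controlledI:
  assumes "\<And>c f g. \<Phi> (\<lambda>y b. c * f y b + g y b) = c * \<Phi> f + \<Phi> g"
    and "\<And>f K. (\<And>y b. (\<And>i. i \<in> I \<Longrightarrow> y i < n) \<Longrightarrow> (\<And>i. i \<in> I \<Longrightarrow> b i < n) \<Longrightarrow> cmod (f y b) \<le> K)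
      \<Longrightarrow> cmod (\<Phi> f) \<le> D * K"
    and "\<And>\<sigma>. \<sigma> permutes I \<Longrightarrow> cmod (\<Phi> (index_delta I \<sigma>)) \<le> E"
  shows "controlled n I D E \<Phi>"
  unfolding controlled_def
proof (intro conjI allI impI)
  fix f K assume "\<forall>y b. (\<forall>i\<in>I. y i < n \<and> b i < n) \<longrightarrow> cmod (f y b) \<le> K"
  then show "cmod (\<Phi> f) \<le> D * K" by (intro assms(2)) simp
qed (rule assms(1), rule assms(3))

text \<open>The bound by \<open>D\<close> with \<open>K = 0\<close> shows that the functional sees
  only index values below \<open>n\<close>.\<close>

lemma controlled_cong:
  assumes "controlled n I D E \<Phi>"
    and "\<And>y b. (\<And>i. i \<in> I \<Longrightarrow> y i < n) \<Longrightarrow> (\<And>i. i \<in> I \<Longrightarrow> b i < n) \<Longrightarrow> f y b = g y b"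
  shows "\<Phi> f = \<Phi> g"
proof -
  have "cmod (\<Phi> (\<lambda>y b. -1 * g y b + f y b)) \<le> D * 0"
    using assms(2) by (intro controlled_bound[OF assms(1)]) auto
  then show ?thesis unfolding controlled_linear[OF assms(1)] by simp
qed

lemma controlled_sum:
  assumes "controlled n I D E \<Phi>" "finite A"
  shows "\<Phi> (\<lambda>y b. \<Sum>k\<in>A. f k y b) = (\<Sum>k\<in>A. \<Phi> (f k))"
  using assms(2)
proof (induction A rule: finite_induct)
  case empty
  show ?case using controlled_linear[OF assms(1), of 1 "\<lambda>_ _. 0" "\<lambda>_ _. 0"] by simp
next
  case (insert a A)
  then show ?case using controlled_linear[OF assms(1), of 1 "f a" "\<lambda>y b. \<Sum>k\<in>A. f k y b"] by simp
qed

text \<open>Composition with a permutation of the row indices permutes the permutation tensors among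
  themselves, so both constants are preserved exactly. Without this stability a single supremum
  could not absorb the permuted terms.\<close>

lemma controlled_permute:
  assumes \<Phi>: "controlled n I D E \<Phi>" and \<tau>: "\<tau> permutes I"
  shows "controlled n I D E (\<lambda>f. \<Phi> (\<lambda>y b. f (y \<circ> \<tau>) b))"
proof (rule controlledI)
  fix c f g
  show "\<Phi> (\<lambda>y b. c * f (y \<circ> \<tau>) b + g (y \<circ> \<tau>) b) = c * \<Phi> (\<lambda>y b. f (y \<circ> \<tau>) b) + \<Phi> (\<lambda>y b. g (y \<circ> \<tau>) b)"
    by (rule controlled_linear[OF \<Phi>])
next
  fix f :: "('a \<Rightarrow> nat) \<Rightarrow> ('a \<Rightarrow> nat) \<Rightarrow> complex" and K
  assume f: "\<And>y b. (\<And>i. i \<in> I \<Longrightarrow> y i < n) \<Longrightarrow> (\<And>i. i \<in> I \<Longrightarrow> b i < n) \<Longrightarrow> cmod (f y b) \<le> K"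
  show "cmod (\<Phi> (\<lambda>y b. f (y \<circ> \<tau>) b)) \<le> D * K"
    by (intro controlled_bound[OF \<Phi>] f) (auto simp: permutes_in_image[OF \<tau>])
next
  fix \<sigma> assume \<sigma>: "\<sigma> permutes I"
  have "index_delta I \<sigma> (y \<circ> \<tau>) b = index_delta I (\<sigma> \<circ> inv_into UNIV \<tau>) y b" for y b
    unfolding index_delta_def
    by (subst prod.permute[OF permutes_inv[OF \<tau>]]) (simp add: o_def permutes_inverses[OF \<tau>])
  then show "cmod (\<Phi> (\<lambda>y b. index_delta I \<sigma> (y \<circ> \<tau>) b)) \<le> E"
    using controlled_delta[OF \<Phi> permutes_compose[OF permutes_inv[OF \<tau>] \<sigma>]] by simp
qed

text \<open>The functional that the contracted Schwinger--Dyson term induces on tensors without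
  index \<open>p\<close>. A permutation \<open>\<sigma>\<close> of \<open>I - {p}\<close> fixes
  \<open>p\<close>, so its tensor becomes the permutation tensor of
  \<open>transpose p k \<circ> \<sigma>\<close> on \<open>I\<close>, and the bound \<open>E\<close>
  is inherited.\<close>

lemma controlled_contract:
  assumes \<Phi>: "controlled n I D E \<Phi>" and I: "finite I" "p \<in> I" "k \<in> I - {p}"
  shows "controlled n (I - {p}) D E
    (\<lambda>f. \<Phi> (\<lambda>y b. (if y p = b k then f y (b \<circ> Transposition.transpose p k) else 0)))"
proof (rule controlledI)
  fix c and f g :: "('a \<Rightarrow> nat) \<Rightarrow> ('a \<Rightarrow> nat) \<Rightarrow> complex"
  let ?h = "\<lambda>f y b. (if y p = b k then f y (b \<circ> Transposition.transpose p k) else 0)"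
  have "?h (\<lambda>y b. c * f y b + g y b) = (\<lambda>y b. c * ?h f y b + ?h g y b)" by (auto simp: fun_eq_iff)
  then show "\<Phi> (?h (\<lambda>y b. c * f y b + g y b)) = c * \<Phi> (?h f) + \<Phi> (?h g)"
    using controlled_linear[OF \<Phi>, of c "?h f" "?h g"] by simp
next
  fix f :: "('a \<Rightarrow> nat) \<Rightarrow> ('a \<Rightarrow> nat) \<Rightarrow> complex" and K
  assume f: "\<And>y b. (\<And>i. i \<in> I - {p} \<Longrightarrow> y i < n) \<Longrightarrow> (\<And>i. i \<in> I - {p} \<Longrightarrow> b i < n) \<Longrightarrow> cmod (f y b) \<le> K"
  show "cmod (\<Phi> (\<lambda>y b. (if y p = b k then f y (b \<circ> Transposition.transpose p k) else 0))) \<le> D * K"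
  proof (rule controlled_bound[OF \<Phi>])
    fix y b assume *: "\<And>i. i \<in> I \<Longrightarrow> y i < n" "\<And>i. i \<in> I \<Longrightarrow> b i < n"
    have "cmod (f y (b \<circ> Transposition.transpose p k)) \<le> K"
      using * I by (intro f) (auto simp: Transposition.transpose_def)
    then show "cmod (if y p = b k then f y (b \<circ> Transposition.transpose p k) else 0) \<le> K"
      using norm_ge_zero[of "f y (b \<circ> Transposition.transpose p k)"] by (simp del: norm_ge_zero)
  qed
next
  fix \<sigma> assume \<sigma>: "\<sigma> permutes I - {p}"
  let ?\<sigma> = "Transposition.transpose p k \<circ> \<sigma>"
  have "(if y p = b k then index_delta (I - {p}) \<sigma> y (b \<circ> Transposition.transpose p k) else 0)
      = index_delta I ?\<sigma> y b" for y b
    unfolding index_delta_def using I permutes_not_in[OF \<sigma>, of p]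
    by (subst prod.remove[OF I(1,2)]) auto
  moreover have "?\<sigma> permutes I"
    using I by (intro permutes_compose permutes_subset[OF \<sigma>] permutes_swap_id) auto
  ultimately show "cmod (\<Phi> (\<lambda>y b. (if y p = b k then
      index_delta (I - {p}) \<sigma> y (b \<circ> Transposition.transpose p k) else 0))) \<le> E"
    using controlled_delta[OF \<Phi>] by simp
qed

text \<open>The inserted delta extends a permutation of \<open>I - {k}\<close> by the fixed point
  \<open>k\<close>. This functional receives the scalar part of a matrix at
  \<open>k\<close>.\<close>

lemma controlled_fix:
  assumes \<Phi>: "controlled n I D E \<Phi>" and I: "finite I" "k \<in> I"
  shows "controlled n (I - {k}) D E (\<lambda>f. \<Phi> (\<lambda>y b. (if y k = b k then f y b else 0)))"
proof (rule controlledI)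
  fix c and f g :: "('a \<Rightarrow> nat) \<Rightarrow> ('a \<Rightarrow> nat) \<Rightarrow> complex"
  let ?h = "\<lambda>f y b. (if y k = b k then f y b else 0)"
  have "?h (\<lambda>y b. c * f y b + g y b) = (\<lambda>y b. c * ?h f y b + ?h g y b)" by (auto simp: fun_eq_iff)
  then show "\<Phi> (?h (\<lambda>y b. c * f y b + g y b)) = c * \<Phi> (?h f) + \<Phi> (?h g)"
    using controlled_linear[OF \<Phi>, of c "?h f" "?h g"] by simp
next
  fix f :: "('a \<Rightarrow> nat) \<Rightarrow> ('a \<Rightarrow> nat) \<Rightarrow> complex" and K
  assume f: "\<And>y b. (\<And>i. i \<in> I - {k} \<Longrightarrow> y i < n) \<Longrightarrow> (\<And>i. i \<in> I - {k} \<Longrightarrow> b i < n) \<Longrightarrow> cmod (f y b) \<le> K"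
  show "cmod (\<Phi> (\<lambda>y b. (if y k = b k then f y b else 0))) \<le> D * K"
  proof (rule controlled_bound[OF \<Phi>])
    fix y b assume *: "\<And>i. i \<in> I \<Longrightarrow> y i < n" "\<And>i. i \<in> I \<Longrightarrow> b i < n"
    have "cmod (f y b) \<le> K" using * by (intro f) auto
    then show "cmod (if y k = b k then f y b else 0) \<le> K"
      using norm_ge_zero[of "f y b"] by (simp del: norm_ge_zero)
  qed
next
  fix \<sigma> assume \<sigma>: "\<sigma> permutes I - {k}"
  have "(if y k = b k then index_delta (I - {k}) \<sigma> y b else 0) = index_delta I \<sigma> y b" for y b
    unfolding index_delta_def using permutes_not_in[OF \<sigma>, of k] by (subst prod.remove[OF I]) auto
  moreover have "\<sigma> permutes I" using \<sigma> by (rule permutes_subset) auto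
  ultimately show "cmod (\<Phi> (\<lambda>y b. (if y k = b k then index_delta (I - {k}) \<sigma> y b else 0))) \<le> E"
    using controlled_delta[OF \<Phi>] by simp
qed

section \<open>The estimate for mixed moments of matrices with trace zero\<close>

context haar_measure
begin

lemma mixed_moment_le:
  assumes "finite I" "\<And>i. i \<in> I \<Longrightarrow> W i \<in> carrier_mat n n" "\<And>i. i \<in> I \<Longrightarrow> y i < n" "\<And>i. i \<in> I \<Longrightarrow> b i < n"
  shows "cmod (mixed_moment \<mu> I W y b) \<le> (\<Prod>i\<in>I. n * frob (W i))"
  unfolding mixed_moment_def
proof (rule integral_norm_le)
  show "(\<lambda>V. \<Prod>i\<in>I. conj_mat V (W i) $$ (y i, b i)) \<in> borel_measurable (borel_unitary n)"
    using assms by (intro borel_measurable_prod measurable_conj_mat_entry)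
  show "cmod (\<Prod>i\<in>I. conj_mat V (W i) $$ (y i, b i)) \<le> (\<Prod>i\<in>I. n * frob (W i))"
    if "V \<in> unitary_group n" for V
    unfolding prod_norm[symmetric] using assms that
    by (intro prod_mono) (auto intro: conj_mat_entry_le)
qed

text \<open>Scalar matrices are invariant under conjugation, so the scalar part of
  \<open>W k\<close> contributes a Kronecker delta and drops the index \<open>k\<close> from the
  product.\<close>

lemma mixed_moment_centre:
  assumes J: "finite J" "k \<in> J" and W: "\<And>i. i \<in> J \<Longrightarrow> W i \<in> carrier_mat n n"
    and yb: "\<And>i. i \<in> J \<Longrightarrow> y i < n" "\<And>i. i \<in> J \<Longrightarrow> b i < n"
  shows "mixed_moment \<mu> J W y b = mixed_moment \<mu> J (W(k := centre (W k))) y b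
    + mat_ntrace (W k) * (if y k = b k then mixed_moment \<mu> (J - {k}) W y b else 0)"
proof -
  let ?M = "\<lambda>V W I. \<Prod>i\<in>I. conj_mat V (W i) $$ (y i, b i)"
  note Wk = W[OF J(2)]
  have point: "?M V W J = ?M V (W(k := centre (W k))) J
      + mat_ntrace (W k) * (if y k = b k then ?M V W (J - {k}) else 0)"
    if V: "V \<in> unitary_group n" for V
  proof -
    note Vc = unitary_groupD(1)[OF V]
    have "conj_mat V (W k) = conj_mat V (centre (W k) + mat_ntrace (W k) \<cdot>\<^sub>m 1\<^sub>m n)"
      using centre_decomp[OF Wk] by simp
    also have "\<dots> = conj_mat V (centre (W k)) + mat_ntrace (W k) \<cdot>\<^sub>m 1\<^sub>m n"
      using Vc centre_carrier[OF Wk] conj_mat_one[OF V]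
      by (simp add: conj_mat_add[of _ n] conj_mat_smult[of _ n])
    finally have entry: "conj_mat V (W k) $$ (y k, b k) = conj_mat V (centre (W k)) $$ (y k, b k)
        + mat_ntrace (W k) * (if y k = b k then 1 else 0)"
      using yb J(2) Vc centre_carrier[OF Wk] by simp
    have "?M V (W(k := centre (W k))) (J - {k}) = ?M V W (J - {k})" by (intro prod.cong) auto
    then show ?thesis
      by (simp add: prod.remove[OF J] entry algebra_simps)
  qed
  have int: "integrable \<mu> (\<lambda>V. ?M V (W(k := centre (W k))) J)" "integrable \<mu> (\<lambda>V. ?M V W (J - {k}))"
    using W yb centre_carrier[OF Wk]
    by (auto intro!: integrable_bounded_measurable bounded_measurable_prod bounded_measurable_conj_mat_entry)
  have "mixed_moment \<mu> J W y b = (\<integral>V. ?M V (W(k := centre (W k))) J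
      + mat_ntrace (W k) * (if y k = b k then ?M V W (J - {k}) else 0) \<partial>\<mu>)"
    unfolding mixed_moment_def by (intro Bochner_Integration.integral_cong refl point) (simp add: space_eq)
  also have "\<dots> = mixed_moment \<mu> J (W(k := centre (W k))) y b
    + mat_ntrace (W k) * (if y k = b k then mixed_moment \<mu> (J - {k}) W y b else 0)"
    using int unfolding mixed_moment_def by (cases "y k = b k") simp_all
  finally show ?thesis .
qed

end

lemma mixed_moment_cong:
  "(\<And>i. i \<in> I \<Longrightarrow> W i = W' i) \<Longrightarrow> mixed_moment \<mu> I W = mixed_moment \<mu> I W'"
  unfolding mixed_moment_def by (intro ext Bochner_Integration.integral_cong prod.cong) auto

text \<open>Each application of the Schwinger--Dyson equation either permutes the tensor, which is absorbed
  because there are fewer than \<open>n / 2\<close> such terms, or gains a factor \<open>1 / n\<close> and removes at most two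
  matrices.\<close>

theorem controlled_mixed_moment:
  "\<exists>C\<ge>0. \<forall>n \<mu> (I :: 'i set) W w D E \<Phi>. haar_measure n \<mu> \<longrightarrow> finite I \<longrightarrow> card I = N \<longrightarrow> 1 \<le> n \<longrightarrow> 2 * N \<le> n \<longrightarrow>
     (\<forall>i\<in>I. op_bounded n (w i) (W i) \<and> mat_trace (W i) = 0) \<longrightarrow> controlled n I D E \<Phi> \<longrightarrow>
     cmod (\<Phi> (mixed_moment \<mu> I W)) \<le> C * E * (\<Prod>i\<in>I. w i) * (1 / sqrt n) ^ N"
proof (induction N rule: less_induct)
  case (less N)
  show ?case
  proof (cases "N = 0")
    case True
    show ?thesis
    proof (intro exI[of _ 1] conjI allI impI)
      fix n \<mu> and I :: "'i set" and W w D E \<Phi>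
      assume h: "haar_measure n \<mu>" "finite I" "card I = N" "controlled n I D E \<Phi>"
      interpret haar_measure n \<mu> by fact
      interpret prob_space \<mu> by (rule prob)
      have I: "I = {}" using h True by simp
      have "mixed_moment \<mu> I W = index_delta I id"
        unfolding I by (intro ext) (simp add: mixed_moment_def index_delta_def prob_space)
      then show "cmod (\<Phi> (mixed_moment \<mu> I W)) \<le> 1 * E * (\<Prod>i\<in>I. w i) * (1 / sqrt n) ^ N"
        using controlled_delta[OF h(4) permutes_id] I True by simp
    qed simp
  next
    case False
    from less[of "N - 1"] False obtain C1 where C1: "0 \<le> C1" and IH1:
      "\<And>n \<mu> (I :: 'i set) W w D E \<Phi>. haar_measure n \<mu> \<Longrightarrow> finite I \<Longrightarrow> card I = N - 1 \<Longrightarrow> 1 \<le> n \<Longrightarrow> 2 * (N - 1) \<le> n \<Longrightarrow>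
        (\<forall>i\<in>I. op_bounded n (w i) (W i) \<and> mat_trace (W i) = 0) \<Longrightarrow> controlled n I D E \<Phi> \<Longrightarrow>
        cmod (\<Phi> (mixed_moment \<mu> I W)) \<le> C1 * E * (\<Prod>i\<in>I. w i) * (1 / sqrt n) ^ (N - 1)"
      by auto
    from less[of "N - 2"] False obtain C2 where C2: "0 \<le> C2" and IH2:
      "\<And>n \<mu> (I :: 'i set) W w D E \<Phi>. haar_measure n \<mu> \<Longrightarrow> finite I \<Longrightarrow> card I = N - 2 \<Longrightarrow> 1 \<le> n \<Longrightarrow> 2 * (N - 2) \<le> n \<Longrightarrow>
        (\<forall>i\<in>I. op_bounded n (w i) (W i) \<and> mat_trace (W i) = 0) \<Longrightarrow> controlled n I D E \<Phi> \<Longrightarrow>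
        cmod (\<Phi> (mixed_moment \<mu> I W)) \<le> C2 * E * (\<Prod>i\<in>I. w i) * (1 / sqrt n) ^ (N - 2)"
      by auto
    show ?thesis
    \<comment> \<open>A contraction costs \<open>C2\<close> for the scalar part of the product and
      \<open>2 * C1\<close> for its centred part, as centring may double an operator bound. There
      are \<open>N - 1\<close> contractions, and the leading \<open>2\<close> pays for absorbing the
      permuted terms.\<close>
    proof (intro exI[of _ "2 * real (N - 1) * (2 * C1 + C2)"] conjI allI impI)
      show "0 \<le> 2 * real (N - 1) * (2 * C1 + C2)" using C1 C2 by simp
      fix n \<mu> and I :: "'i set" and W w D E \<Phi>\<^sub>0
      assume haar: "haar_measure n \<mu>" and I: "finite I" "card I = N" and n: "1 \<le> n" "2 * N \<le> n"
        and W: "\<forall>i\<in>I. op_bounded n (w i) (W i) \<and> mat_trace (W i) = 0"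
        and \<Phi>\<^sub>0: "controlled n I D E \<Phi>\<^sub>0"
      interpret haar_measure n \<mu> by fact
      have Wc: "W i \<in> carrier_mat n n" if "i \<in> I" for i using W that op_bounded_carrier by blast
      have w: "0 \<le> w i" if "i \<in> I" for i using W that op_bounded_nonneg by blast
      obtain p where p: "p \<in> I" using I False by fastforce
      define s where "s = 1 / sqrt n"
      have s: "0 < s" "s \<le> 1" using n by (auto simp: s_def)
      have s2: "s\<^sup>2 = 1 / n" using n by (simp add: s_def power_divide)
      define R where "R = (2 * C1 + C2) * E * (\<Prod>i\<in>I. w i) * s ^ (N - 2)"
      have E: "0 \<le> E" using controlled_nonneg[OF \<Phi>\<^sub>0] .
      have prod_w: "0 \<le> (\<Prod>i\<in>I. w i)" using w by (intro prod_nonneg) auto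
      have R: "0 \<le> R" using C1 C2 E prod_w s by (simp add: R_def)
      define T where "T = mixed_moment \<mu> I W"
      let ?T' = "\<lambda>k. mixed_moment \<mu> (I - {p}) (W(k := W k * W p))"
      let ?c = "\<lambda>k f y b. (if y p = b k then f y (b \<circ> Transposition.transpose p k) else 0)"

      \<comment> \<open>The product \<open>W k * W p\<close> is split into its centred part, leading
        to a moment of \<open>N - 1\<close> matrices with trace zero, and its normalized trace,
        leading to a moment of \<open>N - 2\<close> of them; the induction hypothesis covers
        both.\<close>
      have contraction: "cmod (\<Phi> (?c k (?T' k))) \<le> R"
        if \<Phi>: "controlled n I D E \<Phi>" and k: "k \<in> I - {p}" for \<Phi> k
      proof -
        let ?J = "I - {p}"
        let ?W = "W(k := W k * W p)"
        define \<Psi> where "\<Psi> = (\<lambda>f. \<Phi> (?c k f))"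
        define \<Psi>' where "\<Psi>' = (\<lambda>f. \<Psi> (\<lambda>y b. if y k = b k then f y b else 0))"
        have \<Psi>: "controlled n ?J D E \<Psi>"
          unfolding \<Psi>_def by (rule controlled_contract[OF \<Phi> I(1) p k])
        have \<Psi>': "controlled n (?J - {k}) D E \<Psi>'"
          unfolding \<Psi>'_def by (rule controlled_fix[OF \<Psi> finite_Diff[OF I(1)] k])
        have cards: "card ?J = N - 1" "card (?J - {k}) = N - 2" using I p k by auto
        have Wkp: "op_bounded n (w k * w p) (W k * W p)" using W k p by (intro op_bounded_mult) auto
        have Wc': "?W i \<in> carrier_mat n n" if "i \<in> ?J" for i
          using Wc Wkp that op_bounded_carrier by auto
        have prod_J: "(\<Prod>i\<in>I. w i) = w p * (w k * (\<Prod>i\<in>?J - {k}. w i))"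
          using I p k by (simp add: prod.remove[of I p] prod.remove[of ?J k])
        have "\<Psi> (?T' k) = \<Psi> (\<lambda>y b. mat_ntrace (W k * W p) *
            (if y k = b k then mixed_moment \<mu> (?J - {k}) ?W y b else 0)
            + mixed_moment \<mu> ?J (?W(k := centre (?W k))) y b)"
        proof (rule controlled_cong[OF \<Psi>])
          fix y b assume "\<And>i. i \<in> ?J \<Longrightarrow> y i < n" "\<And>i. i \<in> ?J \<Longrightarrow> b i < n"
          then show "?T' k y b = mat_ntrace (W k * W p) *
            (if y k = b k then mixed_moment \<mu> (?J - {k}) ?W y b else 0)
            + mixed_moment \<mu> ?J (?W(k := centre (?W k))) y b"
            using mixed_moment_centre[of ?J k ?W y b] I k Wc' by simp
        qed
        also have "\<dots> = mat_ntrace (W k * W p) * \<Psi>' (mixed_moment \<mu> (?J - {k}) ?W)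
            + \<Psi> (mixed_moment \<mu> ?J (?W(k := centre (?W k))))"
          unfolding \<Psi>'_def by (rule controlled_linear[OF \<Psi>])
        finally have split: "cmod (\<Psi> (?T' k)) \<le>
            cmod (mat_ntrace (W k * W p)) * cmod (\<Psi>' (mixed_moment \<mu> (?J - {k}) ?W))
            + cmod (\<Psi> (mixed_moment \<mu> ?J (?W(k := centre (?W k)))))"
          using norm_triangle_ineq[of "mat_ntrace (W k * W p) * \<Psi>' (mixed_moment \<mu> (?J - {k}) ?W)"
              "\<Psi> (mixed_moment \<mu> ?J (?W(k := centre (?W k))))"] by (simp only: norm_mult)
        have "mixed_moment \<mu> (?J - {k}) ?W = mixed_moment \<mu> (?J - {k}) W"
          by (rule mixed_moment_cong) auto
        moreover have "cmod (\<Psi>' (mixed_moment \<mu> (?J - {k}) W)) \<le> C2 * E * (\<Prod>i\<in>?J - {k}. w i) * s ^ (N - 2)"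
          unfolding s_def using I cards n W by (intro IH2[OF haar _ _ _ _ _ \<Psi>']) auto
        ultimately have "cmod (mat_ntrace (W k * W p)) * cmod (\<Psi>' (mixed_moment \<mu> (?J - {k}) ?W))
            \<le> (w k * w p) * (C2 * E * (\<Prod>i\<in>?J - {k}. w i) * s ^ (N - 2))"
          using op_bounded_ntrace[OF Wkp] w k p by (intro mult_mono) auto
        also have "\<dots> = C2 * E * (\<Prod>i\<in>I. w i) * s ^ (N - 2)" by (simp add: prod_J)
        finally have first: "cmod (mat_ntrace (W k * W p)) * cmod (\<Psi>' (mixed_moment \<mu> (?J - {k}) ?W))
            \<le> C2 * E * (\<Prod>i\<in>I. w i) * s ^ (N - 2)" .
        let ?w = "w(k := 2 * (w k * w p))"
        have "cmod (\<Psi> (mixed_moment \<mu> ?J (?W(k := centre (?W k))))) \<le> C1 * E * (\<Prod>i\<in>?J. ?w i) * s ^ (N - 1)"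
          unfolding s_def using I cards n W op_bounded_centre[OF Wkp] centre_trace[OF op_bounded_carrier[OF Wkp]]
          by (intro IH1[OF haar _ _ _ _ _ \<Psi>]) auto
        also have "(\<Prod>i\<in>?J. ?w i) = 2 * (\<Prod>i\<in>I. w i)"
        proof -
          have "(\<Prod>i\<in>?J - {k}. ?w i) = (\<Prod>i\<in>?J - {k}. w i)" by (intro prod.cong) auto
          then show ?thesis using I k by (simp add: prod_J prod.remove[of ?J k])
        qed
        \<comment> \<open>The centred part is smaller by one factor \<open>s\<close>; this gain is
          given up so that both parts carry the power \<open>N - 2\<close>.\<close>
        also have "C1 * E * (2 * (\<Prod>i\<in>I. w i)) * s ^ (N - 1) \<le> C1 * E * (2 * (\<Prod>i\<in>I. w i)) * s ^ (N - 2)"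
          using C1 E prod_w s by (intro mult_left_mono power_decreasing) auto
        finally have second: "cmod (\<Psi> (mixed_moment \<mu> ?J (?W(k := centre (?W k)))))
            \<le> C1 * E * (2 * (\<Prod>i\<in>I. w i)) * s ^ (N - 2)" .
        have "cmod (\<Psi> (?T' k)) \<le> C2 * E * (\<Prod>i\<in>I. w i) * s ^ (N - 2)
            + C1 * E * (2 * (\<Prod>i\<in>I. w i)) * s ^ (N - 2)"
          using split first second by linarith
        also have "\<dots> = R" by (simp add: R_def algebra_simps)
        finally show ?thesis unfolding \<Psi>_def .
      qed

      have step: "n * cmod (\<Phi> T) \<le> (\<Sum>k\<in>I - {p}. R + cmod (\<Phi> (\<lambda>y b. T (y \<circ> Transposition.transpose p k) b)))"
        if \<Phi>: "controlled n I D E \<Phi>" for \<Phi>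
      proof -
        have "of_nat n * \<Phi> T = \<Phi> (\<lambda>y b. of_nat n * T y b + 0)"
          using controlled_linear[OF \<Phi>, of "of_nat n" T "\<lambda>_ _. 0"]
            controlled_linear[OF \<Phi>, of 1 "\<lambda>_ _. 0" "\<lambda>_ _. 0"] by simp
        also have "\<dots> = \<Phi> (\<lambda>y b. \<Sum>k\<in>I - {p}. -1 * T (y \<circ> Transposition.transpose p k) b + ?c k (?T' k) y b)"
        proof (rule controlled_cong[OF \<Phi>])
          fix y b assume yb: "\<And>i. i \<in> I \<Longrightarrow> y i < n" "\<And>i. i \<in> I \<Longrightarrow> b i < n"
          show "of_nat n * T y b + 0
            = (\<Sum>k\<in>I - {p}. -1 * T (y \<circ> Transposition.transpose p k) b + ?c k (?T' k) y b)"
            unfolding T_def using schwinger_dyson[OF I(1) p Wc yb] W p by simp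
        qed
        also have "\<dots> = (\<Sum>k\<in>I - {p}. -1 * \<Phi> (\<lambda>y b. T (y \<circ> Transposition.transpose p k) b) + \<Phi> (?c k (?T' k)))"
          unfolding controlled_sum[OF \<Phi> finite_Diff[OF I(1)]] controlled_linear[OF \<Phi>] ..
        finally have "n * cmod (\<Phi> T) = cmod \<dots>" by (metis norm_mult norm_of_nat)
        also have "\<dots> \<le> (\<Sum>k\<in>I - {p}. R + cmod (\<Phi> (\<lambda>y b. T (y \<circ> Transposition.transpose p k) b)))"
        proof (rule sum_norm_le)
          fix k assume k: "k \<in> I - {p}"
          have "cmod (-1 * \<Phi> (\<lambda>y b. T (y \<circ> Transposition.transpose p k) b) + \<Phi> (?c k (?T' k)))
            \<le> cmod (\<Phi> (\<lambda>y b. T (y \<circ> Transposition.transpose p k) b)) + cmod (\<Phi> (?c k (?T' k)))"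
            using norm_triangle_ineq[of "-1 * \<Phi> (\<lambda>y b. T (y \<circ> Transposition.transpose p k) b)" "\<Phi> (?c k (?T' k))"]
            by simp
          then show "cmod (-1 * \<Phi> (\<lambda>y b. T (y \<circ> Transposition.transpose p k) b) + \<Phi> (?c k (?T' k)))
            \<le> R + cmod (\<Phi> (\<lambda>y b. T (y \<circ> Transposition.transpose p k) b))"
            using contraction[OF \<Phi> k] by linarith
        qed
        finally show ?thesis .
      qed

      \<comment> \<open>The supremum is over every functional with the bounds \<open>D\<close> and
        \<open>E\<close>, not just the given one: a permuted functional is again of this kind, so
        each permuted term is at most \<open>Sup X\<close>.\<close>
      define X where "X = (\<lambda>\<Phi>. cmod (\<Phi> T)) ` {\<Phi>. controlled n I D E \<Phi>}"
      have bdd: "bdd_above X"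
      proof (rule bdd_aboveI)
        fix x assume "x \<in> X"
        then obtain \<Phi> where \<Phi>: "controlled n I D E \<Phi>" and x: "x = cmod (\<Phi> T)" by (auto simp: X_def)
        show "x \<le> D * (\<Prod>i\<in>I. n * frob (W i))"
          unfolding x T_def by (rule controlled_bound[OF \<Phi>], rule mixed_moment_le[OF I(1) Wc])
      qed
      have ne: "X \<noteq> {}" using \<Phi>\<^sub>0 by (auto simp: X_def)
      have in_X: "cmod (\<Phi> T) \<le> Sup X" if "controlled n I D E \<Phi>" for \<Phi>
        using that by (intro cSup_upper bdd) (auto simp: X_def)
      have Sup0: "0 \<le> Sup X" by (rule order_trans[OF norm_ge_zero in_X[OF \<Phi>\<^sub>0]])
      have "Sup X \<le> real (N - 1) * (R + Sup X) / n"
      proof (rule cSup_least[OF ne])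
        fix x assume "x \<in> X"
        then obtain \<Phi> where \<Phi>: "controlled n I D E \<Phi>" and x: "x = cmod (\<Phi> T)" by (auto simp: X_def)
        have "n * x \<le> (\<Sum>k\<in>I - {p}. R + Sup X)"
          unfolding x using p
          by (intro order_trans[OF step[OF \<Phi>]] sum_mono add_left_mono
              in_X[OF controlled_permute[OF \<Phi> permutes_swap_id]]) auto
        also have "\<dots> = real (N - 1) * (R + Sup X)" using I p by simp
        finally show "x \<le> real (N - 1) * (R + Sup X) / n" using n by (simp add: field_simps)
      qed
      then have "n * Sup X \<le> real (N - 1) * R + real (N - 1) * Sup X"
        using n by (simp add: field_simps)
      \<comment> \<open>Here \<open>2 * N \<le> n\<close> enters: the permuted terms amount to at
        most half of \<open>n * Sup X\<close>, and since the supremum is finite they can be moved to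
        the left side.\<close>
      moreover have "real (N - 1) * Sup X \<le> n / 2 * Sup X"
        using n Sup0 by (intro mult_right_mono) auto
      ultimately have "Sup X \<le> 2 * real (N - 1) * R / n" using n by (simp add: field_simps)
      \<comment> \<open>The factor \<open>1 / n\<close> is \<open>s^2\<close> and restores the power
        \<open>N\<close>. For \<open>N = 1\<close> both sides are zero, so the truncated exponent
        \<open>N - 2\<close> is harmless.\<close>
      moreover have "2 * real (N - 1) * R / n = 2 * real (N - 1) * (2 * C1 + C2) * E * (\<Prod>i\<in>I. w i) * s ^ N"
      proof (cases "N = 1")
        case False
        then have "N - 2 + 2 = N" using \<open>N \<noteq> 0\<close> by simp
        then have "s ^ N = s ^ (N - 2) * s\<^sup>2" by (metis power_add)
        then show ?thesis by (simp add: R_def s2)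
      qed simp
      ultimately show "cmod (\<Phi>\<^sub>0 (mixed_moment \<mu> I W))
          \<le> 2 * real (N - 1) * (2 * C1 + C2) * E * (\<Prod>i\<in>I. w i) * (1 / sqrt n) ^ N"
        using in_X[OF \<Phi>\<^sub>0] unfolding T_def s_def by linarith
    qed
  qed
qed

section \<open>Traces along permutations and fourth moments\<close>

text \<open>Equals the product, over the cycles of \<open>\<rho>\<close>, of the traces of the
  matrices multiplied along the cycle. As one sum over index functions it requires no cycle
  decomposition.\<close>

definition perm_trace :: "nat \<Rightarrow> 'i set \<Rightarrow> ('i \<Rightarrow> complex mat) \<Rightarrow> ('i \<Rightarrow> 'i) \<Rightarrow> complex" where
  "perm_trace n I M \<rho> = (\<Sum>x \<in> Pi\<^sub>E I (\<lambda>_. {..<n}). \<Prod>i\<in>I. M i $$ (x i, x (\<rho> i)))"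

lemma sum_PiE_insert:
  assumes "j \<notin> I"
  shows "(\<Sum>x \<in> Pi\<^sub>E (insert j I) (\<lambda>_. S). f x) = (\<Sum>x \<in> Pi\<^sub>E I (\<lambda>_. S). \<Sum>v\<in>S. f (x(j := v)))"
proof -
  have "(\<Sum>x \<in> Pi\<^sub>E (insert j I) (\<lambda>_. S). f x) = (\<Sum>(v, x) \<in> S \<times> Pi\<^sub>E I (\<lambda>_. S). f (x(j := v)))"
    unfolding PiE_insert_eq
    by (subst sum.reindex[OF inj_combinator[OF assms]]) (simp add: case_prod_unfold o_def)
  then show ?thesis by (simp add: sum.cartesian_product[symmetric] sum.swap[of _ S])
qed

lemma perm_trace_empty [simp]: "perm_trace n {} M \<rho> = 1"
  by (simp add: perm_trace_def)

lemma perm_trace_fix: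
  assumes I: "finite I" "j \<in> I" and \<rho>: "\<rho> permutes I" "\<rho> j = j" and M: "M j \<in> carrier_mat n n"
  shows "perm_trace n I M \<rho> = mat_trace (M j) * perm_trace n (I - {j}) M \<rho>"
proof -
  have ne: "\<rho> i \<noteq> j" if "i \<noteq> j" for i
    using that \<rho> by (metis permutes_def)
  have "perm_trace n I M \<rho> = (\<Sum>x \<in> Pi\<^sub>E (insert j (I - {j})) (\<lambda>_. {..<n}). \<Prod>i\<in>I. M i $$ (x i, x (\<rho> i)))"
    using I by (simp add: perm_trace_def insert_absorb)
  also have "\<dots> = (\<Sum>x \<in> Pi\<^sub>E (I - {j}) (\<lambda>_. {..<n}). \<Sum>v<n. M j $$ (v, v) * (\<Prod>i\<in>I - {j}. M i $$ (x i, x (\<rho> i))))"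
  proof (subst sum_PiE_insert, simp, intro sum.cong refl)
    fix x v
    have "(\<Prod>i\<in>I. M i $$ ((x(j := v)) i, (x(j := v)) (\<rho> i)))
      = M j $$ (v, v) * (\<Prod>i\<in>I - {j}. M i $$ ((x(j := v)) i, (x(j := v)) (\<rho> i)))"
      using \<rho>(2) by (subst prod.remove[OF I]) simp
    also have "(\<Prod>i\<in>I - {j}. M i $$ ((x(j := v)) i, (x(j := v)) (\<rho> i)))
      = (\<Prod>i\<in>I - {j}. M i $$ (x i, x (\<rho> i)))"
      using ne by (intro prod.cong) auto
    finally show "(\<Prod>i\<in>I. M i $$ ((x(j := v)) i, (x(j := v)) (\<rho> i)))
      = M j $$ (v, v) * (\<Prod>i\<in>I - {j}. M i $$ (x i, x (\<rho> i)))" .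
  qed
  also have "\<dots> = mat_trace (M j) * perm_trace n (I - {j}) M \<rho>"
    unfolding perm_trace_def mat_trace_def'[OF M]
    by (simp add: sum_distrib_right[symmetric] sum_distrib_left)
  finally show ?thesis .
qed

text \<open>Summing out the index at \<open>j\<close> multiplies \<open>M j\<close> onto its
  predecessor \<open>M k\<close> and shortens the cycle. The composed permutation sends
  \<open>k\<close> to the former image of \<open>j\<close> and fixes \<open>j\<close>, which is then
  removed.\<close>

lemma perm_trace_merge:
  assumes I: "finite I" "j \<in> I" "k \<in> I" "j \<noteq> k" and \<rho>: "\<rho> permutes I" "\<rho> k = j"
    and M: "M j \<in> carrier_mat n n" "M k \<in> carrier_mat n n"
  shows "perm_trace n I M \<rho>
    = perm_trace n (I - {j}) (M(k := M k * M j)) (Transposition.transpose j (\<rho> j) \<circ> \<rho>)"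
proof -
  let ?\<rho> = "Transposition.transpose j (\<rho> j) \<circ> \<rho>"
  have inj: "inj \<rho>" using \<rho>(1) permutes_inj by blast
  have \<rho>j: "\<rho> j \<noteq> j" using I(4) \<rho>(2) injD[OF inj, of j k] by auto
  have \<rho>jI: "\<rho> j \<in> I - {j}" using \<rho>j permutes_in_image[OF \<rho>(1), of j] I by auto
  have ne: "\<rho> i \<noteq> j" "\<rho> i \<noteq> \<rho> j" if "i \<noteq> j" "i \<noteq> k" for i
    using that \<rho>(2) injD[OF inj] by blast+
  have "perm_trace n I M \<rho> = (\<Sum>x \<in> Pi\<^sub>E (insert j (I - {j})) (\<lambda>_. {..<n}). \<Prod>i\<in>I. M i $$ (x i, x (\<rho> i)))"
    using I by (simp add: perm_trace_def insert_absorb)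
  also have "\<dots> = (\<Sum>x \<in> Pi\<^sub>E (I - {j}) (\<lambda>_. {..<n}). \<Sum>v<n.
      M k $$ (x k, v) * M j $$ (v, x (\<rho> j)) * (\<Prod>i\<in>I - {j} - {k}. M i $$ (x i, x (\<rho> i))))"
  proof (subst sum_PiE_insert, simp, intro sum.cong refl)
    fix x v
    let ?f = "\<lambda>i. M i $$ ((x(j := v)) i, (x(j := v)) (\<rho> i))"
    have "(\<Prod>i\<in>I. ?f i) = ?f j * (?f k * (\<Prod>i\<in>I - {j} - {k}. ?f i))"
      using I by (simp add: prod.remove[of I j] prod.remove[of "I - {j}" k])
    also have "(\<Prod>i\<in>I - {j} - {k}. ?f i) = (\<Prod>i\<in>I - {j} - {k}. M i $$ (x i, x (\<rho> i)))"
      using ne by (intro prod.cong) auto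
    finally show "(\<Prod>i\<in>I. ?f i)
      = M k $$ (x k, v) * M j $$ (v, x (\<rho> j)) * (\<Prod>i\<in>I - {j} - {k}. M i $$ (x i, x (\<rho> i)))"
      using \<rho>(2) \<rho>j I(4) by simp
  qed
  also have "\<dots> = (\<Sum>x \<in> Pi\<^sub>E (I - {j}) (\<lambda>_. {..<n}). \<Prod>i\<in>I - {j}. (M(k := M k * M j)) i $$ (x i, x (?\<rho> i)))"
  proof (intro sum.cong refl)
    fix x assume x: "x \<in> Pi\<^sub>E (I - {j}) (\<lambda>_. {..<n})"
    let ?g = "\<lambda>i. (M(k := M k * M j)) i $$ (x i, x (?\<rho> i))"
    have "x k < n" "x (\<rho> j) < n" using x I \<rho>jI by (auto simp: PiE_iff)
    then have "?g k = (\<Sum>v<n. M k $$ (x k, v) * M j $$ (v, x (\<rho> j)))"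
      using \<rho>(2) mult_entry[OF M(2,1)] by (simp del: index_mult_mat(1))
    moreover have "(\<Prod>i\<in>I - {j} - {k}. ?g i) = (\<Prod>i\<in>I - {j} - {k}. M i $$ (x i, x (\<rho> i)))"
      using ne by (intro prod.cong) auto
    moreover have "(\<Prod>i\<in>I - {j}. ?g i) = ?g k * (\<Prod>i\<in>I - {j} - {k}. ?g i)"
      using I by (intro prod.remove) auto
    ultimately show "(\<Sum>v<n. M k $$ (x k, v) * M j $$ (v, x (\<rho> j)) * (\<Prod>i\<in>I - {j} - {k}. M i $$ (x i, x (\<rho> i))))
      = (\<Prod>i\<in>I - {j}. ?g i)"
      by (simp only: sum_distrib_right)
  qed
  finally show ?thesis unfolding perm_trace_def .
qed

text \<open>Induction on the number of indices. A fixed point splits off a trace; any other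
  \<open>j\<close> is merged into its predecessor, and the product satisfies both bounds with
  \<open>m k * m j\<close>, by submultiplicativity and Cauchy--Schwarz respectively.\<close>

lemma perm_trace_le:
  assumes "finite I" "\<rho> permutes I" "\<And>i. i \<in> I \<Longrightarrow> M i \<in> carrier_mat n n"
    and "\<And>i. i \<in> I \<Longrightarrow> frob (M i) \<le> m i" "\<And>i. i \<in> I \<Longrightarrow> cmod (mat_trace (M i)) \<le> m i"
  shows "cmod (perm_trace n I M \<rho>) \<le> (\<Prod>i\<in>I. m i)"
  using assms
proof (induction "card I" arbitrary: I \<rho> M m)
  case 0
  then show ?case by simp
next
  case (Suc N)
  then obtain j where j: "j \<in> I" by fastforce
  have card: "N = card (I - {j})" using Suc.hyps Suc.prems(1) j by simp
  have fin: "finite (I - {j})" using Suc.prems by simp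
  have m: "0 \<le> m i" if "i \<in> I" for i
    using order_trans[OF frob_nonneg Suc.prems(4)[OF that]] .
  show ?case
  proof (cases "\<rho> j = j")
    case True
    then have "\<rho> permutes I - {j}" by (intro permutes_superset[OF Suc.prems(2)]) auto
    then have "cmod (perm_trace n (I - {j}) M \<rho>) \<le> (\<Prod>i\<in>I - {j}. m i)"
      using Suc.prems by (intro Suc.hyps(1)[OF card fin]) auto
    then have "cmod (mat_trace (M j)) * cmod (perm_trace n (I - {j}) M \<rho>) \<le> m j * (\<Prod>i\<in>I - {j}. m i)"
      using Suc.prems j m by (intro mult_mono) auto
    then show ?thesis
      using perm_trace_fix[OF Suc.prems(1) j Suc.prems(2) True] Suc.prems(1,3) j
      by (simp add: norm_mult prod.remove)
  next
    case False
    define k where "k = inv_into UNIV \<rho> j"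
    have \<rho>k: "\<rho> k = j" unfolding k_def using permutes_inverses[OF Suc.prems(2)] by simp
    have k: "k \<in> I" using \<rho>k j permutes_in_image[OF Suc.prems(2)] by metis
    have jk: "j \<noteq> k" using \<rho>k False by auto
    let ?\<rho> = "Transposition.transpose j (\<rho> j) \<circ> \<rho>"
    let ?M = "M(k := M k * M j)"
    let ?m = "m(k := m k * m j)"
    have "?\<rho> permutes I"
      using j permutes_in_image[OF Suc.prems(2), of j]
      by (intro permutes_compose[OF Suc.prems(2)] permutes_swap_id) auto
    then have perm: "?\<rho> permutes I - {j}" by (rule permutes_superset) auto
    have "frob (M k * M j) \<le> m k * m j"
      using Suc.prems j k m by (intro order_trans[OF frob_mult[of _ n]] mult_mono) auto
    moreover have "cmod (mat_trace (M k * M j)) \<le> m k * m j"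
      using Suc.prems j k m by (intro order_trans[OF mat_trace_mult_le[of _ n]] mult_mono) auto
    moreover have "M k * M j \<in> carrier_mat n n" using Suc.prems j k by (intro mult_carrier_mat) auto
    ultimately have "cmod (perm_trace n (I - {j}) ?M ?\<rho>) \<le> (\<Prod>i\<in>I - {j}. ?m i)"
      using Suc.prems by (intro Suc.hyps(1)[OF card fin perm]) auto
    also have "\<dots> = (m k * m j) * (\<Prod>i\<in>I - {j} - {k}. m i)"
    proof -
      have "(\<Prod>i\<in>I - {j} - {k}. ?m i) = (\<Prod>i\<in>I - {j} - {k}. m i)" by (intro prod.cong) auto
      then show ?thesis using fin k jk by (subst prod.remove[of _ k]) auto
    qed
    also have "\<dots> = (\<Prod>i\<in>I. m i)"
      using Suc.prems(1) j k jk by (simp add: prod.remove[of I j] prod.remove[of "I - {j}" k])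
    finally show ?thesis
      using perm_trace_merge[OF Suc.prems(1) j k jk Suc.prems(2) \<rho>k] Suc.prems(3) j k by simp
  qed
qed

lemma perm_trace_mult:
  assumes I: "finite I" "\<rho> permutes I"
    and AB: "\<And>i. i \<in> I \<Longrightarrow> A i \<in> carrier_mat n n" "\<And>i. i \<in> I \<Longrightarrow> B i \<in> carrier_mat n n"
  shows "perm_trace n I (\<lambda>i. A i * B i) \<rho> =
    (\<Sum>x \<in> Pi\<^sub>E I (\<lambda>_. {..<n}). \<Sum>y \<in> Pi\<^sub>E I (\<lambda>_. {..<n}).
      (\<Prod>i\<in>I. A i $$ (x i, y i)) * (\<Prod>i\<in>I. B i $$ (y i, x (\<rho> i))))"
  unfolding perm_trace_def
proof (intro sum.cong refl)
  fix x assume x: "x \<in> Pi\<^sub>E I (\<lambda>_. {..<n})"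
  have "(\<Prod>i\<in>I. (A i * B i) $$ (x i, x (\<rho> i))) = (\<Prod>i\<in>I. \<Sum>v<n. A i $$ (x i, v) * B i $$ (v, x (\<rho> i)))"
    using x permutes_in_image[OF I(2)] by (intro prod.cong refl mult_entry AB) (auto simp: PiE_iff)
  also have "\<dots> = (\<Sum>y \<in> Pi\<^sub>E I (\<lambda>_. {..<n}). \<Prod>i\<in>I. A i $$ (x i, y i) * B i $$ (y i, x (\<rho> i)))"
    using I by (intro prod_sum_PiE) auto
  finally show "(\<Prod>i\<in>I. (A i * B i) $$ (x i, x (\<rho> i))) = (\<Sum>y \<in> Pi\<^sub>E I (\<lambda>_. {..<n}).
      (\<Prod>i\<in>I. A i $$ (x i, y i)) * (\<Prod>i\<in>I. B i $$ (y i, x (\<rho> i))))"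
    by (simp add: prod.distrib)
qed

text \<open>Linear in the tensor \<open>f\<close>. At a mixed moment it is an expected trace along
  \<open>\<pi>\<close>; at the permutation tensor of \<open>\<sigma>\<close> it is the trace of the
  \<open>A i\<close> along \<open>\<pi> \<circ> \<sigma>\<close>.\<close>

definition trace_functional ::
    "nat \<Rightarrow> 'i set \<Rightarrow> ('i \<Rightarrow> complex mat) \<Rightarrow> ('i \<Rightarrow> 'i) \<Rightarrow> (('i \<Rightarrow> nat) \<Rightarrow> ('i \<Rightarrow> nat) \<Rightarrow> complex) \<Rightarrow> complex" where
  "trace_functional n I A \<pi> f = (\<Sum>x \<in> Pi\<^sub>E I (\<lambda>_. {..<n}). \<Sum>y \<in> Pi\<^sub>E I (\<lambda>_. {..<n}).
      (\<Prod>i\<in>I. A i $$ (x i, y i)) * f y (x \<circ> \<pi>))"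

text \<open>The first constant is the sum of the absolute values of all coefficients and may grow
  with \<open>n\<close>. The second depends on the bounds \<open>a i\<close> alone, because on a
  permutation tensor the functional is a trace along \<open>\<pi> \<circ> \<sigma>\<close>.\<close>

lemma trace_functional_controlled:
  assumes I: "finite I" "\<pi> permutes I" and A: "\<And>i. i \<in> I \<Longrightarrow> A i \<in> carrier_mat n n"
    and a: "\<And>i. i \<in> I \<Longrightarrow> frob (A i) \<le> a i" "\<And>i. i \<in> I \<Longrightarrow> cmod (mat_trace (A i)) \<le> a i"
  shows "controlled n I (\<Sum>x \<in> Pi\<^sub>E I (\<lambda>_. {..<n}). \<Sum>y \<in> Pi\<^sub>E I (\<lambda>_. {..<n}). cmod (\<Prod>i\<in>I. A i $$ (x i, y i)))
    (\<Prod>i\<in>I. a i) (trace_functional n I A \<pi>)"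
proof (rule controlledI)
  show "trace_functional n I A \<pi> (\<lambda>y b. c * f y b + g y b)
    = c * trace_functional n I A \<pi> f + trace_functional n I A \<pi> g" for c f g
    by (simp add: trace_functional_def sum_distrib_left sum.distrib algebra_simps)
next
  fix f :: "('a \<Rightarrow> nat) \<Rightarrow> ('a \<Rightarrow> nat) \<Rightarrow> complex" and K
  assume f: "\<And>y b. (\<And>i. i \<in> I \<Longrightarrow> y i < n) \<Longrightarrow> (\<And>i. i \<in> I \<Longrightarrow> b i < n) \<Longrightarrow> cmod (f y b) \<le> K"
  show "cmod (trace_functional n I A \<pi> f) \<le> (\<Sum>x \<in> Pi\<^sub>E I (\<lambda>_. {..<n}). \<Sum>y \<in> Pi\<^sub>E I (\<lambda>_. {..<n}).
    cmod (\<Prod>i\<in>I. A i $$ (x i, y i))) * K"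
    unfolding trace_functional_def sum_distrib_right
  proof (intro sum_norm_le)
    fix x y assume "x \<in> Pi\<^sub>E I (\<lambda>_. {..<n})" "y \<in> Pi\<^sub>E I (\<lambda>_. {..<n})"
    then have "cmod (f y (x \<circ> \<pi>)) \<le> K"
      using permutes_in_image[OF I(2)] by (intro f) (auto simp: PiE_iff)
    then show "cmod ((\<Prod>i\<in>I. A i $$ (x i, y i)) * f y (x \<circ> \<pi>)) \<le> cmod (\<Prod>i\<in>I. A i $$ (x i, y i)) * K"
      unfolding norm_mult by (intro mult_left_mono) auto
  qed
next
  fix \<sigma> assume \<sigma>: "\<sigma> permutes I"
  have "trace_functional n I A \<pi> (index_delta I \<sigma>) = perm_trace n I A (\<pi> \<circ> \<sigma>)"
    unfolding trace_functional_def perm_trace_def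
  proof (intro sum.cong refl)
    fix x assume x: "x \<in> Pi\<^sub>E I (\<lambda>_. {..<n})"
    have mem: "x (\<pi> (\<sigma> i)) < n" if "i \<in> I" for i
      using x that permutes_in_image[OF I(2)] permutes_in_image[OF \<sigma>] by (auto simp: PiE_iff)
    have "(\<Sum>y \<in> Pi\<^sub>E I (\<lambda>_. {..<n}). (\<Prod>i\<in>I. A i $$ (x i, y i)) * index_delta I \<sigma> y (x \<circ> \<pi>))
      = (\<Sum>y \<in> Pi\<^sub>E I (\<lambda>_. {..<n}). \<Prod>i\<in>I. A i $$ (x i, y i) * (if y i = x (\<pi> (\<sigma> i)) then 1 else 0))"
      by (simp add: index_delta_def prod.distrib)
    also have "\<dots> = (\<Prod>i\<in>I. \<Sum>v<n. A i $$ (x i, v) * (if v = x (\<pi> (\<sigma> i)) then 1 else 0))"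
      using I by (intro prod_sum_PiE[symmetric]) auto
    also have "\<dots> = (\<Prod>i\<in>I. A i $$ (x i, x ((\<pi> \<circ> \<sigma>) i)))"
      using mem by (intro prod.cong refl) (simp add: if_distrib[of "(*) _"] cong: if_cong)
    finally show "(\<Sum>y \<in> Pi\<^sub>E I (\<lambda>_. {..<n}). (\<Prod>i\<in>I. A i $$ (x i, y i)) * index_delta I \<sigma> y (x \<circ> \<pi>))
      = (\<Prod>i\<in>I. A i $$ (x i, x ((\<pi> \<circ> \<sigma>) i)))" .
  qed
  then show "cmod (trace_functional n I A \<pi> (index_delta I \<sigma>)) \<le> (\<Prod>i\<in>I. a i)"
    using perm_trace_le[OF I(1) permutes_compose[OF \<sigma> I(2)] A a] by simp
qed

context haar_measure
begin

lemma trace_functional_mixed_moment: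
  assumes I: "finite I" "\<pi> permutes I" and A: "\<And>i. i \<in> I \<Longrightarrow> A i \<in> carrier_mat n n"
    and W: "\<And>i. i \<in> I \<Longrightarrow> W i \<in> carrier_mat n n"
  shows "trace_functional n I A \<pi> (mixed_moment \<mu> I W)
    = (\<integral>V. perm_trace n I (\<lambda>i. A i * conj_mat V (W i)) \<pi> \<partial>\<mu>)"
proof -
  let ?P = "Pi\<^sub>E I (\<lambda>_. {..<n})"
  let ?f = "\<lambda>x y V. (\<Prod>i\<in>I. A i $$ (x i, y i)) * (\<Prod>i\<in>I. conj_mat V (W i) $$ (y i, x (\<pi> i)))"
  have int: "integrable \<mu> (\<lambda>V. \<Prod>i\<in>I. conj_mat V (W i) $$ (y i, x (\<pi> i)))"
    if "x \<in> ?P" "y \<in> ?P" for x y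
    using that permutes_in_image[OF I(2)] W
    by (intro integrable_bounded_measurable bounded_measurable_prod bounded_measurable_conj_mat_entry)
      (auto simp: PiE_iff)
  have "(\<integral>V. perm_trace n I (\<lambda>i. A i * conj_mat V (W i)) \<pi> \<partial>\<mu>) = (\<integral>V. (\<Sum>x\<in>?P. \<Sum>y\<in>?P. ?f x y V) \<partial>\<mu>)"
    by (intro Bochner_Integration.integral_cong refl perm_trace_mult I A conj_mat_carrier W)
      (auto simp: space_eq dest: unitary_groupD(1))
  also have "\<dots> = (\<Sum>x\<in>?P. \<Sum>y\<in>?P. \<integral>V. ?f x y V \<partial>\<mu>)"
    using int by (subst Bochner_Integration.integral_sum)
      (auto intro!: sum.cong Bochner_Integration.integral_sum Bochner_Integration.integrable_sum)
  also have "\<dots> = trace_functional n I A \<pi> (mixed_moment \<mu> I W)"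
    unfolding trace_functional_def mixed_moment_def using int by (intro sum.cong refl) simp
  finally show ?thesis by simp
qed

end

section \<open>Complex conjugates and products of traces along permutations\<close>

lemma sum_PiE_permute:
  assumes \<pi>: "\<pi> permutes J"
  shows "(\<Sum>x \<in> Pi\<^sub>E J (\<lambda>_. S). f x) = (\<Sum>x \<in> Pi\<^sub>E J (\<lambda>_. S). f (restrict (x \<circ> \<pi>) J))"
proof -
  let ?\<pi>' = "inv_into UNIV \<pi>"
  have mem: "\<pi> i \<in> J \<longleftrightarrow> i \<in> J" "?\<pi>' i \<in> J \<longleftrightarrow> i \<in> J" for i
    using permutes_in_image[OF \<pi>] permutes_in_image[OF permutes_inv[OF \<pi>]] by auto
  show ?thesis
    by (rule sum.reindex_bij_witness[where i = "\<lambda>x. restrict (x \<circ> \<pi>) J" and j = "\<lambda>x. restrict (x \<circ> ?\<pi>') J"])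
      (auto simp: mem permutes_inverses[OF \<pi>] PiE_iff restrict_def extensional_def fun_eq_iff
        intro!: arg_cong[of _ _ f])
qed

text \<open>Conjugation reverses the cycles and replaces the factors by adjoints. The reversed word
  has the adjoint of \<open>B i\<close> preceded by that of the next \<open>A\<close>, hence the
  index \<open>\<pi> i\<close>; regrouping in this way keeps the order of an \<open>A\<close>
  followed by a \<open>B\<close>.\<close>

lemma perm_trace_cnj:
  assumes J: "finite J" "\<pi> permutes J"
    and A: "\<And>i. i \<in> J \<Longrightarrow> A i \<in> carrier_mat n n" and B: "\<And>i. i \<in> J \<Longrightarrow> B i \<in> carrier_mat n n"
  shows "cnj (perm_trace n J (\<lambda>i. A i * B i) \<pi>)
    = perm_trace n J (\<lambda>i. mat_adjoint (A (\<pi> i)) * mat_adjoint (B i)) (inv_into UNIV \<pi>)"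
proof -
  let ?P = "Pi\<^sub>E J (\<lambda>_. {..<n})"
  let ?\<pi>' = "inv_into UNIV \<pi>"
  let ?G = "\<lambda>x y. (\<Prod>i\<in>J. mat_adjoint (A (\<pi> i)) $$ (x i, y i)) * (\<Prod>i\<in>J. mat_adjoint (B i) $$ (y i, x (?\<pi>' i)))"
  have mem: "\<pi> i \<in> J \<longleftrightarrow> i \<in> J" "?\<pi>' i \<in> J \<longleftrightarrow> i \<in> J" for i
    using permutes_in_image[OF J(2)] permutes_in_image[OF permutes_inv[OF J(2)]] by auto
  have "cnj (perm_trace n J (\<lambda>i. A i * B i) \<pi>)
    = (\<Sum>x\<in>?P. \<Sum>y\<in>?P. (\<Prod>i\<in>J. cnj (A i $$ (x i, y i))) * (\<Prod>i\<in>J. cnj (B i $$ (y i, x (\<pi> i)))))"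
    using assms by (subst perm_trace_mult) auto
  also have "\<dots> = (\<Sum>x\<in>?P. \<Sum>y\<in>?P. ?G (restrict (y \<circ> \<pi>) J) (restrict (x \<circ> \<pi>) J))"
  proof (intro sum.cong refl arg_cong2[where f = "(*)"])
    fix x y assume x: "x \<in> ?P" and y: "y \<in> ?P"
    have "(\<Prod>i\<in>J. cnj (A i $$ (x i, y i))) = (\<Prod>i\<in>J. cnj (A (\<pi> i) $$ (x (\<pi> i), y (\<pi> i))))"
      by (subst prod.permute[OF J(2)]) (simp add: o_def)
    also have "\<dots> = (\<Prod>i\<in>J. mat_adjoint (A (\<pi> i)) $$ (restrict (y \<circ> \<pi>) J i, restrict (x \<circ> \<pi>) J i))"
    proof (intro prod.cong refl)
      fix i assume i: "i \<in> J"
      have "A (\<pi> i) \<in> carrier_mat n n" "x (\<pi> i) < n" "y (\<pi> i) < n"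
        using A x y i mem by (auto simp: PiE_iff)
      then show "cnj (A (\<pi> i) $$ (x (\<pi> i), y (\<pi> i)))
        = mat_adjoint (A (\<pi> i)) $$ (restrict (y \<circ> \<pi>) J i, restrict (x \<circ> \<pi>) J i)"
        using i by auto
    qed
    finally show "(\<Prod>i\<in>J. cnj (A i $$ (x i, y i)))
      = (\<Prod>i\<in>J. mat_adjoint (A (\<pi> i)) $$ (restrict (y \<circ> \<pi>) J i, restrict (x \<circ> \<pi>) J i))" .
    show "(\<Prod>i\<in>J. cnj (B i $$ (y i, x (\<pi> i))))
      = (\<Prod>i\<in>J. mat_adjoint (B i) $$ (restrict (x \<circ> \<pi>) J i, restrict (y \<circ> \<pi>) J (?\<pi>' i)))"
    proof (intro prod.cong refl)
      fix i assume i: "i \<in> J"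
      have "B i \<in> carrier_mat n n" "x (\<pi> i) < n" "y i < n"
        using B x y i mem by (auto simp: PiE_iff)
      then show "cnj (B i $$ (y i, x (\<pi> i)))
        = mat_adjoint (B i) $$ (restrict (x \<circ> \<pi>) J i, restrict (y \<circ> \<pi>) J (?\<pi>' i))"
        using i mem permutes_inverses[OF J(2)] by auto
    qed
  qed
  also have "\<dots> = (\<Sum>x\<in>?P. \<Sum>y\<in>?P. ?G y (restrict (x \<circ> \<pi>) J))"
    by (intro sum.cong refl sum_PiE_permute[OF J(2), symmetric])
  also have "\<dots> = (\<Sum>x\<in>?P. \<Sum>y\<in>?P. ?G y x)"
    by (rule sum_PiE_permute[OF J(2), symmetric, of "\<lambda>x. \<Sum>y\<in>?P. ?G y x"])
  also have "\<dots> = (\<Sum>y\<in>?P. \<Sum>x\<in>?P. ?G y x)" by (rule sum.swap)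
  also have "\<dots> = perm_trace n J (\<lambda>i. mat_adjoint (A (\<pi> i)) * mat_adjoint (B i)) ?\<pi>'"
    using A B mem by (intro perm_trace_mult[symmetric] J permutes_inv) auto
  finally show ?thesis .
qed

text \<open>Independent permutations on the disjoint copies of \<open>J\<close>, so that a product
  of traces is a single trace along a permutation. It is the identity elsewhere, as
  \<open>permutes\<close> demands.\<close>

definition fibrewise :: "'q set \<Rightarrow> 'i set \<Rightarrow> ('q \<Rightarrow> 'i \<Rightarrow> 'i) \<Rightarrow> 'q \<times> 'i \<Rightarrow> 'q \<times> 'i" where
  "fibrewise Q J \<rho> p = (if p \<in> Q \<times> J then (fst p, \<rho> (fst p) (snd p)) else p)"

lemma fibrewise_permutes:
  assumes "\<And>q. q \<in> Q \<Longrightarrow> \<rho> q permutes J"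
  shows "fibrewise Q J \<rho> permutes Q \<times> J"
proof (rule bij_imp_permutes)
  show "bij_betw (fibrewise Q J \<rho>) (Q \<times> J) (Q \<times> J)"
    by (rule bij_betw_byWitness[where f' = "fibrewise Q J (\<lambda>q. inv_into UNIV (\<rho> q))"])
      (auto simp: fibrewise_def permutes_inverses[OF assms] permutes_in_image[OF assms]
        permutes_in_image[OF permutes_inv[OF assms]])
qed (simp add: fibrewise_def)

text \<open>Distributivity: choosing one index function per copy is the same as choosing one index
  function on \<open>Q \<times> J\<close>.\<close>

lemma perm_trace_fibrewise:
  assumes fin: "finite Q" "finite J" and \<rho>: "\<And>q. q \<in> Q \<Longrightarrow> \<rho> q permutes J"
  shows "perm_trace n (Q \<times> J) M (fibrewise Q J \<rho>) = (\<Prod>q\<in>Q. perm_trace n J (\<lambda>i. M (q, i)) (\<rho> q))"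
proof -
  let ?P = "Pi\<^sub>E J (\<lambda>_. {..<n})"
  have "(\<Prod>q\<in>Q. perm_trace n J (\<lambda>i. M (q, i)) (\<rho> q))
    = (\<Sum>X \<in> Pi\<^sub>E Q (\<lambda>_. ?P). \<Prod>q\<in>Q. \<Prod>i\<in>J. M (q, i) $$ (X q i, X q (\<rho> q i)))"
    unfolding perm_trace_def using fin by (intro prod_sum_PiE) (auto intro: finite_PiE)
  also have "\<dots> = (\<Sum>x \<in> Pi\<^sub>E (Q \<times> J) (\<lambda>_. {..<n}). \<Prod>p\<in>Q \<times> J. M p $$ (x p, x (fibrewise Q J \<rho> p)))"
  proof (rule sum.reindex_bij_witness[where i = "\<lambda>x. \<lambda>q\<in>Q. \<lambda>i\<in>J. x (q, i)"
        and j = "\<lambda>X. \<lambda>p\<in>Q \<times> J. X (fst p) (snd p)"])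
    fix X assume X: "X \<in> Pi\<^sub>E Q (\<lambda>_. ?P)"
    show "(\<lambda>q\<in>Q. \<lambda>i\<in>J. (\<lambda>p\<in>Q \<times> J. X (fst p) (snd p)) (q, i)) = X"
    proof (intro ext)
      fix q i
      show "(\<lambda>q\<in>Q. \<lambda>i\<in>J. (\<lambda>p\<in>Q \<times> J. X (fst p) (snd p)) (q, i)) q i = X q i"
        using X by (cases "q \<in> Q"; cases "i \<in> J") (auto simp: PiE_iff extensional_def)
    qed
    show "(\<lambda>p\<in>Q \<times> J. X (fst p) (snd p)) \<in> Pi\<^sub>E (Q \<times> J) (\<lambda>_. {..<n})"
      using X by (auto simp: PiE_iff)
    show "(\<Prod>p\<in>Q \<times> J. M p $$ ((\<lambda>p\<in>Q \<times> J. X (fst p) (snd p)) p,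
        (\<lambda>p\<in>Q \<times> J. X (fst p) (snd p)) (fibrewise Q J \<rho> p)))
      = (\<Prod>q\<in>Q. \<Prod>i\<in>J. M (q, i) $$ (X q i, X q (\<rho> q i)))"
      unfolding prod.cartesian_product
      by (intro prod.cong refl) (auto simp: fibrewise_def permutes_in_image[OF \<rho>])
  next
    fix x assume x: "x \<in> Pi\<^sub>E (Q \<times> J) (\<lambda>_. {..<n})"
    show "(\<lambda>p\<in>Q \<times> J. (\<lambda>q\<in>Q. \<lambda>i\<in>J. x (q, i)) (fst p) (snd p)) = x"
      using x by (auto simp: PiE_iff extensional_def fun_eq_iff)
    show "(\<lambda>q\<in>Q. \<lambda>i\<in>J. x (q, i)) \<in> Pi\<^sub>E Q (\<lambda>_. ?P)"
      using x by (auto simp: PiE_iff)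
  qed
  finally show ?thesis unfolding perm_trace_def by simp
qed

text \<open>With \<open>Y\<close> the product of the adjoint of \<open>W\<close> and
  \<open>X\<close>, the squared norm of \<open>Y\<close> is the pairing of \<open>X\<close> with
  \<open>W * Y\<close>, hence at most \<open>c\<close> times the norms of \<open>X\<close> and
  \<open>Y\<close>; one norm of \<open>Y\<close> is cancelled.\<close>

lemma op_bounded_adjoint:
  assumes "op_bounded n c W"
  shows "op_bounded n c (mat_adjoint W)"
  unfolding op_bounded_def
proof (intro conjI ballI)
  note W = op_bounded_carrier[OF assms]
  show "mat_adjoint W \<in> carrier_mat n n" "0 \<le> c" using W op_bounded_nonneg[OF assms] by auto
  fix X :: "complex mat" assume X: "X \<in> carrier_mat n n"
  let ?Y = "mat_adjoint W * X"
  have Y: "?Y \<in> carrier_mat n n" using W X by (intro mult_carrier_mat[of _ n n]) auto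
  have "mat_adjoint ?Y * ?Y = mat_adjoint X * (W * ?Y)"
    using W X by (simp add: adjoint_mult[of _ n] assoc_mult_mat[of _ n n _ n _ n] mult_carrier_mat[of _ n n])
  then have "complex_of_real ((frob ?Y)\<^sup>2) = mat_trace (mat_adjoint X * (W * ?Y))"
    using mat_trace_adjoint_mult[OF Y] by simp
  then have "(frob ?Y)\<^sup>2 = cmod (mat_trace (mat_adjoint X * (W * ?Y)))"
    by (metis norm_of_real abs_of_nonneg zero_le_power2)
  also have "\<dots> \<le> frob (mat_adjoint X) * frob (W * ?Y)"
    using X W Y by (intro mat_trace_mult_le[of _ n]) auto
  also have "\<dots> \<le> frob X * (c * frob ?Y)"
    using op_boundedD[OF assms Y] X by (simp add: frob_adjoint[of _ n] mult_left_mono)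
  finally have "frob ?Y * frob ?Y \<le> (c * frob X) * frob ?Y"
    by (simp add: power2_eq_square mult.assoc mult.left_commute)
  then show "frob ?Y \<le> c * frob X"
    using op_bounded_nonneg[OF assms] by (cases "frob ?Y = 0") (auto simp: less_le)
qed

lemma mat_trace_adjoint:
  "X \<in> carrier_mat n n \<Longrightarrow> mat_trace (mat_adjoint X) = cnj (mat_trace X)"
  by (auto simp: mat_trace_def intro!: sum.cong)

section \<open>Traces of products as traces along a cycle, and their fourth moments\<close>

definition mat_prod :: "nat \<Rightarrow> complex mat list \<Rightarrow> complex mat" where
  "mat_prod n Ms = foldr (*) Ms (1\<^sub>m n)"

lemma mat_prod_simps [simp]:
  "mat_prod n [] = 1\<^sub>m n" "mat_prod n (X # Ms) = X * mat_prod n Ms"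
  by (simp_all add: mat_prod_def)

lemma mat_prod_carrier: "set Ms \<subseteq> carrier_mat n n \<Longrightarrow> mat_prod n Ms \<in> carrier_mat n n"
  by (induction Ms) (auto intro: mult_carrier_mat)

lemma mat_prod_append:
  "\<lbrakk>set Ms \<subseteq> carrier_mat n n; set Ns \<subseteq> carrier_mat n n\<rbrakk> \<Longrightarrow>
    mat_prod n (Ms @ Ns) = mat_prod n Ms * mat_prod n Ns"
  using mat_prod_carrier[of Ns n]
  by (induction Ms)
    (auto simp: assoc_mult_mat[of _ n n _ n _ n] mat_prod_carrier left_mult_one_mat[of _ n n])

text \<open>The successor modulo \<open>m\<close>, extended by the identity outside
  \<open>{..<m}\<close> so that it satisfies \<open>permutes\<close>.\<close>

definition cyc :: "nat \<Rightarrow> nat \<Rightarrow> nat" where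
  "cyc m i = (if i < m then (if Suc i = m then 0 else Suc i) else i)"

lemma cyc_permutes: "cyc m permutes {..<m}"
proof (rule bij_imp_permutes)
  show "bij_betw (cyc m) {..<m} {..<m}"
    by (rule bij_betw_byWitness[where f' = "\<lambda>i. if i = 0 then m - 1 else i - 1"])
      (auto simp: cyc_def)
qed (simp add: cyc_def)

lemma perm_trace_cong:
  assumes "\<And>i. i \<in> I \<Longrightarrow> M i = M' i" "\<And>i. i \<in> I \<Longrightarrow> \<rho> i = \<rho>' i"
  shows "perm_trace n I M \<rho> = perm_trace n I M' \<rho>'"
  unfolding perm_trace_def using assms by (intro sum.cong prod.cong) auto

text \<open>Induction on the length: replacing the last two matrices by their product corresponds to
  one application of \<open>perm_trace_merge\<close>, and a single matrix is a fixed point.\<close>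

lemma mat_trace_mat_prod:
  assumes "Ms \<noteq> []" "set Ms \<subseteq> carrier_mat n n"
  shows "mat_trace (mat_prod n Ms) = perm_trace n {..<length Ms} (\<lambda>i. Ms ! i) (cyc (length Ms))"
  using assms
proof (induction "length Ms" arbitrary: Ms rule: less_induct)
  case less
  obtain Ls Y where Ms: "Ms = Ls @ [Y]" using less.prems(1) by (metis rev_exhaust)
  show ?case
  proof (cases "Ls = []")
    case True
    have "perm_trace n {..<1} (\<lambda>i. Ms ! i) (cyc 1) = mat_trace (Ms ! 0) * perm_trace n ({..<1} - {0}) (\<lambda>i. Ms ! i) (cyc 1)"
      using less.prems(2) Ms True by (intro perm_trace_fix cyc_permutes) (auto simp: cyc_def)
    moreover have "{..<1} - {0::nat} = {}" by auto
    ultimately have "perm_trace n {..<1} (\<lambda>i. Ms ! i) (cyc 1) = mat_trace (Ms ! 0)"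
      by (simp only: perm_trace_empty mult_1_right)
    then show ?thesis using Ms True less.prems(2) by simp
  next
    case False
    then obtain Ks X where Ls: "Ls = Ks @ [X]" by (metis rev_exhaust)
    let ?m = "length Ks"
    let ?M = "\<lambda>i. Ms ! i"
    have X: "X \<in> carrier_mat n n" and Y: "Y \<in> carrier_mat n n" and Ks: "set Ks \<subseteq> carrier_mat n n"
      using less.prems(2) Ms Ls by auto
    have XY: "X * Y \<in> carrier_mat n n" using X Y by (rule mult_carrier_mat)
    have len: "length Ms = Suc (Suc ?m)" using Ms Ls by simp
    have nth: "?M ?m = X" "?M (Suc ?m) = Y" "\<And>i. i < ?m \<Longrightarrow> ?M i = Ks ! i"
      using Ms Ls by (auto simp: nth_append)
    have I: "{..<length Ms} - {Suc ?m} = {..<Suc ?m}" using len by auto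
    have cy: "cyc (length Ms) (Suc ?m) = 0" "cyc (length Ms) ?m = Suc ?m" using len by (auto simp: cyc_def)
    have "perm_trace n {..<length Ms} ?M (cyc (length Ms)) =
      perm_trace n ({..<length Ms} - {Suc ?m}) (?M(?m := ?M ?m * ?M (Suc ?m)))
        (Transposition.transpose (Suc ?m) (cyc (length Ms) (Suc ?m)) \<circ> cyc (length Ms))"
      using X Y nth cy len by (intro perm_trace_merge cyc_permutes) auto
    also have "\<dots> = perm_trace n {..<Suc ?m} (\<lambda>i. (Ks @ [X * Y]) ! i) (cyc (Suc ?m))"
      unfolding I using nth len
      by (intro perm_trace_cong) (auto simp: nth_append cyc_def Transposition.transpose_def less_Suc_eq)
    also have "\<dots> = mat_trace (mat_prod n (Ks @ [X * Y]))"
      using less.hyps[of "Ks @ [X * Y]"] len Ks XY by simp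
    also have "mat_prod n (Ks @ [X * Y]) = mat_prod n Ms"
      unfolding Ms Ls using X Y XY Ks by (simp add: mat_prod_append mat_prod_carrier)
    finally show ?thesis by simp
  qed
qed

definition alternating :: "nat \<Rightarrow> complex mat \<Rightarrow> (complex mat \<times> complex mat) list \<Rightarrow> complex mat" where
  "alternating n V ps = mat_prod n (map (\<lambda>(A, W). A * conj_mat V W) ps)"

lemma alternating_trace:
  assumes "ps \<noteq> []" "V \<in> carrier_mat n n" "set ps \<subseteq> carrier_mat n n \<times> carrier_mat n n"
  shows "mat_trace (alternating n V ps)
    = perm_trace n {..<length ps} (\<lambda>i. fst (ps ! i) * conj_mat V (snd (ps ! i))) (cyc (length ps))"
proof -
  have "A * conj_mat V W \<in> carrier_mat n n" if "(A, W) \<in> set ps" for A W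
    using that assms by (intro mult_carrier_mat[of _ n n] conj_mat_carrier) auto
  then have "mat_trace (alternating n V ps) = perm_trace n {..<length ps}
      (\<lambda>i. map (\<lambda>(A, W). A * conj_mat V W) ps ! i) (cyc (length ps))"
    unfolding alternating_def using assms(1) by (subst mat_trace_mat_prod) auto
  also have "\<dots> = perm_trace n {..<length ps} (\<lambda>i. fst (ps ! i) * conj_mat V (snd (ps ! i))) (cyc (length ps))"
    by (intro perm_trace_cong) (auto simp: case_prod_unfold)
  finally show ?thesis .
qed

lemma bounded_measurable_cong:
  assumes "bounded_measurable n f" "\<And>V. V \<in> unitary_group n \<Longrightarrow> f V = g V"
  shows "bounded_measurable n g"
  using assms measurable_cong[of "borel_unitary n" g f borel] by (auto simp: bounded_measurable_def)

text \<open>Expanded along the cycle, the trace is a polynomial in entries of conjugated matrices,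
  each of which is bounded and measurable.\<close>

lemma bounded_measurable_alternating:
  assumes "set ps \<subseteq> carrier_mat n n \<times> carrier_mat n n"
  shows "bounded_measurable n (\<lambda>V. mat_trace (alternating n V ps))"
proof (cases "ps = []")
  case True
  then show ?thesis by (simp add: alternating_def bounded_measurable_const)
next
  case False
  let ?P = "Pi\<^sub>E {..<length ps} (\<lambda>_. {..<n})"
  let ?\<rho> = "cyc (length ps)"
  have carr: "fst (ps ! i) \<in> carrier_mat n n" "snd (ps ! i) \<in> carrier_mat n n" if "i < length ps" for i
    using assms nth_mem[OF that] by (cases "ps ! i"; auto)+
  have eq: "(\<Sum>x\<in>?P. \<Sum>y\<in>?P. (\<Prod>i<length ps. fst (ps ! i) $$ (x i, y i))
      * (\<Prod>i<length ps. conj_mat V (snd (ps ! i)) $$ (y i, x (?\<rho> i)))) = mat_trace (alternating n V ps)"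
    if "V \<in> unitary_group n" for V
    unfolding alternating_trace[OF False unitary_groupD(1)[OF that] assms]
    using carr unitary_groupD(1)[OF that] by (intro perm_trace_mult[symmetric] cyc_permutes) auto
  show ?thesis
    by (rule bounded_measurable_cong[OF _ eq],
        intro bounded_measurable_sum bounded_measurable_mult bounded_measurable_const
          bounded_measurable_prod bounded_measurable_conj_mat_entry carr)
      (use permutes_in_image[OF cyc_permutes[of "length ps"]] in \<open>auto simp: PiE_iff\<close>)
qed

text \<open>The fourth power of the modulus is the product of two copies of the trace and two of its
  conjugate, hence one trace along a permutation of \<open>4 * m\<close> indices; adjoints keep
  operator bounds and trace zero. The estimate for mixed moments applies with
  \<open>N = 4 * m\<close>, and its condition on \<open>n\<close> becomes
  \<open>8 * m \<le> n\<close>.\<close>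

lemma fourth_moment:
  fixes m :: nat
  assumes m: "1 \<le> m"
  shows "\<exists>C\<ge>0. \<forall>n \<mu> ps a w. haar_measure n \<mu> \<longrightarrow> length ps = m \<longrightarrow> 8 * m \<le> n \<longrightarrow>
    (\<forall>(A, W) \<in> set ps. A \<in> carrier_mat n n \<and> frob A \<le> a \<and> cmod (mat_trace A) \<le> a \<and>
       op_bounded n w W \<and> mat_trace W = 0) \<longrightarrow>
    (\<integral>V. (cmod (mat_trace (alternating n V ps))) ^ 4 \<partial>\<mu>) \<le> C * a ^ (4 * m) * w ^ (4 * m) * (1 / sqrt n) ^ (4 * m)"
proof -
  from controlled_mixed_moment[where 'i = "nat \<times> nat", of "4 * m"]
  obtain C where C: "0 \<le> C" and bound:
    "\<And>n \<mu> (I :: (nat \<times> nat) set) W w D E \<Phi>. haar_measure n \<mu> \<Longrightarrow> finite I \<Longrightarrow> card I = 4 * m \<Longrightarrow> 1 \<le> n \<Longrightarrow>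
       2 * (4 * m) \<le> n \<Longrightarrow> (\<forall>i\<in>I. op_bounded n (w i) (W i) \<and> mat_trace (W i) = 0) \<Longrightarrow> controlled n I D E \<Phi> \<Longrightarrow>
       cmod (\<Phi> (mixed_moment \<mu> I W)) \<le> C * E * (\<Prod>i\<in>I. w i) * (1 / sqrt n) ^ (4 * m)"
    by auto
  show ?thesis
  proof (intro exI[of _ C] conjI C allI impI)
    fix n \<mu> ps a w
    assume haar: "haar_measure n \<mu>" and len: "length ps = m" and n: "8 * m \<le> n"
      and ps: "\<forall>(A, W) \<in> set ps. A \<in> carrier_mat n n \<and> frob A \<le> a \<and> cmod (mat_trace A) \<le> a \<and>
        op_bounded n w W \<and> mat_trace W = 0"
    interpret haar_measure n \<mu> by fact
    let ?J = "{..<m}" and ?Q = "{..<4::nat}"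
    let ?I = "?Q \<times> ?J"
    define \<pi> where "\<pi> = cyc m"
    have \<pi>: "\<pi> permutes ?J" unfolding \<pi>_def by (rule cyc_permutes)
    define A where "A i = fst (ps ! i)" for i
    define W where "W i = snd (ps ! i)" for i
    have A: "A i \<in> carrier_mat n n" "frob (A i) \<le> a" "cmod (mat_trace (A i)) \<le> a"
      and W: "op_bounded n w (W i)" "mat_trace (W i) = 0" if "i < m" for i
      using ps nth_mem[of i ps] that len by (auto simp: A_def W_def case_prod_unfold)
    note Wc = op_bounded_carrier[OF W(1)]
    have \<pi>m: "\<pi> i < m" if "i < m" for i using permutes_in_image[OF \<pi>, of i] that by simp
    \<comment> \<open>Copies \<open>0\<close> and \<open>1\<close> carry the trace, copies
      \<open>2\<close> and \<open>3\<close> its conjugate; the shift by \<open>\<pi>\<close> is the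
      one of \<open>perm_trace_cnj\<close>.\<close>
    define A' where "A' p = (if fst p < 2 then A (snd p) else mat_adjoint (A (\<pi> (snd p))))" for p :: "nat \<times> nat"
    define W' where "W' p = (if fst p < 2 then W (snd p) else mat_adjoint (W (snd p)))" for p :: "nat \<times> nat"
    define \<rho> where "\<rho> q = (if q < 2 then \<pi> else inv_into UNIV \<pi>)" for q :: nat
    have \<rho>: "\<rho> q permutes ?J" for q using \<pi> permutes_inv[OF \<pi>] by (simp add: \<rho>_def)
    let ?\<pi>' = "fibrewise ?Q ?J \<rho>"
    have \<pi>': "?\<pi>' permutes ?I" by (rule fibrewise_permutes[OF \<rho>])
    have A': "A' p \<in> carrier_mat n n" "frob (A' p) \<le> a" "cmod (mat_trace (A' p)) \<le> a" if "p \<in> ?I" for p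
      using that A[of "snd p"] A[of "\<pi> (snd p)"] \<pi>m[of "snd p"]
      by (auto simp: A'_def frob_adjoint[of _ n] mat_trace_adjoint[of _ n])
    have W': "op_bounded n w (W' p)" "mat_trace (W' p) = 0" if "p \<in> ?I" for p
      using that W[of "snd p"] op_bounded_adjoint[of n w "W (snd p)"] Wc[of "snd p"]
      by (auto simp: W'_def mat_trace_adjoint[of _ n])
    have ne: "ps \<noteq> []" using len m by auto
    have psc: "set ps \<subseteq> carrier_mat n n \<times> carrier_mat n n"
      using ps op_bounded_carrier by fastforce
    have point: "complex_of_real ((cmod (mat_trace (alternating n V ps))) ^ 4)
        = perm_trace n ?I (\<lambda>p. A' p * conj_mat V (W' p)) ?\<pi>'" if V: "V \<in> unitary_group n" for V
    proof -
      note Vc = unitary_groupD(1)[OF V]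
      let ?X = "mat_trace (alternating n V ps)"
      have X: "?X = perm_trace n ?J (\<lambda>i. A i * conj_mat V (W i)) \<pi>"
        using alternating_trace[OF ne Vc psc] len by (simp add: A_def W_def \<pi>_def)
      have "cnj ?X = perm_trace n ?J (\<lambda>i. mat_adjoint (A (\<pi> i)) * mat_adjoint (conj_mat V (W i))) (inv_into UNIV \<pi>)"
        unfolding X using A Wc Vc by (intro perm_trace_cnj \<pi>) auto
      also have "\<dots> = perm_trace n ?J (\<lambda>i. mat_adjoint (A (\<pi> i)) * conj_mat V (mat_adjoint (W i))) (inv_into UNIV \<pi>)"
        using Wc Vc by (intro perm_trace_cong) (auto simp: conj_mat_adjoint[of _ n])
      finally have cX: "cnj ?X = perm_trace n ?J (\<lambda>i. mat_adjoint (A (\<pi> i)) * conj_mat V (mat_adjoint (W i))) (inv_into UNIV \<pi>)" .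
      have "perm_trace n ?I (\<lambda>p. A' p * conj_mat V (W' p)) ?\<pi>'
        = (\<Prod>q\<in>?Q. perm_trace n ?J (\<lambda>i. A' (q, i) * conj_mat V (W' (q, i))) (\<rho> q))"
        by (rule perm_trace_fibrewise) (auto simp: \<rho>)
      also have "\<dots> = (\<Prod>q\<in>?Q. if q < 2 then ?X else cnj ?X)"
      proof (intro prod.cong refl)
        fix q :: nat
        show "perm_trace n ?J (\<lambda>i. A' (q, i) * conj_mat V (W' (q, i))) (\<rho> q) = (if q < 2 then ?X else cnj ?X)"
        proof (cases "q < 2")
          case True
          then show ?thesis unfolding X by (simp add: A'_def W'_def \<rho>_def)
        next
          case False
          then show ?thesis unfolding cX by (simp add: A'_def W'_def \<rho>_def)
        qed
      qed
      also have "\<dots> = ?X * ?X * (cnj ?X * cnj ?X)"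
        by (simp add: numeral_eq_Suc lessThan_Suc)
      also have "\<dots> = (?X * cnj ?X) * (?X * cnj ?X)" by simp
      also have "\<dots> = complex_of_real ((cmod ?X)\<^sup>2 * (cmod ?X)\<^sup>2)"
        by (simp only: complex_norm_square[symmetric] of_real_mult)
      also have "(cmod ?X)\<^sup>2 * (cmod ?X)\<^sup>2 = (cmod ?X) ^ 4" by (simp flip: power_add)
      finally show ?thesis by simp
    qed
    let ?E = "\<integral>V. (cmod (mat_trace (alternating n V ps))) ^ 4 \<partial>\<mu>"
    have "complex_of_real ?E = (\<integral>V. complex_of_real ((cmod (mat_trace (alternating n V ps))) ^ 4) \<partial>\<mu>)"
      by (rule integral_complex_of_real[symmetric])
    also have "\<dots> = (\<integral>V. perm_trace n ?I (\<lambda>p. A' p * conj_mat V (W' p)) ?\<pi>' \<partial>\<mu>)"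
      by (intro Bochner_Integration.integral_cong refl point) (simp add: space_eq)
    also have "\<dots> = trace_functional n ?I A' ?\<pi>' (mixed_moment \<mu> ?I W')"
      using A' W' by (intro trace_functional_mixed_moment[symmetric] \<pi>') (blast intro: op_bounded_carrier)+
    finally have "complex_of_real ?E = trace_functional n ?I A' ?\<pi>' (mixed_moment \<mu> ?I W')" .
    then have "\<bar>?E\<bar> = cmod (trace_functional n ?I A' ?\<pi>' (mixed_moment \<mu> ?I W'))"
      by (metis norm_of_real)
    also have "\<dots> \<le> C * (\<Prod>i\<in>?I. a) * (\<Prod>i\<in>?I. w) * (1 / sqrt n) ^ (4 * m)"
      by (rule bound[OF haar _ _ _ _ _ trace_functional_controlled[OF _ \<pi>']])
        (use n m A' W' in auto)
    finally show "?E \<le> C * a ^ (4 * m) * w ^ (4 * m) * (1 / sqrt n) ^ (4 * m)" by simp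
  qed
qed

section \<open>Almost sure convergence\<close>

text \<open>The sum of the fourth powers has finite expectation, so it is almost surely finite and
  its terms tend to zero. Only the individual laws enter, so unitaries of different sizes may be
  coupled arbitrarily.\<close>

lemma AE_tendsto_zero_fourth_moment:
  fixes X :: "nat \<Rightarrow> 'w \<Rightarrow> complex"
  assumes int: "\<And>n. N \<le> n \<Longrightarrow> integrable M (\<lambda>\<omega>. (cmod (X n \<omega>)) ^ 4)"
    and bound: "\<And>n. N \<le> n \<Longrightarrow> (\<integral>\<omega>. (cmod (X n \<omega>)) ^ 4 \<partial>M) \<le> c n" and c: "summable c"
  shows "AE \<omega> in M. (\<lambda>n. X n \<omega>) \<longlonglongrightarrow> 0"
proof -
  let ?Y = "\<lambda>n \<omega>. (cmod (X (n + N) \<omega>)) ^ 4"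
  have c': "summable (\<lambda>n. c (n + N))" using c by (simp add: summable_iff_shift)
  have c0: "0 \<le> c (n + N)" for n
    using bound[of "n + N"] by (intro order_trans[OF _ bound[of "n + N"]] integral_nonneg_AE) auto
  have meas: "(\<lambda>\<omega>. ennreal (?Y n \<omega>)) \<in> borel_measurable M" for n
    using int[of "n + N"] by auto
  have "(\<integral>\<^sup>+\<omega>. suminf (\<lambda>n. ennreal (?Y n \<omega>)) \<partial>M) = suminf (\<lambda>n. \<integral>\<^sup>+\<omega>. ennreal (?Y n \<omega>) \<partial>M)"
    using meas by (rule nn_integral_suminf)
  also have "\<dots> \<le> suminf (\<lambda>n. ennreal (c (n + N)))"
  proof (intro suminf_le summableI)
    fix n
    have "(\<integral>\<^sup>+\<omega>. ennreal (?Y n \<omega>) \<partial>M) = ennreal (\<integral>\<omega>. ?Y n \<omega> \<partial>M)"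
      using int[of "n + N"] by (intro nn_integral_eq_integral) auto
    then show "(\<integral>\<^sup>+\<omega>. ennreal (?Y n \<omega>) \<partial>M) \<le> ennreal (c (n + N))"
      using bound[of "n + N"] by (simp add: ennreal_leI)
  qed
  also have "\<dots> < \<infinity>"
    using suminf_ennreal2[OF c0 c'] by (simp add: less_top[symmetric])
  finally have "(\<integral>\<^sup>+\<omega>. suminf (\<lambda>n. ennreal (?Y n \<omega>)) \<partial>M) \<noteq> \<infinity>" by simp
  then have "AE \<omega> in M. suminf (\<lambda>n. ennreal (?Y n \<omega>)) \<noteq> \<infinity>"
    using meas by (intro nn_integral_PInf_AE) auto
  then show ?thesis
  proof eventually_elim
    case (elim \<omega>)
    then have "summable (\<lambda>n. ?Y n \<omega>)" by (intro summable_suminf_not_top) auto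
    then have "(\<lambda>n. ?Y n \<omega>) \<longlonglongrightarrow> 0" by (rule summable_LIMSEQ_zero)
    then have "(\<lambda>n. root 4 (?Y n \<omega>)) \<longlonglongrightarrow> root 4 0" by (rule tendsto_real_root)
    then have "(\<lambda>n. cmod (X (n + N) \<omega>)) \<longlonglongrightarrow> 0" by (simp add: real_root_power_cancel)
    then have "(\<lambda>n. X (n + N) \<omega>) \<longlonglongrightarrow> 0" by (rule tendsto_norm_zero_cancel)
    then show ?case by (rule LIMSEQ_offset)
  qed
qed

text \<open>The trace is bounded separately because the Frobenius norm controls it only up to
  \<open>sqrt n\<close>. For products, Frobenius bounds give both estimates.\<close>

definition trace_bounded :: "(nat \<Rightarrow> complex mat) \<Rightarrow> bool" where
  "trace_bounded A \<longleftrightarrow> (\<exists>c. \<forall>n\<ge>1. A n \<in> carrier_mat n n \<and> frob (A n) \<le> c \<and> cmod (mat_trace (A n)) \<le> c)"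

text \<open>The exponent is what bounded normalized eighth moments yield: the eighth power of the
  operator norm is at most the unnormalized trace of the fourth power of
  \<open>mat_adjoint W * W\<close>, which is of order \<open>n\<close>.\<close>

definition moment_bounded :: "(nat \<Rightarrow> complex mat) \<Rightarrow> bool" where
  "moment_bounded W \<longleftrightarrow> (\<exists>c. \<forall>n\<ge>1. op_bounded n (c * real n powr (1/8)) (W n) \<and> cmod (mat_ntrace (W n)) \<le> c)"

definition centred :: "(nat \<Rightarrow> complex mat) \<Rightarrow> bool" where
  "centred W \<longleftrightarrow> (\<forall>n\<ge>1. mat_trace (W n) = 0)"

lemma trace_bounded_carrier: "\<lbrakk>trace_bounded A; 1 \<le> n\<rbrakk> \<Longrightarrow> A n \<in> carrier_mat n n"
  by (auto simp: trace_bounded_def)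

lemma moment_bounded_carrier: "\<lbrakk>moment_bounded W; 1 \<le> n\<rbrakk> \<Longrightarrow> W n \<in> carrier_mat n n"
  by (auto simp: moment_bounded_def dest: op_bounded_carrier)

lemma trace_bounded_mult:
  assumes "trace_bounded A" "trace_bounded B"
  shows "trace_bounded (\<lambda>n. A n * B n)"
proof -
  from assms obtain c d where c: "\<And>n. 1 \<le> n \<Longrightarrow> A n \<in> carrier_mat n n \<and> frob (A n) \<le> c"
    and d: "\<And>n. 1 \<le> n \<Longrightarrow> B n \<in> carrier_mat n n \<and> frob (B n) \<le> d"
    unfolding trace_bounded_def by meson
  have "frob (A n * B n) \<le> c * d \<and> cmod (mat_trace (A n * B n)) \<le> c * d" if n: "1 \<le> n" for n
  proof -
    have "frob (A n) * frob (B n) \<le> c * d"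
      using c[OF n] d[OF n] order_trans[OF frob_nonneg, of "A n" c] by (intro mult_mono) auto
    then show ?thesis
      using c[OF n] d[OF n] frob_mult[of "A n" n "B n"] mat_trace_mult_le[of "A n" n "B n"] by auto
  qed
  then show ?thesis
    unfolding trace_bounded_def using c d by (intro exI[of _ "c * d"]) (auto intro!: mult_carrier_mat)
qed

lemma moment_bounded_centre:
  assumes "moment_bounded W"
  shows "moment_bounded (\<lambda>n. centre (W n))" "centred (\<lambda>n. centre (W n))"
proof -
  from assms obtain c where c: "\<And>n. 1 \<le> n \<Longrightarrow> op_bounded n (c * real n powr (1/8)) (W n)"
    "\<And>n. 1 \<le> n \<Longrightarrow> cmod (mat_ntrace (W n)) \<le> c"
    unfolding moment_bounded_def by auto
  have c0: "0 \<le> c" using c(2)[of 1] order_trans[OF norm_ge_zero] by auto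
  have tr: "mat_trace (centre (W n)) = 0" if "1 \<le> n" for n
    using centre_trace op_bounded_carrier[OF c(1)[OF that]] by blast
  then show "centred (\<lambda>n. centre (W n))" by (simp add: centred_def)
  show "moment_bounded (\<lambda>n. centre (W n))"
    unfolding moment_bounded_def
  proof (intro exI[of _ "2 * c"] allI impI conjI)
    fix n :: nat assume n: "1 \<le> n"
    show "op_bounded n (2 * c * real n powr (1/8)) (centre (W n))"
      using op_bounded_centre[OF c(1)[OF n]] by (simp add: mult.assoc)
    show "cmod (mat_ntrace (centre (W n))) \<le> 2 * c"
      using tr[OF n] c0 by (simp add: mat_ntrace_def)
  qed
qed

lemma finite_uniform_bound:
  fixes P :: "'a \<Rightarrow> real \<Rightarrow> bool"
  assumes "finite S" "\<And>x. x \<in> S \<Longrightarrow> \<exists>c. P x c" "\<And>x c d. \<lbrakk>P x c; c \<le> d\<rbrakk> \<Longrightarrow> P x d"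
  shows "\<exists>c\<ge>0. \<forall>x\<in>S. P x c"
  using assms(1,2)
proof (induction S rule: finite_induct)
  case (insert a S)
  from insert.IH insert.prems obtain c where c: "0 \<le> c" "\<And>x. x \<in> S \<Longrightarrow> P x c" by blast
  from insert.prems[of a] obtain d where d: "P a d" by blast
  have "P x (max c d)" if "x \<in> insert a S" for x
    using that assms(3)[OF c(2), of x "max c d"] assms(3)[OF d, of "max c d"] by auto
  then show ?case using c(1) by (intro exI[of _ "max c d"]) auto
qed auto

lemma Bfun_mult_tendsto_zero:
  fixes f g :: "'a \<Rightarrow> complex"
  assumes "Bfun f F" "(g \<longlongrightarrow> 0) F"
  shows "((\<lambda>x. f x * g x) \<longlongrightarrow> 0) F"
  using bounded_bilinear.Bfun_prod_Zfun[OF bounded_bilinear_mult assms(1)] assms(2)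
  by (simp add: tendsto_Zfun_iff)

section \<open>Almost sure limits of alternating traces\<close>

type_synonym mat_seq = "nat \<Rightarrow> complex mat"

definition at_stage :: "nat \<Rightarrow> (mat_seq \<times> mat_seq) list \<Rightarrow> (complex mat \<times> complex mat) list" where
  "at_stage n ps = map (\<lambda>(A, W). (A n, W n)) ps"

locale haar_sequence = prob_space M for M :: "'w measure" +
  fixes U :: "nat \<Rightarrow> 'w \<Rightarrow> complex mat"
  assumes haar: "1 \<le> n \<Longrightarrow> haar_unitary n M (U n)"
begin

lemma haar_measure_distr: "1 \<le> n \<Longrightarrow> haar_measure n (distr M (borel_unitary n) (U n))"
  using haar by (simp add: haar_measure_def haar_unitary_def)

lemma measurable_U: "1 \<le> n \<Longrightarrow> U n \<in> measurable M (borel_unitary n)"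
  using haar by (simp add: haar_unitary_def)

lemma U_unitary: "\<lbrakk>1 \<le> n; \<omega> \<in> space M\<rbrakk> \<Longrightarrow> U n \<omega> \<in> unitary_group n"
  using measurable_space[OF measurable_U] by simp

text \<open>In the fourth moment each of the \<open>4 * m\<close> pairs contributes
  \<open>n^(1/8) / sqrt n = n^(-3/8)\<close>, in total \<open>n^(-3 m / 2)\<close>. This is summable
  even for \<open>m = 1\<close>.\<close>

lemma AE_alternating_centred:
  assumes ne: "ps \<noteq> []"
    and ps: "\<And>A W. (A, W) \<in> set ps \<Longrightarrow> trace_bounded A \<and> moment_bounded W \<and> centred W"
  shows "AE \<omega> in M. (\<lambda>n. mat_trace (alternating n (U n \<omega>) (at_stage n ps))) \<longlonglongrightarrow> 0"
proof -
  define m where "m = length ps"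
  have m: "1 \<le> m" using ne by (cases ps) (auto simp: m_def)
  have "\<exists>c\<ge>0. \<forall>p\<in>set ps. \<forall>n\<ge>1. fst p n \<in> carrier_mat n n \<and> frob (fst p n) \<le> c \<and>
      cmod (mat_trace (fst p n)) \<le> c \<and> op_bounded n (c * real n powr (1/8)) (snd p n)"
  proof (rule finite_uniform_bound)
    fix p assume "p \<in> set ps"
    then have "trace_bounded (fst p)" "moment_bounded (snd p)" using ps[of "fst p" "snd p"] by auto
    then obtain c d where *: "\<And>n. 1 \<le> n \<Longrightarrow> fst p n \<in> carrier_mat n n \<and> frob (fst p n) \<le> c \<and> cmod (mat_trace (fst p n)) \<le> c"
      "\<And>n. 1 \<le> n \<Longrightarrow> op_bounded n (d * real n powr (1/8)) (snd p n)"
      unfolding trace_bounded_def moment_bounded_def by blast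
    show "\<exists>c. \<forall>n\<ge>1. fst p n \<in> carrier_mat n n \<and> frob (fst p n) \<le> c \<and>
      cmod (mat_trace (fst p n)) \<le> c \<and> op_bounded n (c * real n powr (1/8)) (snd p n)"
    proof (intro exI[of _ "max c d"] allI impI)
      fix n :: nat assume n: "1 \<le> n"
      show "fst p n \<in> carrier_mat n n \<and> frob (fst p n) \<le> max c d \<and>
        cmod (mat_trace (fst p n)) \<le> max c d \<and> op_bounded n (max c d * real n powr (1/8)) (snd p n)"
        using *(1)[OF n] op_bounded_mono[OF *(2)[OF n], of "max c d * real n powr (1/8)"]
          mult_right_mono[of d "max c d" "real n powr (1/8)"] by auto
    qed
  next
    fix p :: "mat_seq \<times> mat_seq" and c d :: real
    assume h: "\<forall>n\<ge>1. fst p n \<in> carrier_mat n n \<and> frob (fst p n) \<le> c \<and>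
      cmod (mat_trace (fst p n)) \<le> c \<and> op_bounded n (c * real n powr (1/8)) (snd p n)" and cd: "c \<le> d"
    show "\<forall>n\<ge>1. fst p n \<in> carrier_mat n n \<and> frob (fst p n) \<le> d \<and>
      cmod (mat_trace (fst p n)) \<le> d \<and> op_bounded n (d * real n powr (1/8)) (snd p n)"
    proof (intro allI impI)
      fix n :: nat assume n: "1 \<le> n"
      show "fst p n \<in> carrier_mat n n \<and> frob (fst p n) \<le> d \<and>
        cmod (mat_trace (fst p n)) \<le> d \<and> op_bounded n (d * real n powr (1/8)) (snd p n)"
        using h[rule_format, OF n] cd op_bounded_mono[of n "c * real n powr (1/8)" _ "d * real n powr (1/8)"]
          mult_right_mono[of c d "real n powr (1/8)"] by auto
    qed
  qed simp
  then obtain c where c: "0 \<le> c" and bd: "\<And>p n. \<lbrakk>p \<in> set ps; 1 \<le> n\<rbrakk> \<Longrightarrow> fst p n \<in> carrier_mat n n \<and>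
      frob (fst p n) \<le> c \<and> cmod (mat_trace (fst p n)) \<le> c \<and> op_bounded n (c * real n powr (1/8)) (snd p n)"
    by blast
  from fourth_moment[OF m] obtain C where C: "0 \<le> C" and moment:
    "\<And>n \<mu> ps a w. haar_measure n \<mu> \<Longrightarrow> length ps = m \<Longrightarrow> 8 * m \<le> n \<Longrightarrow>
    (\<forall>(A, W) \<in> set ps. A \<in> carrier_mat n n \<and> frob A \<le> a \<and> cmod (mat_trace A) \<le> a \<and>
       op_bounded n w W \<and> mat_trace W = 0) \<Longrightarrow>
    (\<integral>V. (cmod (mat_trace (alternating n V ps))) ^ 4 \<partial>\<mu>) \<le> C * a ^ (4 * m) * w ^ (4 * m) * (1 / sqrt n) ^ (4 * m)"
    by blast
  define K where "K = C * c ^ (4 * m) * c ^ (4 * m)"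
  have K: "0 \<le> K" using C c by (simp add: K_def)
  show ?thesis
  proof (rule AE_tendsto_zero_fourth_moment[where N = "8 * m" and c = "\<lambda>n. K * real n powr (-3/2)"])
    show "summable (\<lambda>n. K * real n powr (-3/2))"
      by (intro summable_mult) (simp add: summable_real_powr_iff)
    fix n assume n: "8 * m \<le> n"
    then have n1: "1 \<le> n" using m by simp
    let ?f = "\<lambda>V. mat_trace (alternating n V (at_stage n ps))"
    have stage: "\<forall>(A, W) \<in> set (at_stage n ps). A \<in> carrier_mat n n \<and> frob A \<le> c \<and> cmod (mat_trace A) \<le> c \<and>
       op_bounded n (c * real n powr (1/8)) W \<and> mat_trace W = 0"
      using bd n1 ps by (fastforce simp: at_stage_def centred_def)
    then have "set (at_stage n ps) \<subseteq> carrier_mat n n \<times> carrier_mat n n"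
      using op_bounded_carrier by fastforce
    then have bm: "bounded_measurable n ?f" by (rule bounded_measurable_alternating)
    interpret \<mu>: haar_measure n "distr M (borel_unitary n) (U n)" by (rule haar_measure_distr[OF n1])
    have meas: "(\<lambda>V. (cmod (?f V)) ^ 4) \<in> borel_measurable (borel_unitary n)"
      using bm by (auto simp: bounded_measurable_def)
    obtain B where B: "\<And>V. V \<in> unitary_group n \<Longrightarrow> cmod (?f V) \<le> B"
      using bm by (auto simp: bounded_measurable_def)
    show "integrable M (\<lambda>\<omega>. (cmod (?f (U n \<omega>))) ^ 4)"
      by (rule integrable_const_bound[where B = "B ^ 4"])
        (use B U_unitary[OF n1] measurable_compose[OF measurable_U[OF n1] meas] in
          \<open>auto intro!: power_mono AE_I2\<close>)
    have "(\<integral>\<omega>. (cmod (?f (U n \<omega>))) ^ 4 \<partial>M) = (\<integral>V. (cmod (?f V)) ^ 4 \<partial>(distr M (borel_unitary n) (U n)))"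
      by (rule integral_distr[OF measurable_U[OF n1] meas, symmetric])
    also have "\<dots> \<le> C * c ^ (4 * m) * (c * real n powr (1/8)) ^ (4 * m) * (1 / sqrt n) ^ (4 * m)"
      by (rule moment[OF haar_measure_distr[OF n1] _ n stage]) (simp add: at_stage_def m_def)
    also have "\<dots> = K * (real n powr (1/8) / sqrt n) ^ (4 * m)"
      by (simp add: K_def power_mult_distrib power_divide)
    also have "real n powr (1/8) / sqrt n = real n powr (-3/8)"
      using n1 by (simp add: powr_half_sqrt[symmetric] powr_diff[symmetric])
    also have "(real n powr (-3/8)) ^ (4 * m) = real n powr (-3/2 * m)"
      using n1 by (simp add: powr_power)
    also have "\<dots> \<le> real n powr (-3/2)" using n1 m by (intro powr_mono) auto
    finally show "(\<integral>\<omega>. (cmod (?f (U n \<omega>))) ^ 4 \<partial>M) \<le> K * real n powr (-3/2)"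
      using K by (simp add: mult_left_mono)
  qed
qed

text \<open>Induction on \<open>length ys\<close>, where \<open>xs\<close> collects pairs that are
  already centred. The first matrix of \<open>ys\<close> is written as its centred part, which joins
  \<open>xs\<close>, plus a bounded scalar, which makes the word shorter by letting two of the
  \<open>A\<close> become adjacent. With nothing left to centre, the trace tends to zero.\<close>

lemma AE_alternating_factorization:
  assumes "\<And>A W. (A, W) \<in> set xs \<Longrightarrow> trace_bounded A \<and> moment_bounded W \<and> centred W"
    and "\<And>A W. (A, W) \<in> set ys \<Longrightarrow> trace_bounded A \<and> moment_bounded W"
  shows "AE \<omega> in M. (\<lambda>n. mat_trace (alternating n (U n \<omega>) (at_stage n (xs @ ys)))
      - mat_trace (mat_prod n (map (\<lambda>(A, W). A n) (xs @ ys))) * (\<Prod>(A, W)\<leftarrow>xs @ ys. mat_ntrace (W n))) \<longlonglongrightarrow> 0"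
    (is "AE \<omega> in M. ?D \<omega> xs ys \<longlonglongrightarrow> 0")
  using assms
proof (induction "length ys" arbitrary: xs ys rule: less_induct)
  case less
  let ?T = "\<lambda>\<omega> ps n. mat_trace (alternating n (U n \<omega>) (at_stage n ps))"
  let ?P = "\<lambda>ps n. \<Prod>(A, W)\<leftarrow>ps. mat_ntrace (W n)"
  \<comment> \<open>One centred pair makes the product of normalized traces zero, so the subtracted
    term matters only for lists without centred pairs.\<close>
  have vanish: "?P ps n = 0" if "(A, W) \<in> set ps" "centred W" "1 \<le> n" for ps A W n
  proof -
    have "mat_ntrace (W n) = 0" using that by (simp add: centred_def mat_ntrace_def)
    then show ?thesis using that by (force simp: prod_list_zero_iff)
  qed
  have xs: "\<And>A W. (A, W) \<in> set xs \<Longrightarrow> trace_bounded A \<and> moment_bounded W \<and> centred W"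
    using less.prems(1) by blast
  show ?case
  proof (cases ys)
    case Nil
    show ?thesis
    proof (cases "xs = []")
      case True
      then show ?thesis using Nil by (simp add: alternating_def at_stage_def)
    next
      case False
      then obtain A W where AW: "(A, W) \<in> set xs" by (cases xs) auto
      have "\<forall>\<^sub>F n in sequentially. ?T \<omega> xs n = ?D \<omega> xs ys n" for \<omega>
        using vanish[of A W xs] AW xs[OF AW] Nil by (intro eventually_sequentiallyI[of 1]) simp
      then show ?thesis
        using AE_alternating_centred[OF False xs] by (auto elim!: eventually_mono intro: Lim_transform_eventually)
    qed
  next
    case (Cons y zs)
    obtain A W where y: "y = (A, W)" by (cases y)
    have A: "trace_bounded A" and W: "moment_bounded W" using less.prems(2) Cons y by auto
    define W0 where "W0 n = centre (W n)" for n
    have W0: "moment_bounded W0" "centred W0" using moment_bounded_centre[OF W] by (simp_all add: W0_def[abs_def])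
    have zs: "\<And>A W. (A, W) \<in> set zs \<Longrightarrow> trace_bounded A \<and> moment_bounded W"
      using less.prems(2) Cons by auto
    let ?\<beta> = "\<lambda>n. mat_ntrace (W n)"
    have D1: "AE \<omega> in M. ?D \<omega> (xs @ [(A, W0)]) zs \<longlonglongrightarrow> 0"
    proof (rule less.hyps)
      show "length zs < length ys" using Cons by simp
    qed (use xs zs A W0 in auto)
    obtain B where B: "\<And>n. 1 \<le> n \<Longrightarrow> cmod (?\<beta> n) \<le> B" using W by (auto simp: moment_bounded_def)
    have \<beta>: "Bfun ?\<beta> sequentially" using B by (intro BfunI[of _ B] eventually_sequentiallyI[of 1])
    let ?term = "\<lambda>n V p. fst p n * conj_mat V (snd p n)"
    let ?L = "\<lambda>n V. mat_prod n (map (?term n V) xs)"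
    let ?R = "\<lambda>n V. mat_prod n (map (?term n V) zs)"
    have alt: "alternating n V (at_stage n ps) = mat_prod n (map (?term n V) ps)" for n V ps
      by (simp add: alternating_def at_stage_def case_prod_unfold o_def)
    have term_carr: "set (map (?term n V) ps) \<subseteq> carrier_mat n n"
      if "\<And>A W. (A, W) \<in> set ps \<Longrightarrow> trace_bounded A \<and> moment_bounded W" "1 \<le> n" "V \<in> carrier_mat n n" for n V ps
      using that by (force intro!: mult_carrier_mat[of _ n n] conj_mat_carrier
          dest: trace_bounded_carrier moment_bounded_carrier)
    have carr: "?L n V \<in> carrier_mat n n" "?R n V \<in> carrier_mat n n" "A n \<in> carrier_mat n n"
      "conj_mat V (W n) \<in> carrier_mat n n" "conj_mat V (W0 n) \<in> carrier_mat n n"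
      if "1 \<le> n" "V \<in> carrier_mat n n" for n V
      using that term_carr[of xs n V] term_carr[of zs n V] xs zs
        trace_bounded_carrier[OF A] moment_bounded_carrier[OF W] moment_bounded_carrier[OF W0(1)]
      by (auto intro!: mat_prod_carrier conj_mat_carrier)
    \<comment> \<open>Linearity in one slot: the scalar part of \<open>W n\<close> is invariant
      under conjugation and leaves \<open>A n\<close> directly in front of the remaining
      product.\<close>
    have split: "?T \<omega> (xs @ (A, W) # zs) n = ?T \<omega> (xs @ [(A, W0)] @ zs) n
        + ?\<beta> n * mat_trace (?L n (U n \<omega>) * (A n * ?R n (U n \<omega>)))"
      if n: "1 \<le> n" and \<omega>: "\<omega> \<in> space M" for n \<omega>
    proof -
      let ?V = "U n \<omega>"
      note V = U_unitary[OF n \<omega>]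
      note Vc = unitary_groupD(1)[OF V]
      note c = carr[OF n Vc]
      have app: "mat_prod n (map (?term n ?V) (xs @ (A, X) # zs)) = ?L n ?V * (A n * conj_mat ?V (X n) * ?R n ?V)"
        if "conj_mat ?V (X n) \<in> carrier_mat n n" for X
        using term_carr[of xs n ?V] term_carr[of zs n ?V] xs zs n Vc c that
        by (subst map_append, subst mat_prod_append) (auto intro!: mult_carrier_mat[of _ n n])
      have "conj_mat ?V (W n) = conj_mat ?V (W0 n + ?\<beta> n \<cdot>\<^sub>m 1\<^sub>m n)"
        using centre_decomp[OF moment_bounded_carrier[OF W n]] by (simp add: W0_def)
      also have "\<dots> = conj_mat ?V (W0 n) + ?\<beta> n \<cdot>\<^sub>m 1\<^sub>m n"
        using Vc moment_bounded_carrier[OF W0(1) n] conj_mat_one[OF V]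
        by (simp add: conj_mat_add[of _ n] conj_mat_smult[of _ n])
      finally have "A n * conj_mat ?V (W n) = A n * conj_mat ?V (W0 n) + ?\<beta> n \<cdot>\<^sub>m A n"
        using c by (simp add: mult_add_distrib_mat[of _ n n _ n] mult_smult_distrib[of _ n n _ n])
      then have "?L n ?V * (A n * conj_mat ?V (W n) * ?R n ?V)
          = ?L n ?V * (A n * conj_mat ?V (W0 n) * ?R n ?V) + ?\<beta> n \<cdot>\<^sub>m (?L n ?V * (A n * ?R n ?V))"
        using c mult_carrier_mat[OF c(3) c(5)] mult_carrier_mat[OF c(3) c(2)]
          mult_carrier_mat[OF mult_carrier_mat[OF c(3) c(5)] c(2)]
        by (simp add: mult_add_distrib_mat[of _ n n _ n] add_mult_distrib_mat[of _ n n _ _ n]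
            mult_smult_distrib[of _ n n _ n] mult_smult_assoc_mat[of _ n n _ n])
      then show ?thesis
        unfolding alt append_Cons append_Nil app[of W, OF c(4)] app[of W0, OF c(5)]
        using c mult_carrier_mat[OF c(1) mult_carrier_mat[OF c(3) c(2)]]
          mult_carrier_mat[OF c(1) mult_carrier_mat[OF mult_carrier_mat[OF c(3) c(5)] c(2)]]
        by (simp add: mat_trace_add[of _ n] mat_trace_smult[of _ n])
    qed
    have zero: "?P (xs @ [(A, W0)] @ zs) n = 0" if "1 \<le> n" for n
      by (rule vanish[of A W0]) (use W0 that in auto)
    show ?thesis
    \<comment> \<open>The matrix \<open>A\<close> left over by the scalar part is merged with the
      first matrix of \<open>zs\<close>, or, if \<open>zs\<close> is empty, by cyclicity with the
      first matrix of \<open>xs\<close>. If both are empty, the scalar part is exactly the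
      subtracted term.\<close>
    proof (cases zs)
      case Nil
      show ?thesis
      proof (cases xs)
        case (Cons x xs')
        obtain A' W' where x: "x = (A', W')" by (cases x)
        have A': "trace_bounded A'" "moment_bounded W'" "centred W'" using xs Cons x by auto
        let ?xs = "(\<lambda>n. A n * A' n, W') # xs'"
        have D2: "AE \<omega> in M. ?D \<omega> ?xs [] \<longlonglongrightarrow> 0"
        proof (rule less.hyps)
          show "length [] < length ys" using \<open>ys = y # zs\<close> by simp
        qed (use xs A A' Cons x trace_bounded_mult[OF A A'(1)] in auto)
        have "AE \<omega> in M. \<omega> \<in> space M" by simp
        then show ?thesis
          using D1 D2
        proof eventually_elim
          case (elim \<omega>)
          have "(\<lambda>n. ?D \<omega> (xs @ [(A, W0)]) zs n + ?\<beta> n * ?D \<omega> ?xs [] n) \<longlonglongrightarrow> 0 + 0"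
            using \<beta> elim(3) by (intro tendsto_add elim(2) Bfun_mult_tendsto_zero)
          moreover have "\<forall>\<^sub>F n in sequentially. ?D \<omega> (xs @ [(A, W0)]) zs n + ?\<beta> n * ?D \<omega> ?xs [] n = ?D \<omega> xs ys n"
          proof (rule eventually_sequentiallyI[of 1])
            fix n :: nat assume n: "1 \<le> n"
            note Vc = unitary_groupD(1)[OF U_unitary[OF n elim(1)]]
            have "?P (?xs @ []) n = 0"
              by (rule vanish[of "\<lambda>n. A n * A' n" W']) (use A'(3) n in auto)
            then have D2': "?D \<omega> ?xs [] n = ?T \<omega> ?xs n"
              by (simp only: append_Nil2 mult_zero_right diff_zero)
            have "?P (xs @ ys) n = 0"
              by (rule vanish[of A' W']) (use A'(3) n Cons x in auto)
            then have D3: "?D \<omega> xs ys n = ?T \<omega> (xs @ (A, W) # zs) n"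
              using \<open>ys = y # zs\<close> y by (simp only: mult_zero_right diff_zero)
            have D1': "?D \<omega> (xs @ [(A, W0)]) zs n = ?T \<omega> (xs @ [(A, W0)] @ zs) n"
              using zero[OF n] by (simp only: append_assoc mult_zero_right diff_zero)
            have tr: "mat_trace (?L n (U n \<omega>) * (A n * ?R n (U n \<omega>))) = ?T \<omega> ?xs n"
            proof -
              note c = carr[OF n Vc]
              have Q: "mat_prod n (map (?term n (U n \<omega>)) xs') \<in> carrier_mat n n"
                using term_carr[of xs' n "U n \<omega>"] xs Cons n Vc by (intro mat_prod_carrier) auto
              have "mat_trace (?L n (U n \<omega>) * A n) = mat_trace (A n * ?L n (U n \<omega>))"
                using c by (intro mat_trace_comm)
              moreover have "A n * ?L n (U n \<omega>) = mat_prod n (map (?term n (U n \<omega>)) ?xs)"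
                using Q c Vc trace_bounded_carrier[OF A'(1) n] moment_bounded_carrier[OF A'(2) n] Cons x
                by (simp add: assoc_mult_mat[of _ n n _ n _ n] mult_carrier_mat[of _ n n])
              ultimately show ?thesis using c Nil by (simp add: alt)
            qed
            show "?D \<omega> (xs @ [(A, W0)]) zs n + ?\<beta> n * ?D \<omega> ?xs [] n = ?D \<omega> xs ys n"
              unfolding D1' D2' D3 split[OF n elim(1)] tr ..
          qed
          ultimately show ?case by (auto intro: Lim_transform_eventually)
        qed
      next
        case xsNil: Nil
        have "AE \<omega> in M. \<omega> \<in> space M" by simp
        then show ?thesis
          using D1
        proof eventually_elim
          case (elim \<omega>)
          have "\<forall>\<^sub>F n in sequentially. ?D \<omega> (xs @ [(A, W0)]) zs n = ?D \<omega> xs ys n"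
          proof (rule eventually_sequentiallyI[of 1])
            fix n :: nat assume n: "1 \<le> n"
            note c = carr[OF n unitary_groupD(1)[OF U_unitary[OF n elim(1)]]]
            show "?D \<omega> (xs @ [(A, W0)]) zs n = ?D \<omega> xs ys n"
              using split[OF n elim(1)] zero[OF n] \<open>ys = y # zs\<close> y Nil xsNil c by simp
          qed
          then show ?case using elim(2) by (rule Lim_transform_eventually[rotated])
        qed
      qed
    next
      case zsCons: (Cons z zs')
      obtain A' W' where z: "z = (A', W')" by (cases z)
      have A': "trace_bounded A'" "moment_bounded W'" using zs zsCons z by auto
      let ?zs = "(\<lambda>n. A n * A' n, W') # zs'"
      have D2: "AE \<omega> in M. ?D \<omega> xs ?zs \<longlonglongrightarrow> 0"
      proof (rule less.hyps)
        show "length ?zs < length ys" using Cons zsCons by simp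
      qed (use xs zs zsCons z A' trace_bounded_mult[OF A A'(1)] in auto)
      have "AE \<omega> in M. \<omega> \<in> space M" by simp
      then show ?thesis
        using D1 D2
      proof eventually_elim
        case (elim \<omega>)
        have "(\<lambda>n. ?D \<omega> (xs @ [(A, W0)]) zs n + ?\<beta> n * ?D \<omega> xs ?zs n) \<longlonglongrightarrow> 0 + 0"
          using \<beta> elim(3) by (intro tendsto_add elim(2) Bfun_mult_tendsto_zero)
        moreover have "\<forall>\<^sub>F n in sequentially. ?D \<omega> (xs @ [(A, W0)]) zs n + ?\<beta> n * ?D \<omega> xs ?zs n = ?D \<omega> xs ys n"
        proof (rule eventually_sequentiallyI[of 1])
          fix n :: nat assume n: "1 \<le> n"
          note Vc = unitary_groupD(1)[OF U_unitary[OF n elim(1)]]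
          note c = carr[OF n Vc]
          note Ac = trace_bounded_carrier[OF A n] trace_bounded_carrier[OF A'(1) n]
          have Q: "mat_prod n (map (?term n (U n \<omega>)) zs') \<in> carrier_mat n n"
            using term_carr[of zs' n "U n \<omega>"] zs zsCons n Vc by (intro mat_prod_carrier) auto
          have zs1: "trace_bounded B \<and> moment_bounded X" if "(B, X) \<in> set ?zs" for B X
            using that zs[of B X] zsCons A' trace_bounded_mult[OF A A'(1)] by auto
          have xs1: "trace_bounded B \<and> moment_bounded X" if "(B, X) \<in> set xs" for B X
            using xs[OF that] by simp
          note Qx = term_carr[of xs n "U n \<omega>", OF xs1 n Vc] term_carr[of ?zs n "U n \<omega>", OF zs1 n Vc]
          have "A n * ?R n (U n \<omega>) = mat_prod n (map (?term n (U n \<omega>)) ?zs)"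
            using Q c Vc Ac moment_bounded_carrier[OF A'(2) n] zsCons z
            by (simp add: assoc_mult_mat[of _ n n _ n _ n] mult_carrier_mat[of _ n n])
          then have 1: "mat_trace (?L n (U n \<omega>) * (A n * ?R n (U n \<omega>))) = ?T \<omega> (xs @ ?zs) n"
            by (simp only: alt map_append mat_prod_append[OF Qx])
          have carrs: "set (map (\<lambda>(A, W). A n) ps) \<subseteq> carrier_mat n n"
            if "\<And>A W. (A, W) \<in> set ps \<Longrightarrow> trace_bounded A" for ps :: "(mat_seq \<times> mat_seq) list"
            using that n by (force dest: trace_bounded_carrier)
          have Qz: "mat_prod n (map (\<lambda>(A, W). A n) zs') \<in> carrier_mat n n"
            using carrs[of zs'] zs zsCons by (intro mat_prod_carrier) auto
          have 2: "mat_prod n (map (\<lambda>(A, W). A n) (xs @ (A, W) # zs)) = mat_prod n (map (\<lambda>(A, W). A n) (xs @ ?zs))"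
          proof -
            have c1: "set (map (\<lambda>(A, W). A n) xs) \<subseteq> carrier_mat n n"
              by (rule carrs) (use xs1 in blast)
            have c2: "set (map (\<lambda>(A, W). A n) ((A, W) # zs)) \<subseteq> carrier_mat n n"
              by (rule carrs) (use zs A in auto)
            have c3: "set (map (\<lambda>(A, W). A n) ?zs) \<subseteq> carrier_mat n n"
              by (rule carrs) (use zs1 in blast)
            have "mat_prod n (map (\<lambda>(A, W). A n) ((A, W) # zs)) = mat_prod n (map (\<lambda>(A, W). A n) ?zs)"
              using zsCons z by (simp add: assoc_mult_mat[OF Ac Qz])
            then show ?thesis
              by (simp only: map_append mat_prod_append[OF c1 c2] mat_prod_append[OF c1 c3])
          qed
          have 3: "?P (xs @ (A, W) # zs) n = ?\<beta> n * ?P (xs @ ?zs) n"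
            using zsCons z by simp
          have D: "?D \<omega> (xs @ [(A, W0)]) zs n = ?T \<omega> (xs @ [(A, W0)] @ zs) n"
            using zero[OF n] by simp
          show "?D \<omega> (xs @ [(A, W0)]) zs n + ?\<beta> n * ?D \<omega> xs ?zs n = ?D \<omega> xs ys n"
            unfolding D Cons y split[OF n elim(1)] 1 2 3 by (simp add: algebra_simps)
        qed
        ultimately show ?case by (auto intro: Lim_transform_eventually)
      qed
    qed
  qed
qed

end

section \<open>The algebra of non-commutative polynomials\<close>

text \<open>Only monomials occurring in \<open>P\<close> are visited, so a property of
  \<open>P\<close> such as the absence of a constant term is available in the monomial case.\<close>

lemma ncpoly_keys_induct [case_names single zero add]:
  fixes P :: "'v ncpoly"
  assumes single: "\<And>w. w \<in> Poly_Mapping.keys P \<Longrightarrow> Q (Poly_Mapping.single w (Poly_Mapping.lookup P w))"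
    and zero: "Q 0" and add: "\<And>R S. Q R \<Longrightarrow> Q S \<Longrightarrow> Q (R + S)"
  shows "Q P"
proof -
  have "Q (\<Sum>w\<in>T. Poly_Mapping.single w (Poly_Mapping.lookup P w))" if "finite T" "T \<subseteq> Poly_Mapping.keys P" for T
    using that
  proof (induction T rule: finite_induct)
    case (insert w T)
    then show ?case using single[of w] by (simp add: add)
  qed (simp add: zero)
  from this[OF finite_keys subset_refl] show ?thesis
  proof -
    assume q: "Q (\<Sum>w\<in>Poly_Mapping.keys P. Poly_Mapping.single w (Poly_Mapping.lookup P w))"
    have "(\<Sum>w\<in>Poly_Mapping.keys P. Poly_Mapping.single w (Poly_Mapping.lookup P w)) = P"
      by (rule poly_mapping_eqI) (auto simp: lookup_sum lookup_single when_def in_keys_iff)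
    then show ?thesis using q by simp
  qed
qed

lemma ncpoly_induct [case_names single add]:
  fixes P :: "'v ncpoly"
  assumes "\<And>w c. Q (Poly_Mapping.single w c)" "\<And>R S. Q R \<Longrightarrow> Q S \<Longrightarrow> Q (R + S)"
  shows "Q P"
  by (induction P rule: ncpoly_keys_induct) (use assms assms(1)[of "[]" 0] in auto)

lemma sum_keys_single:
  assumes "h w 0 = 0"
  shows "(\<Sum>u\<in>Poly_Mapping.keys (Poly_Mapping.single w c). h u (Poly_Mapping.lookup (Poly_Mapping.single w c) u)) = h w c"
  using assms by (cases "c = 0") simp_all

lemma lookup_ncp_scale [simp]: "Poly_Mapping.lookup (ncp_scale c P) w = c * Poly_Mapping.lookup P w"
  by (simp add: ncp_scale_def Poly_Mapping.map.rep_eq when_def)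

lemma ncp_scale_conv: "ncp_scale c P = Poly_Mapping.single [] c * P"
  unfolding ncp_scale_def zero_list_def[symmetric] by (rule mult_map_scale_conv_mult)

lemma ncp_scale_single [simp]: "ncp_scale c (Poly_Mapping.single w d) = Poly_Mapping.single w (c * d)"
  by (rule poly_mapping_eqI) (simp add: lookup_single when_def)

lemma ncp_scale_add: "ncp_scale c (P + Q) = ncp_scale c P + ncp_scale c Q"
  by (simp add: ncp_scale_conv distrib_left)

lemma ncp_one: "(1 :: 'v ncpoly) = Poly_Mapping.single [] 1"
  unfolding zero_list_def[symmetric] by simp

lemma ncp_single_mult:
  "Poly_Mapping.single u c * Poly_Mapping.single v d = (Poly_Mapping.single (u @ v) (c * d) :: 'v ncpoly)"
  by (simp add: mult_single plus_list_def)

lemma ncp_scale_mult_left: "ncp_scale c P * Q = ncp_scale c (P * Q)"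
  by (simp add: ncp_scale_conv mult.assoc)

lemma ncp_scale_mult_right: "P * ncp_scale c Q = ncp_scale c (P * Q)"
proof -
  have "P * Poly_Mapping.single [] c = Poly_Mapping.single [] c * P"
    by (induction P rule: ncpoly_induct) (simp_all add: ncp_single_mult distrib_left distrib_right mult.commute)
  then show ?thesis by (simp add: ncp_scale_conv mult.assoc[symmetric])
qed

lemma ncp_star_add: "ncp_star (P + Q) = ncp_star P + ncp_star Q"
  unfolding ncp_star_def by (rule Poly_Mapping.setsum_keys_plus_distrib) (simp_all add: single_add)

lemma ncp_star_single [simp]:
  "ncp_star (Poly_Mapping.single w c) = Poly_Mapping.single (rev (map flip_letter w)) (cnj c)"
  unfolding ncp_star_def
  by (rule sum_keys_single[where h = "\<lambda>w c. Poly_Mapping.single (rev (map flip_letter w)) (cnj c)"]) simp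

lemma flip_flip [simp]: "flip_letter (flip_letter l) = l"
  by (cases l) simp_all

lemma unital_star_algebra_ncpoly: "unital_star_algebra (ncp_scale :: complex \<Rightarrow> 'v ncpoly \<Rightarrow> _) ncp_star"
proof
  fix x y :: "'v ncpoly" and z z' :: complex
  show "ncp_scale z (x + y) = ncp_scale z x + ncp_scale z y" by (rule ncp_scale_add)
  show "ncp_scale (z + z') x = ncp_scale z x + ncp_scale z' x"
    by (rule poly_mapping_eqI) (simp add: lookup_add distrib_right)
  show "ncp_scale z (ncp_scale z' x) = ncp_scale (z * z') x"
    by (rule poly_mapping_eqI) simp
  show "ncp_scale 1 x = x" by (rule poly_mapping_eqI) simp
  show "ncp_scale z x * y = ncp_scale z (x * y)" by (rule ncp_scale_mult_left)
  show "x * ncp_scale z y = ncp_scale z (x * y)" by (rule ncp_scale_mult_right)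
  show "ncp_star (x + y) = ncp_star x + ncp_star y" by (rule ncp_star_add)
  show "ncp_star (ncp_scale z x) = ncp_scale (cnj z) (ncp_star x)"
    by (induction x rule: ncpoly_induct) (simp_all add: ncp_scale_add ncp_star_add)
  show "ncp_star (ncp_star x) = x"
    by (induction x rule: ncpoly_induct) (simp_all add: ncp_star_add rev_map o_def)
  have "ncp_star (Poly_Mapping.single w c * y) = ncp_star y * ncp_star (Poly_Mapping.single w c)" for w c
    by (induction y rule: ncpoly_induct)
      (simp_all add: ncp_single_mult ncp_star_add distrib_left distrib_right mult.commute)
  then show "ncp_star (x * y) = ncp_star y * ncp_star x"
    by (induction x rule: ncpoly_induct) (simp_all add: ncp_star_add distrib_left distrib_right)
qed

section \<open>Linear extension from words and renaming of variables\<close>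

definition word_linear :: "('v letter list \<Rightarrow> complex) \<Rightarrow> 'v ncpoly \<Rightarrow> complex" where
  "word_linear f P = (\<Sum>w \<in> Poly_Mapping.keys P. Poly_Mapping.lookup P w * f w)"

lemma word_linear_add: "word_linear f (P + Q) = word_linear f P + word_linear f Q"
  unfolding word_linear_def by (rule Poly_Mapping.setsum_keys_plus_distrib) (simp_all add: distrib_right)

lemma word_linear_single [simp]: "word_linear f (Poly_Mapping.single w c) = c * f w"
  unfolding word_linear_def by (rule sum_keys_single[where h = "\<lambda>w c. c * f w"]) simp

lemma word_linear_scale: "word_linear f (ncp_scale c P) = c * word_linear f P"
  by (induction P rule: ncpoly_induct) (simp_all add: ncp_scale_add word_linear_add distrib_left)

lemma word_val_simps [simp]:
  "word_val prd e st x [] = e"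
  "word_val prd e st x (l # w) = prd (letter_val st x l) (word_val prd e st x w)"
  by (simp_all add: word_val_def)

definition relabel :: "('u \<Rightarrow> 'v) \<Rightarrow> 'u ncpoly \<Rightarrow> 'v ncpoly" where
  "relabel f P = (\<Sum>w \<in> Poly_Mapping.keys P. Poly_Mapping.single (map (map_letter f) w) (Poly_Mapping.lookup P w))"

lemma relabel_add: "relabel f (P + Q) = relabel f P + relabel f Q"
  unfolding relabel_def by (rule Poly_Mapping.setsum_keys_plus_distrib) (simp_all add: single_add)

lemma relabel_single [simp]:
  "relabel f (Poly_Mapping.single w c) = Poly_Mapping.single (map (map_letter f) w) c"
  unfolding relabel_def
  by (rule sum_keys_single[where h = "\<lambda>w c. Poly_Mapping.single (map (map_letter f) w) c"]) simp

text \<open>Evaluation at generators is renaming, so the two algebras in the freeness statement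
  consist of renamed polynomials.\<close>

lemma ncp_eval_relabel: "ncp_eval ncp_scale ncp_star (\<lambda>i. ncp_var (f i)) P = relabel f P"
proof -
  have "letter_val ncp_star (\<lambda>i. ncp_var (f i)) l = Poly_Mapping.single [map_letter f l] 1" for l
    by (cases l) (simp_all add: ncp_var_def)
  then have "word_val (*) 1 ncp_star (\<lambda>i. ncp_var (f i)) w = Poly_Mapping.single (map (map_letter f) w) 1" for w
    by (induction w) (simp_all add: ncp_one ncp_single_mult)
  then show ?thesis by (simp add: ncp_eval_def relabel_def)
qed

section \<open>Evaluation at matrices\<close>

context
  fixes n :: nat and X :: "'v \<Rightarrow> complex mat"
  assumes X: "\<And>v. X v \<in> carrier_mat n n"
begin

lemma letter_val_carrier: "letter_val mat_adjoint X l \<in> carrier_mat n n"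
  using X by (cases l) auto

lemma mat_word_carrier [simp]: "mat_word n X w \<in> carrier_mat n n"
  unfolding mat_word_def by (induction w) (auto intro: mult_carrier_mat letter_val_carrier)

lemma mat_word_dim [simp]: "dim_row (mat_word n X w) = n" "dim_col (mat_word n X w) = n"
  using carrier_matD[OF mat_word_carrier[of w]] by auto

lemma mat_word_append: "mat_word n X (u @ w) = mat_word n X u * mat_word n X w"
proof (induction u)
  case Nil
  show ?case using left_mult_one_mat[OF mat_word_carrier[of w]] by (simp add: mat_word_def)
next
  case (Cons l u)
  then show ?case
    using assoc_mult_mat[OF letter_val_carrier[of l] mat_word_carrier[of u] mat_word_carrier[of w]]
    by (simp add: mat_word_def)
qed

lemma mat_word_single: "mat_word n X [l] = letter_val mat_adjoint X l"
  using right_mult_one_mat[OF letter_val_carrier[of l]] by (simp add: mat_word_def)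

lemma mat_word_Cons: "mat_word n X (l # w) = letter_val mat_adjoint X l * mat_word n X w"
  by (simp add: mat_word_def)

lemma mat_word_adjoint: "mat_adjoint (mat_word n X w) = mat_word n X (rev (map flip_letter w))"
proof (induction w)
  case Nil
  show ?case by (simp add: mat_word_def)
next
  case (Cons l w)
  have "letter_val mat_adjoint X (flip_letter l) = mat_adjoint (letter_val mat_adjoint X l)"
    by (cases l) simp_all
  then show ?case
    using Cons adjoint_mult[OF letter_val_carrier[of l] mat_word_carrier[of w]]
    by (simp only: mat_word_Cons[of l w] list.map rev.simps mat_word_append mat_word_single)
qed

lemma ncp_mat_carrier [simp]: "ncp_mat n X P \<in> carrier_mat n n"
  by (simp add: ncp_mat_def)

lemma ncp_mat_entry:
  "\<lbrakk>i < n; j < n\<rbrakk> \<Longrightarrow> ncp_mat n X P $$ (i, j) = word_linear (\<lambda>w. mat_word n X w $$ (i, j)) P"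
  by (simp add: ncp_mat_def word_linear_def)

lemma ncp_mat_add: "ncp_mat n X (P + Q) = ncp_mat n X P + ncp_mat n X Q"
  by (intro eq_matI) (auto simp: ncp_mat_entry word_linear_add ncp_mat_def[of _ _ "P + Q"]
      ncp_mat_def[of _ _ P] ncp_mat_def[of _ _ Q] simp flip: word_linear_def)

lemma ncp_mat_single: "ncp_mat n X (Poly_Mapping.single w c) = c \<cdot>\<^sub>m mat_word n X w"
  by (intro eq_matI) (auto simp: ncp_mat_def simp flip: word_linear_def)

lemma ncp_mat_zero: "ncp_mat n X 0 = 0\<^sub>m n n"
  by (intro eq_matI) (auto simp: ncp_mat_def)

lemma ncp_mat_one: "ncp_mat n X 1 = 1\<^sub>m n"
  unfolding ncp_one ncp_mat_single by (intro eq_matI) (auto simp: mat_word_def)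

lemma ncp_mat_mult: "ncp_mat n X (P * Q) = ncp_mat n X P * ncp_mat n X Q"
proof (induction P rule: ncpoly_induct)
  case (single w c)
  show ?case
  proof (induction Q rule: ncpoly_induct)
    case (single v d)
    show ?case
      using mat_word_carrier[of v] mat_word_carrier[of w]
      by (simp add: ncp_single_mult ncp_mat_single mat_word_append mult_smult_distrib[of _ n n _ n]
          mult_smult_assoc_mat[of _ n n _ n]) (intro eq_matI, auto)
  next
    case (add R S)
    then show ?case
      by (simp add: distrib_left ncp_mat_add
          mult_add_distrib_mat[OF ncp_mat_carrier ncp_mat_carrier ncp_mat_carrier])
  qed
next
  case (add R S)
  then show ?case
    by (simp add: distrib_right ncp_mat_add
        add_mult_distrib_mat[OF ncp_mat_carrier ncp_mat_carrier ncp_mat_carrier])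
qed

lemma ncp_mat_star: "ncp_mat n X (ncp_star P) = mat_adjoint (ncp_mat n X P)"
proof (induction P rule: ncpoly_induct)
  case (single w c)
  show ?case
    by (intro eq_matI) (auto simp: ncp_mat_single mat_word_adjoint[symmetric])
next
  case (add R S)
  have d: "dim_row (ncp_mat n X Q) = n" "dim_col (ncp_mat n X Q) = n" for Q
    by (simp_all add: ncp_mat_def)
  show ?case
    unfolding ncp_star_add ncp_mat_add add by (intro eq_matI) (auto simp: d)
qed

lemma ncp_mat_trace: "mat_trace (ncp_mat n X P) = word_linear (\<lambda>w. mat_trace (mat_word n X w)) P"
proof (induction P rule: ncpoly_induct)
  case (single w c)
  show ?case by (simp add: ncp_mat_single mat_trace_smult[of _ n])
next
  case (add R S)
  then show ?case by (simp add: ncp_mat_add word_linear_add mat_trace_add[of _ n])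
qed

lemma ncp_mat_ntrace: "mat_ntrace (ncp_mat n X P) = word_linear (\<lambda>w. mat_ntrace (mat_word n X w)) P"
proof -
  have "dim_row (ncp_mat n X P) = n" by (simp add: ncp_mat_def)
  then show ?thesis
    by (simp add: mat_ntrace_def ncp_mat_trace word_linear_def sum_divide_distrib)
qed

end

section \<open>Evaluation under renaming and under conjugation\<close>

lemma mat_word_relabel: "mat_word n X (map (map_letter f) w) = mat_word n (\<lambda>i. X (f i)) w"
proof (induction w)
  case (Cons l w)
  have "letter_val mat_adjoint X (map_letter f l) = letter_val mat_adjoint (\<lambda>i. X (f i)) l"
    by (cases l) simp_all
  then show ?case using Cons by (simp add: mat_word_def)
qed (simp add: mat_word_def)

lemma ncp_mat_relabel:
  assumes "\<And>v. X v \<in> carrier_mat n n"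
  shows "ncp_mat n X (relabel f P) = ncp_mat n (\<lambda>i. X (f i)) P"
  by (induction P rule: ncpoly_induct)
    (simp_all add: ncp_mat_single[OF assms] relabel_add ncp_mat_add[OF assms] ncp_mat_add[OF assms, of f]
      ncp_mat_single[of "\<lambda>i. X (f i)", OF assms] ncp_mat_add[of "\<lambda>i. X (f i)", OF assms] mat_word_relabel)

lemma mat_word_conj:
  assumes V: "V \<in> unitary_group n" and B: "\<And>j. B j \<in> carrier_mat n n"
  shows "mat_word n (\<lambda>j. conj_mat V (B j)) w = conj_mat V (mat_word n B w)"
proof (induction w)
  case Nil
  show ?case using conj_mat_one[OF V] by (simp add: mat_word_def)
next
  case (Cons l w)
  have "letter_val mat_adjoint (\<lambda>j. conj_mat V (B j)) l = conj_mat V (letter_val mat_adjoint B l)"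
    using conj_mat_adjoint[OF unitary_groupD(1)[OF V] B] by (cases l) simp_all
  then show ?case
    using Cons conj_mat_mult[OF V letter_val_carrier[of B, OF B] mat_word_carrier[of B, OF B]]
    by (simp add: mat_word_def)
qed

lemma ncp_mat_conj:
  assumes V: "V \<in> unitary_group n" and B: "\<And>j. B j \<in> carrier_mat n n"
  shows "ncp_mat n (\<lambda>j. conj_mat V (B j)) P = conj_mat V (ncp_mat n B P)"
proof -
  note Vc = unitary_groupD(1)[OF V]
  have C: "conj_mat V (B j) \<in> carrier_mat n n" for j using Vc B by (rule conj_mat_carrier)
  show ?thesis
  proof (induction P rule: ncpoly_induct)
    case (single w c)
    show ?case
      using Vc mat_word_carrier[of B, OF B]
      by (simp add: ncp_mat_single[of "\<lambda>j. conj_mat V (B j)", OF C] ncp_mat_single[of B, OF B]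
          mat_word_conj[OF V B] conj_mat_smult[of _ n])
  next
    case (add R S)
    then show ?case
      using Vc ncp_mat_carrier[of B, OF B]
      by (simp add: ncp_mat_add[of "\<lambda>j. conj_mat V (B j)", OF C] ncp_mat_add[of B, OF B] conj_mat_add[of _ n])
  qed
qed

text \<open>A word in the letters of both families is written as
  \<open>u\<^sub>0 x\<^sub>1 u\<^sub>1 \<dots> x\<^sub>m u\<^sub>m\<close> with words \<open>u\<^sub>i\<close> in the second family.\<close>

fun parse :: "('k + 'l) letter list \<Rightarrow> 'l letter list \<times> ('k letter \<times> 'l letter list) list" where
  "parse [] = ([], [])"
| "parse (Var (Inl i) # w) = ([], (Var i, fst (parse w)) # snd (parse w))"
| "parse (Adj (Inl i) # w) = ([], (Adj i, fst (parse w)) # snd (parse w))"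
| "parse (Var (Inr j) # w) = (Var j # fst (parse w), snd (parse w))"
| "parse (Adj (Inr j) # w) = (Adj j # fst (parse w), snd (parse w))"

lemma parse_append_empty: "snd (parse (u @ w)) = [] \<longleftrightarrow> snd (parse u) = [] \<and> snd (parse w) = []"
  by (induction u rule: parse.induct) simp_all

lemma parse_Inr: "parse (map (map_letter Inr) w) = (w, [])"
proof (induction w)
  case (Cons l w)
  then show ?case by (cases l) simp_all
qed simp

lemma parse_Inl: "w \<noteq> [] \<Longrightarrow> snd (parse (map (map_letter Inl) w)) \<noteq> []"
proof (induction w)
  case (Cons l w)
  then show ?case by (cases l) simp_all
qed simp

text \<open>Conjugation by a unitary is multiplicative and respects adjoints, so consecutive letters
  of the second family collapse to one conjugated block. Empty blocks are harmless because the
  identity is conjugated to itself.\<close>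

lemma mat_word_parse:
  fixes w :: "('k + 'l) letter list"
  assumes V: "V \<in> unitary_group n" and A: "\<And>i. A i \<in> carrier_mat n n" and B: "\<And>j. B j \<in> carrier_mat n n"
  shows "mat_word n (conj_family A B V) w = conj_mat V (mat_word n B (fst (parse w)))
    * mat_prod n (map (\<lambda>(l, u). mat_word n A [l] * conj_mat V (mat_word n B u)) (snd (parse w)))"
proof -
  note Vc = unitary_groupD(1)[OF V]
  note Bw = mat_word_carrier[of B, OF B] and Aw = mat_word_carrier[of A, OF A]
  let ?f = "\<lambda>(l, u). mat_word n A [l] * conj_mat V (mat_word n B u)"
  have P: "mat_prod n (map ?f ps) \<in> carrier_mat n n" for ps
    by (rule mat_prod_carrier) (auto intro!: mult_carrier_mat[OF Aw conj_mat_carrier[OF Vc Bw]])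
  have C: "conj_mat V (mat_word n B u) \<in> carrier_mat n n" for u by (rule conj_mat_carrier[OF Vc Bw])
  have x: "Y * (conj_mat V (mat_word n B u) * mat_prod n (map ?f ps))
      = conj_mat V (mat_word n B []) * mat_prod n (map ?f ((l, u) # ps))"
    if "Y = mat_word n A [l]" for l u ps Y
  proof -
    have "mat_word n A [l] * (conj_mat V (mat_word n B u) * mat_prod n (map ?f ps)) = mat_prod n (map ?f ((l, u) # ps))"
      using assoc_mult_mat[OF Aw C P] by simp
    moreover have "conj_mat V (mat_word n B []) = 1\<^sub>m n" using conj_mat_one[OF V] by (simp add: mat_word_def)
    ultimately show ?thesis using that by (simp only: left_mult_one_mat[OF P])
  qed
  have y: "conj_mat V (mat_word n B [l]) * (conj_mat V (mat_word n B u) * mat_prod n (map ?f ps))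
      = conj_mat V (mat_word n B (l # u)) * mat_prod n (map ?f ps)" for l u ps
  proof -
    have "conj_mat V (mat_word n B [l]) * conj_mat V (mat_word n B u) = conj_mat V (mat_word n B ([l] @ u))"
      unfolding mat_word_append[of B, OF B] by (rule conj_mat_mult[OF V Bw Bw])
    then show ?thesis using assoc_mult_mat[OF C C P] by (metis append_Cons append_Nil)
  qed
  show ?thesis
  proof (induction w rule: parse.induct)
    case 1
    then show ?case using conj_mat_one[OF V] by (simp add: mat_word_def)
  next
    case (2 i w)
    then show ?case
      using x[of "A i" "Var i" "fst (parse w)" "snd (parse w)"] mat_word_single[of A n "Var i", OF A]
      by (simp add: mat_word_def conj_family_def)
  next
    case (3 i w)
    then show ?case
      using x[of "mat_adjoint (A i)" "Adj i" "fst (parse w)" "snd (parse w)"] mat_word_single[of A n "Adj i", OF A]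
      by (simp add: mat_word_def conj_family_def)
  next
    case (4 j w)
    then show ?case
      using y[of "Var j" "fst (parse w)" "snd (parse w)"] mat_word_single[of B n "Var j", OF B]
      by (simp add: mat_word_def conj_family_def)
  next
    case (5 j w)
    then show ?case
      using y[of "Adj j" "fst (parse w)" "snd (parse w)"] mat_word_single[of B n "Adj j", OF B]
        conj_mat_adjoint[OF Vc B]
      by (simp add: mat_word_def conj_family_def)
  qed
qed

section \<open>Asymptotic infinitesimal freeness\<close>

lemma trace_bounded_zero: "trace_bounded (\<lambda>n. 0\<^sub>m n n)"
proof -
  have "frob (0\<^sub>m n n) = 0" for n using frob_sq[of "0\<^sub>m n n" n] by simp
  then show ?thesis
    unfolding trace_bounded_def by (intro exI[of _ 0]) (auto simp: mat_trace_def)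
qed

lemma trace_bounded_add:
  assumes "trace_bounded A" "trace_bounded B"
  shows "trace_bounded (\<lambda>n. A n + B n)"
proof -
  from assms obtain c d
    where c: "\<And>n. 1 \<le> n \<Longrightarrow> A n \<in> carrier_mat n n \<and> frob (A n) \<le> c \<and> cmod (mat_trace (A n)) \<le> c"
      and d: "\<And>n. 1 \<le> n \<Longrightarrow> B n \<in> carrier_mat n n \<and> frob (B n) \<le> d \<and> cmod (mat_trace (B n)) \<le> d"
    unfolding trace_bounded_def by meson
  show ?thesis
    unfolding trace_bounded_def
  proof (intro exI[of _ "c + d"] allI impI conjI)
    fix n :: nat assume n: "1 \<le> n"
    note cn = c[OF n] and dn = d[OF n]
    show "A n + B n \<in> carrier_mat n n" using cn dn by auto
    show "frob (A n + B n) \<le> c + d" using cn dn frob_add[of "A n" n "B n"] by linarith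
    show "cmod (mat_trace (A n + B n)) \<le> c + d"
      using cn dn mat_trace_add[of "A n" n "B n"] norm_triangle_ineq[of "mat_trace (A n)" "mat_trace (B n)"]
      by auto
  qed
qed

lemma trace_bounded_smult:
  assumes "trace_bounded A"
  shows "trace_bounded (\<lambda>n. z \<cdot>\<^sub>m A n)"
proof -
  from assms obtain c
    where c: "\<And>n. 1 \<le> n \<Longrightarrow> A n \<in> carrier_mat n n \<and> frob (A n) \<le> c \<and> cmod (mat_trace (A n)) \<le> c"
    unfolding trace_bounded_def by meson
  show ?thesis
    unfolding trace_bounded_def
  proof (intro exI[of _ "cmod z * c"] allI impI conjI)
    fix n :: nat assume n: "1 \<le> n"
    note cn = c[OF n]
    show "z \<cdot>\<^sub>m A n \<in> carrier_mat n n" using cn by auto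
    show "frob (z \<cdot>\<^sub>m A n) \<le> cmod z * c" using cn frob_smult[of "A n" n z] by (simp add: mult_left_mono)
    show "cmod (mat_trace (z \<cdot>\<^sub>m A n)) \<le> cmod z * c"
      using cn mat_trace_smult[of "A n" n z] by (simp add: norm_mult mult_left_mono)
  qed
qed

lemma moment_bounded_smult:
  assumes "moment_bounded W"
  shows "moment_bounded (\<lambda>n. z \<cdot>\<^sub>m W n)"
proof -
  from assms obtain c where c: "\<And>n. 1 \<le> n \<Longrightarrow> op_bounded n (c * real n powr (1/8)) (W n)"
    "\<And>n. 1 \<le> n \<Longrightarrow> cmod (mat_ntrace (W n)) \<le> c"
    unfolding moment_bounded_def by auto
  show ?thesis
    unfolding moment_bounded_def
  proof (intro exI[of _ "cmod z * c"] allI impI conjI)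
    fix n :: nat assume n: "1 \<le> n"
    show "op_bounded n (cmod z * c * real n powr (1/8)) (z \<cdot>\<^sub>m W n)"
      using op_bounded_smult[OF c(1)[OF n], of z] by (simp add: mult.assoc)
    have "mat_ntrace (z \<cdot>\<^sub>m W n) = z * mat_ntrace (W n)"
      using mat_trace_smult[OF op_bounded_carrier[OF c(1)[OF n]], of z] by (simp add: mat_ntrace_def)
    then show "cmod (mat_ntrace (z \<cdot>\<^sub>m W n)) \<le> cmod z * c"
      using c(2)[OF n] by (simp add: norm_mult mult_left_mono)
  qed
qed

lemma moment_bounded_add:
  assumes "moment_bounded V" "moment_bounded W"
  shows "moment_bounded (\<lambda>n. V n + W n)"
proof -
  from assms obtain c d where c: "\<And>n. 1 \<le> n \<Longrightarrow> op_bounded n (c * real n powr (1/8)) (V n)"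
    "\<And>n. 1 \<le> n \<Longrightarrow> cmod (mat_ntrace (V n)) \<le> c"
    and d: "\<And>n. 1 \<le> n \<Longrightarrow> op_bounded n (d * real n powr (1/8)) (W n)"
    "\<And>n. 1 \<le> n \<Longrightarrow> cmod (mat_ntrace (W n)) \<le> d"
    unfolding moment_bounded_def by meson
  show ?thesis
    unfolding moment_bounded_def
  proof (intro exI[of _ "c + d"] allI impI conjI)
    fix n :: nat assume n: "1 \<le> n"
    show "op_bounded n ((c + d) * real n powr (1/8)) (V n + W n)"
      using op_bounded_add[OF c(1)[OF n] d(1)[OF n]] by (simp add: distrib_right)
    note carr = op_bounded_carrier[OF c(1)[OF n]] op_bounded_carrier[OF d(1)[OF n]]
    have "mat_ntrace (V n + W n) = mat_ntrace (V n) + mat_ntrace (W n)"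
      using mat_trace_add[OF carr] carr by (simp add: mat_ntrace_def add_divide_distrib)
    then show "cmod (mat_ntrace (V n + W n)) \<le> c + d"
      using c(2)[OF n] d(2)[OF n] norm_triangle_ineq[of "mat_ntrace (V n)" "mat_ntrace (W n)"] by simp
  qed
qed

lemma trace_bounded_mat_prod:
  assumes "As \<noteq> []" "\<And>A. A \<in> set As \<Longrightarrow> trace_bounded A"
  shows "trace_bounded (\<lambda>n. mat_prod n (map (\<lambda>A. A n) As))"
  using assms
proof (induction As rule: list_nonempty_induct)
  case (single A)
  then obtain c where "\<And>n. 1 \<le> n \<Longrightarrow> A n \<in> carrier_mat n n \<and> frob (A n) \<le> c \<and> cmod (mat_trace (A n)) \<le> c"
    unfolding trace_bounded_def by auto
  then show ?case unfolding trace_bounded_def by (intro exI[of _ c]) (auto simp: right_mult_one_mat[of _ n n for n])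
next
  case (cons A As)
  then show ?case using trace_bounded_mult[of A "\<lambda>n. mat_prod n (map (\<lambda>A. A n) As)"] by simp
qed

text \<open>Both limiting objects are represented by the scalar values of their words. The empty
  word is excluded for \<open>\<alpha>\<close> because its unnormalized trace is
  \<open>n\<close>.\<close>

locale matrix_model = haar_sequence M U for M :: "'w measure" and U +
  fixes A :: "nat \<Rightarrow> 'k \<Rightarrow> complex mat" and B :: "nat \<Rightarrow> 'l \<Rightarrow> complex mat"
    and \<alpha> :: "'k letter list \<Rightarrow> complex" and \<beta> \<beta>' :: "'l letter list \<Rightarrow> complex"
  assumes A: "1 \<le> n \<Longrightarrow> A n i \<in> carrier_mat n n"
    and B: "1 \<le> n \<Longrightarrow> B n j \<in> carrier_mat n n"
    and A_lim: "w \<noteq> [] \<Longrightarrow> (\<lambda>n. mat_trace (mat_word n (A n) w)) \<longlonglongrightarrow> \<alpha> w"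
    and B_lim: "(\<lambda>n. mat_ntrace (mat_word n (B n) u)) \<longlonglongrightarrow> \<beta> u"
    and B_lim': "(\<lambda>n. of_nat n * (mat_ntrace (mat_word n (B n) u) - \<beta> u)) \<longlonglongrightarrow> \<beta>' u"
begin

lemma A_word: "1 \<le> n \<Longrightarrow> mat_word n (A n) w \<in> carrier_mat n n"
  by (rule mat_word_carrier) (rule A)

lemma B_word: "1 \<le> n \<Longrightarrow> mat_word n (B n) w \<in> carrier_mat n n"
  by (rule mat_word_carrier) (rule B)

text \<open>The squared Frobenius norm of a word is the trace of the word preceded by its adjoint,
  again a nonempty word with convergent, hence bounded, trace.\<close>

lemma trace_bounded_word:
  assumes "w \<noteq> []"
  shows "trace_bounded (\<lambda>n. mat_word n (A n) w)"
proof -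
  let ?v = "rev (map flip_letter w) @ w"
  obtain K where K: "0 < K" "\<And>n. cmod (mat_trace (mat_word n (A n) w)) \<le> K"
    using convergent_imp_Bseq[OF convergentI[OF A_lim[OF assms]]] by (auto simp: Bseq_def)
  have "?v \<noteq> []" using assms by simp
  then obtain L where L: "0 < L" "\<And>n. cmod (mat_trace (mat_word n (A n) ?v)) \<le> L"
    using convergent_imp_Bseq[OF convergentI[OF A_lim]] by (auto simp: Bseq_def)
  show ?thesis
    unfolding trace_bounded_def
  proof (intro exI[of _ "max K (sqrt L)"] allI impI conjI)
    fix n :: nat assume n: "1 \<le> n"
    show "mat_word n (A n) w \<in> carrier_mat n n" by (rule A_word[OF n])
    show "cmod (mat_trace (mat_word n (A n) w)) \<le> max K (sqrt L)" using K(2)[of n] by simp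
    have "mat_word n (A n) ?v = mat_adjoint (mat_word n (A n) w) * mat_word n (A n) w"
      using mat_word_append[of "A n" n, OF A[OF n]] mat_word_adjoint[of "A n" n, OF A[OF n]] by simp
    then have "complex_of_real ((frob (mat_word n (A n) w))\<^sup>2) = mat_trace (mat_word n (A n) ?v)"
      using mat_trace_adjoint_mult[OF A_word[OF n, of w]] by simp
    then have "(frob (mat_word n (A n) w))\<^sup>2 = cmod (mat_trace (mat_word n (A n) ?v))"
      by (metis norm_of_real abs_of_nonneg zero_le_power2)
    then have "frob (mat_word n (A n) w) \<le> sqrt L"
      using L(2)[of n] by (simp add: real_le_rsqrt)
    then show "frob (mat_word n (A n) w) \<le> max K (sqrt L)" by simp
  qed
qed

text \<open>With \<open>W\<close> the matrix of \<open>u\<close>, the word \<open>?v\<close>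
  evaluates to the fourth power of \<open>mat_adjoint W * W\<close>, whose trace is at most
  \<open>n * L\<close> in modulus. So the square of \<open>mat_adjoint W * W\<close> has Frobenius
  norm of order \<open>sqrt n\<close>, and \<open>op_bounded_of_moment\<close> takes the fourth
  root.\<close>

lemma moment_bounded_word: "moment_bounded (\<lambda>n. mat_word n (B n) u)"
proof -
  let ?r = "\<lambda>w. rev (map flip_letter w)"
  let ?h = "?r u @ u"
  let ?v = "?r (?h @ ?h) @ (?h @ ?h)"
  obtain K where K: "0 < K" "\<And>n. cmod (mat_ntrace (mat_word n (B n) u)) \<le> K"
    using convergent_imp_Bseq[OF convergentI[OF B_lim]] by (auto simp: Bseq_def)
  obtain L where L: "0 < L" "\<And>n. cmod (mat_ntrace (mat_word n (B n) ?v)) \<le> L"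
    using convergent_imp_Bseq[OF convergentI[OF B_lim]] by (auto simp: Bseq_def)
  \<comment> \<open>The lower bound \<open>1\<close> ensures \<open>c \<le> c ^ 4\<close>, so that
    \<open>sqrt L\<close> is also below \<open>c ^ 4\<close>.\<close>
  define c where "c = max K (max 1 (sqrt L))"
  have c: "1 \<le> c" "K \<le> c" "sqrt L \<le> c" by (auto simp: c_def)
  have c4: "c \<le> c ^ 4" using c(1) self_le_power[of c 4] by simp
  show ?thesis
    unfolding moment_bounded_def
  proof (intro exI[of _ c] allI impI conjI)
    fix n :: nat assume n: "1 \<le> n"
    note app = mat_word_append[of "B n" n, OF B[OF n]] and adj = mat_word_adjoint[of "B n" n, OF B[OF n]]
    let ?X = "mat_word n (B n) (?h @ ?h)"
    have X: "?X \<in> carrier_mat n n" by (rule B_word[OF n])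
    show "cmod (mat_ntrace (mat_word n (B n) u)) \<le> c" using K(2)[of n] c by simp
    show "op_bounded n (c * real n powr (1/8)) (mat_word n (B n) u)"
    proof (rule op_bounded_of_moment[OF B_word[OF n]])
      show "0 \<le> c * real n powr (1/8)" using c by simp
      have "complex_of_real ((frob ?X)\<^sup>2) = mat_trace (mat_word n (B n) ?v)"
        using mat_trace_adjoint_mult[OF X] unfolding adj app[symmetric] by simp
      also have "\<dots> = of_nat n * mat_ntrace (mat_word n (B n) ?v)"
        using n carrier_matD[OF B_word[OF n, of ?v]] by (simp add: mat_ntrace_def)
      finally have e: "complex_of_real ((frob ?X)\<^sup>2) = of_nat n * mat_ntrace (mat_word n (B n) ?v)" .
      have "(frob ?X)\<^sup>2 = cmod (complex_of_real ((frob ?X)\<^sup>2))"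
        by (simp only: norm_of_real abs_of_nonneg[OF zero_le_power2])
      also have "\<dots> = n * cmod (mat_ntrace (mat_word n (B n) ?v))"
        unfolding e norm_mult norm_of_nat ..
      also have "\<dots> \<le> n * L" using L(2)[of n] by (intro mult_left_mono) auto
      finally have "frob ?X \<le> sqrt (n * L)" by (rule real_le_rsqrt)
      also have "\<dots> = sqrt L * sqrt n" by (simp add: real_sqrt_mult mult.commute)
      also have "\<dots> \<le> c ^ 4 * sqrt n" using c c4 by (intro mult_right_mono) auto
      also have "\<dots> = (c * real n powr (1/8)) ^ 4"
        using n by (simp add: power_mult_distrib powr_power powr_half_sqrt)
      finally show "frob (mat_adjoint (mat_word n (B n) u) * mat_word n (B n) u *
          (mat_adjoint (mat_word n (B n) u) * mat_word n (B n) u)) \<le> (c * real n powr (1/8)) ^ 4"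
        unfolding adj app .
    qed
  qed
qed

lemma trace_bounded_cong:
  "\<lbrakk>trace_bounded F; \<And>n. 1 \<le> n \<Longrightarrow> F n = G n\<rbrakk> \<Longrightarrow> trace_bounded G"
  unfolding trace_bounded_def by simp

lemma moment_bounded_cong:
  "\<lbrakk>moment_bounded F; \<And>n. 1 \<le> n \<Longrightarrow> F n = G n\<rbrakk> \<Longrightarrow> moment_bounded G"
  unfolding moment_bounded_def by simp

text \<open>A constant term is excluded because the identity has the unbounded Frobenius norm
  \<open>sqrt n\<close>.\<close>

lemma trace_bounded_ncp_mat:
  assumes "Poly_Mapping.lookup P [] = 0"
  shows "trace_bounded (\<lambda>n. ncp_mat n (A n) P)"
proof (induction P rule: ncpoly_keys_induct)
  case (single w)
  then have "w \<noteq> []" using assms by (auto simp: in_keys_iff)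
  then have "trace_bounded (\<lambda>n. Poly_Mapping.lookup P w \<cdot>\<^sub>m mat_word n (A n) w)"
    by (intro trace_bounded_smult trace_bounded_word)
  then show ?case
    by (rule trace_bounded_cong) (simp add: ncp_mat_single[of "A n" n for n, OF A])
next
  case zero
  then show ?case
    by (rule trace_bounded_cong[OF trace_bounded_zero]) (simp add: ncp_mat_zero[of "A n" n for n, OF A])
next
  case (add R S)
  show ?case
    by (rule trace_bounded_cong[OF trace_bounded_add[OF add]])
      (simp add: ncp_mat_add[of "A n" n for n, OF A])
qed

lemma moment_bounded_ncp_mat: "moment_bounded (\<lambda>n. ncp_mat n (B n) Q)"
proof (induction Q rule: ncpoly_induct)
  case (single w c)
  show ?case
    by (rule moment_bounded_cong[OF moment_bounded_smult[OF moment_bounded_word]])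
      (simp add: ncp_mat_single[of "B n" n for n, OF B])
next
  case (add R S)
  show ?case
    by (rule moment_bounded_cong[OF moment_bounded_add[OF add]])
      (simp add: ncp_mat_add[of "B n" n for n, OF B])
qed

section \<open>Limits of words and polynomials in the matrix model\<close>

definition model :: "nat \<Rightarrow> 'w \<Rightarrow> 'k + 'l \<Rightarrow> complex mat" where
  "model n \<omega> = conj_family (A n) (B n) (U n \<omega>)"

lemma model_carrier: "\<lbrakk>1 \<le> n; \<omega> \<in> space M\<rbrakk> \<Longrightarrow> model n \<omega> v \<in> carrier_mat n n"
  using A B unitary_groupD(1)[OF U_unitary] by (cases v) (auto simp: model_def conj_family_def)

lemma model_word_pure:
  assumes "snd (parse w) = []" "1 \<le> n" "\<omega> \<in> space M"
  shows "mat_ntrace (mat_word n (model n \<omega>) w) = mat_ntrace (mat_word n (B n) (fst (parse w)))"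
proof -
  note V = U_unitary[OF assms(2,3)]
  note C = conj_mat_carrier[OF unitary_groupD(1)[OF V] B_word[OF assms(2), of "fst (parse w)"]]
  have "mat_word n (model n \<omega>) w = conj_mat (U n \<omega>) (mat_word n (B n) (fst (parse w)))"
    unfolding model_def mat_word_parse[OF V A[OF assms(2)] B[OF assms(2)]]
    using assms(1) right_mult_one_mat[OF C] by simp
  then show ?thesis
    using conj_mat_trace[OF V B_word[OF assms(2)]] C carrier_matD[OF C] carrier_matD[OF B_word[OF assms(2), of "fst (parse w)"]]
    by (simp add: mat_ntrace_def del: index_mult_mat)
qed

text \<open>By cyclicity and the factorization, the unnormalized trace of a word with at least one
  \<open>x\<close> converges to \<open>\<alpha>\<close> of its \<open>x\<close>-letters times the
  product of \<open>\<beta>\<close> over its \<open>y\<close>-blocks. Its normalized trace is thus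
  of order \<open>1 / n\<close>.\<close>

lemma model_word_mixed:
  assumes "snd (parse w) \<noteq> []"
  shows "\<exists>z. AE \<omega> in M. (\<lambda>n. mat_trace (mat_word n (model n \<omega>) w)) \<longlonglongrightarrow> z"
proof -
  obtain u0 where u0: "fst (parse w) = u0" by simp
  obtain qs l u where ps: "snd (parse w) = qs @ [(l, u)]"
    using assms by (metis rev_exhaust surj_pair)
  \<comment> \<open>The leading block \<open>u0\<close> is carried around the trace and joined to
    the last block, which gives the word a strictly alternating form.\<close>
  let ?rs = "qs @ [(l, u @ u0)]"
  let ?seq = "\<lambda>(l, u). ((\<lambda>n. mat_word n (A n) [l]), (\<lambda>n. mat_word n (B n) u))"
  let ?ls = "map fst ?rs"
  let ?z = "\<alpha> ?ls * (\<Prod>(l, u)\<leftarrow>?rs. \<beta> u)"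
  have lim: "(\<lambda>n. mat_trace (mat_prod n (map (\<lambda>(A, W). A n) (map ?seq ?rs)))
      * (\<Prod>(A, W)\<leftarrow>map ?seq ?rs. mat_ntrace (W n))) \<longlonglongrightarrow> ?z"
  proof (rule tendsto_mult)
    have eq: "mat_prod n (map (\<lambda>(A, W). A n) (map ?seq ps)) = mat_word n (A n) (map fst ps)" if "1 \<le> n" for n ps
    proof (induction ps)
      case (Cons p ps)
      then show ?case
        using mat_word_single[of "A n" n "fst p", OF A[OF that]]
        by (simp add: case_prod_unfold mat_word_Cons[of _ n, OF A[OF that]])
    qed (simp add: mat_word_def)
    have "\<forall>\<^sub>F n in sequentially. mat_trace (mat_word n (A n) ?ls)
        = mat_trace (mat_prod n (map (\<lambda>(A, W). A n) (map ?seq ?rs)))"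
      by (intro eventually_sequentiallyI[of 1]) (simp only: eq)
    then show "(\<lambda>n. mat_trace (mat_prod n (map (\<lambda>(A, W). A n) (map ?seq ?rs)))) \<longlonglongrightarrow> \<alpha> ?ls"
      using A_lim[of ?ls] by (auto intro: Lim_transform_eventually)
    have "(\<lambda>n. \<Prod>(A, W)\<leftarrow>map ?seq ps. mat_ntrace (W n)) \<longlonglongrightarrow> (\<Prod>(l, u)\<leftarrow>ps. \<beta> u)" for ps
      by (induction ps) (auto simp: case_prod_unfold intro!: tendsto_mult B_lim)
    then show "(\<lambda>n. \<Prod>(A, W)\<leftarrow>map ?seq ?rs. mat_ntrace (W n)) \<longlonglongrightarrow> (\<Prod>(l, u)\<leftarrow>?rs. \<beta> u)" .
  qed
  have "AE \<omega> in M. (\<lambda>n. mat_trace (alternating n (U n \<omega>) (at_stage n ([] @ map ?seq ?rs)))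
      - mat_trace (mat_prod n (map (\<lambda>(A, W). A n) ([] @ map ?seq ?rs)))
        * (\<Prod>(A, W)\<leftarrow>[] @ map ?seq ?rs. mat_ntrace (W n))) \<longlonglongrightarrow> 0"
    by (rule AE_alternating_factorization) (auto intro: trace_bounded_word moment_bounded_word)
  moreover have "AE \<omega> in M. \<omega> \<in> space M" by simp
  ultimately have "AE \<omega> in M. (\<lambda>n. mat_trace (mat_word n (model n \<omega>) w)) \<longlonglongrightarrow> ?z"
  proof eventually_elim
    case (elim \<omega>)
    have "(\<lambda>n. mat_trace (alternating n (U n \<omega>) (at_stage n (map ?seq ?rs)))) \<longlonglongrightarrow> 0 + ?z"
      using tendsto_add[OF elim(1) lim] by simp
    moreover have "\<forall>\<^sub>F n in sequentially. mat_trace (alternating n (U n \<omega>) (at_stage n (map ?seq ?rs)))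
        = mat_trace (mat_word n (model n \<omega>) w)"
    proof (rule eventually_sequentiallyI[of 1])
      fix n :: nat assume n: "1 \<le> n"
      note V = U_unitary[OF n elim(2)]
      let ?V = "U n \<omega>"
      note C = conj_mat_carrier[OF unitary_groupD(1)[OF V] B_word[OF n]]
      let ?f = "\<lambda>(l, u). mat_word n (A n) [l] * conj_mat ?V (mat_word n (B n) u)"
      have f: "?f p \<in> carrier_mat n n" for p
        by (cases p) (auto intro!: mult_carrier_mat[OF A_word[OF n] C])
      have f_sub: "set (map ?f ps) \<subseteq> carrier_mat n n" for ps using f by (simp add: image_subset_iff)
      let ?Q = "mat_prod n (map ?f qs)"
      have Q: "?Q \<in> carrier_mat n n" by (rule mat_prod_carrier[OF f_sub])
      have last: "mat_prod n (map ?f (qs @ [p])) = ?Q * ?f p" for p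
        using mat_prod_append[OF f_sub f_sub, of qs "[p]"] right_mult_one_mat[OF f[of p]]
        by (simp only: map_append list.map mat_prod_simps)
      have "mat_trace (mat_word n (model n \<omega>) w)
          = mat_trace (conj_mat ?V (mat_word n (B n) u0) * (?Q * ?f (l, u)))"
        unfolding model_def mat_word_parse[OF V A[OF n] B[OF n]] u0 ps last ..
      also have "\<dots> = mat_trace (?Q * ?f (l, u) * conj_mat ?V (mat_word n (B n) u0))"
        using C mult_carrier_mat[OF Q f] by (rule mat_trace_comm)
      also have "?Q * ?f (l, u) * conj_mat ?V (mat_word n (B n) u0)
          = ?Q * (?f (l, u) * conj_mat ?V (mat_word n (B n) u0))"
        by (rule assoc_mult_mat[OF Q f C])
      also have "?f (l, u) * conj_mat ?V (mat_word n (B n) u0) = ?f (l, u @ u0)"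
        using assoc_mult_mat[OF A_word[OF n] C C] conj_mat_mult[OF V B_word[OF n] B_word[OF n]]
          mat_word_append[of "B n" n, OF B[OF n]] by simp
      also have "?Q * ?f (l, u @ u0) = alternating n ?V (at_stage n (map ?seq ?rs))"
        unfolding last[symmetric] alternating_def at_stage_def by (simp add: case_prod_unfold o_def)
      finally show "mat_trace (alternating n (U n \<omega>) (at_stage n (map ?seq ?rs)))
        = mat_trace (mat_word n (model n \<omega>) w)" by simp
    qed
    ultimately show ?case by (auto intro: Lim_transform_eventually)
  qed
  then show ?thesis by blast
qed

text \<open>For words containing an \<open>x\<close> the choice is well-defined: two almost sure
  limits must agree at a common sample point.\<close>

definition mixed_limit :: "('k + 'l) letter list \<Rightarrow> complex" where
  "mixed_limit w = (SOME z. AE \<omega> in M. (\<lambda>n. mat_trace (mat_word n (model n \<omega>) w)) \<longlonglongrightarrow> z)"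

text \<open>The value \<open>0\<close> on words with an \<open>x\<close> reflects that already their
  unnormalized traces converge.\<close>

definition limit_trace :: "('k + 'l) ncpoly \<Rightarrow> complex" where
  "limit_trace = word_linear (\<lambda>w. if snd (parse w) = [] then \<beta> (fst (parse w)) else 0)"

text \<open>For words in the \<open>y\<close> alone the correction is that of the deterministic
  \<open>B j\<close>, since conjugation does not change traces. For other words \<open>n\<close>
  times the normalized trace is the unnormalized trace.\<close>

definition limit_trace' :: "('k + 'l) ncpoly \<Rightarrow> complex" where
  "limit_trace' = word_linear (\<lambda>w. if snd (parse w) = [] then \<beta>' (fst (parse w)) else mixed_limit w)"

lemma AE_word_limit':
  "AE \<omega> in M. (\<lambda>n. of_nat n * (mat_ntrace (mat_word n (model n \<omega>) w)
      - (if snd (parse w) = [] then \<beta> (fst (parse w)) else 0)))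
    \<longlonglongrightarrow> (if snd (parse w) = [] then \<beta>' (fst (parse w)) else mixed_limit w)"
proof (cases "snd (parse w) = []")
  case True
  have "AE \<omega> in M. \<omega> \<in> space M" by simp
  then show ?thesis
  proof eventually_elim
    case (elim \<omega>)
    have "\<forall>\<^sub>F n in sequentially. of_nat n * (mat_ntrace (mat_word n (B n) (fst (parse w))) - \<beta> (fst (parse w)))
        = of_nat n * (mat_ntrace (mat_word n (model n \<omega>) w) - \<beta> (fst (parse w)))"
      using model_word_pure[OF True _ elim] by (intro eventually_sequentiallyI[of 1]) simp
    then show ?case using True B_lim'[of "fst (parse w)"] by (auto intro: Lim_transform_eventually)
  qed
next
  case False
  have "AE \<omega> in M. (\<lambda>n. mat_trace (mat_word n (model n \<omega>) w)) \<longlonglongrightarrow> mixed_limit w"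
    unfolding mixed_limit_def by (rule someI_ex) (rule model_word_mixed[OF False])
  moreover have "AE \<omega> in M. \<omega> \<in> space M" by simp
  ultimately show ?thesis
  proof eventually_elim
    case (elim \<omega>)
    have "\<forall>\<^sub>F n in sequentially. mat_trace (mat_word n (model n \<omega>) w)
        = of_nat n * (mat_ntrace (mat_word n (model n \<omega>) w) - 0)"
    proof (rule eventually_sequentiallyI[of 1])
      fix n :: nat assume n: "1 \<le> n"
      have "dim_row (mat_word n (model n \<omega>) w) = n"
        using carrier_matD[OF mat_word_carrier[of "model n \<omega>" n, OF model_carrier[OF n elim(2)]]] by auto
      then show "mat_trace (mat_word n (model n \<omega>) w)
        = of_nat n * (mat_ntrace (mat_word n (model n \<omega>) w) - 0)"
        using n by (simp add: mat_ntrace_def)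
    qed
    then show ?case using False elim(1) by (auto intro: Lim_transform_eventually)
  qed
qed

lemma AE_limit_trace':
  "AE \<omega> in M. (\<lambda>n. of_nat n * (mat_ntrace (ncp_mat n (model n \<omega>) P) - limit_trace P)) \<longlonglongrightarrow> limit_trace' P"
proof -
  let ?t = "\<lambda>w. if snd (parse w) = [] then \<beta> (fst (parse w)) else 0"
  let ?t' = "\<lambda>w. if snd (parse w) = [] then \<beta>' (fst (parse w)) else mixed_limit w"
  have "AE \<omega> in M. \<forall>w\<in>Poly_Mapping.keys P. (\<lambda>n. of_nat n * (mat_ntrace (mat_word n (model n \<omega>) w) - ?t w)) \<longlonglongrightarrow> ?t' w"
    by (intro AE_finite_allI AE_word_limit') simp
  moreover have "AE \<omega> in M. \<omega> \<in> space M" by simp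
  ultimately show ?thesis
  proof eventually_elim
    case (elim \<omega>)
    have "(\<lambda>n. \<Sum>w\<in>Poly_Mapping.keys P. Poly_Mapping.lookup P w *
        (of_nat n * (mat_ntrace (mat_word n (model n \<omega>) w) - ?t w)))
      \<longlonglongrightarrow> (\<Sum>w\<in>Poly_Mapping.keys P. Poly_Mapping.lookup P w * ?t' w)"
      using elim(1) by (intro tendsto_sum tendsto_mult tendsto_const) blast
    moreover have "\<forall>\<^sub>F n in sequentially. (\<Sum>w\<in>Poly_Mapping.keys P. Poly_Mapping.lookup P w *
        (of_nat n * (mat_ntrace (mat_word n (model n \<omega>) w) - ?t w)))
      = of_nat n * (mat_ntrace (ncp_mat n (model n \<omega>) P) - limit_trace P)"
      by (intro eventually_sequentiallyI[of 1])
        (simp add: ncp_mat_ntrace[of "model n \<omega>" n for n, OF model_carrier[OF _ elim(2)]] word_linear_def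
          limit_trace_def sum_subtractf[symmetric] sum_distrib_left algebra_simps)
    ultimately show ?case
      unfolding limit_trace'_def word_linear_def by (rule Lim_transform_eventually)
  qed
qed

text \<open>Follows from the first-order statement: a sequence that converges after multiplication
  by \<open>n\<close> tends to zero.\<close>

lemma AE_limit_trace:
  "AE \<omega> in M. (\<lambda>n. mat_ntrace (ncp_mat n (model n \<omega>) P)) \<longlonglongrightarrow> limit_trace P"
  using AE_limit_trace'[of P]
proof eventually_elim
  case (elim \<omega>)
  let ?x = "\<lambda>n. mat_ntrace (ncp_mat n (model n \<omega>) P) - limit_trace P"
  have "(\<lambda>n. inverse (of_nat n :: complex) * (of_nat n * ?x n)) \<longlonglongrightarrow> 0 * limit_trace' P"
    by (intro tendsto_mult lim_inverse_n elim)
  moreover have "\<forall>\<^sub>F n in sequentially. inverse (of_nat n :: complex) * (of_nat n * ?x n) = ?x n"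
    by (intro eventually_sequentiallyI[of 1]) simp
  ultimately have "?x \<longlonglongrightarrow> 0" by (auto intro: Lim_transform_eventually)
  then show ?case by (simp add: LIM_zero_iff)
qed

section \<open>The limit functionals form an infinitesimal probability space\<close>

lemma AE_ex:
  assumes "AE \<omega> in M. Q \<omega>"
  obtains \<omega> where "\<omega> \<in> space M" "Q \<omega>"
proof -
  have "AE \<omega> in M. \<omega> \<in> space M \<and> Q \<omega>" using assms by simp
  then have "\<exists>\<omega>. \<omega> \<in> space M \<and> Q \<omega>"
    using eventually_happens'[OF ae_filter_bot] by blast
  then show ?thesis using that by blast
qed

lemma limit_trace_scale: "limit_trace (ncp_scale c P) = c * limit_trace P"
  and limit_trace_add: "limit_trace (P + Q) = limit_trace P + limit_trace Q"
  and limit_trace'_scale: "limit_trace' (ncp_scale c P) = c * limit_trace' P"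
  and limit_trace'_add: "limit_trace' (P + Q) = limit_trace' P + limit_trace' Q"
  by (simp_all add: limit_trace_def limit_trace'_def word_linear_scale word_linear_add)

lemma beta_Nil: "\<beta> [] = 1" "\<beta>' [] = 0"
proof -
  have one: "mat_ntrace (mat_word n (B n) []) = 1" if "1 \<le> n" for n
    using that by (simp add: mat_word_def mat_ntrace_def mat_trace_one)
  have "(\<lambda>n. mat_ntrace (mat_word n (B n) [])) \<longlonglongrightarrow> 1"
    by (rule tendsto_eventually) (auto intro: eventually_sequentiallyI[of 1] one)
  with B_lim show b: "\<beta> [] = 1" by (rule LIMSEQ_unique)
  have "(\<lambda>n. of_nat n * (mat_ntrace (mat_word n (B n) []) - \<beta> [])) \<longlonglongrightarrow> 0"
    by (rule tendsto_eventually) (auto intro!: eventually_sequentiallyI[of 1] simp: one b)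
  with B_lim' show "\<beta>' [] = 0" by (rule LIMSEQ_unique)
qed

lemma limit_trace_one: "limit_trace 1 = 1" "limit_trace' 1 = 0"
  by (simp_all add: limit_trace_def limit_trace'_def ncp_one beta_Nil)

lemma ntrace_comm:
  assumes "1 \<le> n" "\<omega> \<in> space M"
  shows "mat_ntrace (ncp_mat n (model n \<omega>) (P * Q)) = mat_ntrace (ncp_mat n (model n \<omega>) (Q * P))"
proof -
  note C = ncp_mat_carrier[of "model n \<omega>" n, OF model_carrier[OF assms]]
  have "mat_trace (ncp_mat n (model n \<omega>) (P * Q)) = mat_trace (ncp_mat n (model n \<omega>) (Q * P))"
    unfolding ncp_mat_mult[of "model n \<omega>" n, OF model_carrier[OF assms]] by (rule mat_trace_comm[OF C C])
  moreover have "dim_row (ncp_mat n (model n \<omega>) R) = n" for R by (simp add: ncp_mat_def)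
  ultimately show ?thesis by (simp add: mat_ntrace_def)
qed

text \<open>The limits are deterministic, so an identity between two of them can be read off at one
  sample point where both convergences hold; there the matrix trace is tracial for every
  \<open>n \<ge> 1\<close>.\<close>

lemma limit_trace_comm: "limit_trace (P * Q) = limit_trace (Q * P)"
proof -
  have "AE \<omega> in M. (\<lambda>n. mat_ntrace (ncp_mat n (model n \<omega>) (P * Q))) \<longlonglongrightarrow> limit_trace (P * Q) \<and>
      (\<lambda>n. mat_ntrace (ncp_mat n (model n \<omega>) (Q * P))) \<longlonglongrightarrow> limit_trace (Q * P)"
    using AE_limit_trace[of "P * Q"] AE_limit_trace[of "Q * P"] by simp
  then obtain \<omega> where \<omega>: "\<omega> \<in> space M"
    and 1: "(\<lambda>n. mat_ntrace (ncp_mat n (model n \<omega>) (P * Q))) \<longlonglongrightarrow> limit_trace (P * Q)"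
    and 2: "(\<lambda>n. mat_ntrace (ncp_mat n (model n \<omega>) (Q * P))) \<longlonglongrightarrow> limit_trace (Q * P)"
    by (rule AE_ex) blast
  have "(\<lambda>n. mat_ntrace (ncp_mat n (model n \<omega>) (P * Q))) \<longlonglongrightarrow> limit_trace (Q * P)"
    by (rule Lim_transform_eventually[OF 2]) (auto intro: eventually_sequentiallyI[of 1] ntrace_comm \<omega>)
  with 1 show ?thesis by (rule LIMSEQ_unique)
qed

lemma limit_trace'_comm: "limit_trace' (P * Q) = limit_trace' (Q * P)"
proof -
  let ?x = "\<lambda>\<omega> P n. of_nat n * (mat_ntrace (ncp_mat n (model n \<omega>) P) - limit_trace P)"
  have "AE \<omega> in M. ?x \<omega> (P * Q) \<longlonglongrightarrow> limit_trace' (P * Q) \<and> ?x \<omega> (Q * P) \<longlonglongrightarrow> limit_trace' (Q * P)"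
    using AE_limit_trace'[of "P * Q"] AE_limit_trace'[of "Q * P"] by simp
  then obtain \<omega> where \<omega>: "\<omega> \<in> space M"
    and 1: "?x \<omega> (P * Q) \<longlonglongrightarrow> limit_trace' (P * Q)" and 2: "?x \<omega> (Q * P) \<longlonglongrightarrow> limit_trace' (Q * P)"
    by (rule AE_ex) blast
  have "?x \<omega> (P * Q) \<longlonglongrightarrow> limit_trace' (Q * P)"
    by (rule Lim_transform_eventually[OF 2])
      (auto intro!: eventually_sequentiallyI[of 1] simp: limit_trace_comm[of P Q] ntrace_comm[OF _ \<omega>, of _ P Q])
  with 1 show ?thesis by (rule LIMSEQ_unique)
qed

text \<open>At a suitable sample point the approximants are squared Frobenius norms divided by
  \<open>n\<close>, and the nonnegative reals are closed in the complex plane.\<close>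

lemma limit_trace_positive:
  "limit_trace (ncp_star P * P) \<in> \<real>" "0 \<le> Re (limit_trace (ncp_star P * P))"
proof -
  obtain \<omega> where \<omega>: "\<omega> \<in> space M"
    and lim: "(\<lambda>n. mat_ntrace (ncp_mat n (model n \<omega>) (ncp_star P * P))) \<longlonglongrightarrow> limit_trace (ncp_star P * P)"
    using AE_limit_trace by (rule AE_ex)
  have eq: "mat_ntrace (ncp_mat n (model n \<omega>) (ncp_star P * P))
      = complex_of_real ((frob (ncp_mat n (model n \<omega>) P))\<^sup>2 / n)" if n: "1 \<le> n" for n
  proof -
    note mc = model_carrier[OF n \<omega>]
    have "mat_trace (ncp_mat n (model n \<omega>) (ncp_star P * P)) = complex_of_real ((frob (ncp_mat n (model n \<omega>) P))\<^sup>2)"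
      unfolding ncp_mat_mult[of "model n \<omega>" n, OF mc] ncp_mat_star[of "model n \<omega>" n, OF mc]
      by (rule mat_trace_adjoint_mult[OF ncp_mat_carrier[of "model n \<omega>" n, OF mc]])
    moreover have "dim_row (ncp_mat n (model n \<omega>) (ncp_star P * P)) = n" by (simp add: ncp_mat_def)
    ultimately show ?thesis by (simp add: mat_ntrace_def)
  qed
  have ev: "\<forall>\<^sub>F n in sequentially. mat_ntrace (ncp_mat n (model n \<omega>) (ncp_star P * P))
      \<in> {z. z \<in> \<real> \<and> 0 \<le> Re z}"
    by (intro eventually_sequentiallyI[of 1]) (simp add: eq del: of_real_divide of_real_power)
  have "{z :: complex. z \<in> \<real> \<and> 0 \<le> Re z} = \<real> \<inter> {z. 0 \<le> Re z}" by auto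
  then have "closed {z :: complex. z \<in> \<real> \<and> 0 \<le> Re z}"
    by (simp add: closed_Int closed_complex_Reals closed_halfspace_Re_ge)
  from Lim_in_closed_set[OF this ev _ lim] show "limit_trace (ncp_star P * P) \<in> \<real>"
    "0 \<le> Re (limit_trace (ncp_star P * P))" by auto
qed

theorem infinitesimal_ncps_limit: "infinitesimal_ncps ncp_scale ncp_star limit_trace' limit_trace"
proof -
  interpret unital_star_algebra ncp_scale "ncp_star :: ('k + 'l) ncpoly \<Rightarrow> _"
    by (rule unital_star_algebra_ncpoly)
  show ?thesis
    by unfold_locales
      (use limit_trace_positive limit_trace_comm limit_trace'_comm in
        \<open>auto simp: limit_trace_add limit_trace_scale limit_trace'_add limit_trace'_scale
          limit_trace_one algebra_simps\<close>)
qed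

text \<open>Without a constant term in \<open>P\<close>, every monomial of the product contains an
  \<open>x\<close>, and \<open>limit_trace\<close> is zero on each such word.\<close>

lemma limit_trace_mixed:
  assumes "Poly_Mapping.lookup P [] = 0"
  shows "limit_trace (X * relabel Inl P * Y) = 0"
proof (induction P rule: ncpoly_keys_induct)
  case (single w)
  then have w: "w \<noteq> []" using assms by (auto simp: in_keys_iff)
  let ?R = "Poly_Mapping.single (map (map_letter Inl) w) (Poly_Mapping.lookup P w) :: ('k + 'l) ncpoly"
  have "limit_trace (Poly_Mapping.single u c * ?R * Y) = 0" for u c
    by (induction Y rule: ncpoly_induct)
      (simp_all add: distrib_left limit_trace_add ncp_single_mult limit_trace_def parse_append_empty parse_Inl[OF w] word_linear_add)
  then show ?case
    by (induction X rule: ncpoly_induct) (simp_all add: distrib_right limit_trace_add)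
next
  case zero
  show ?case by (simp add: relabel_def limit_trace_def word_linear_def)
next
  case (add R S)
  then show ?case by (simp add: relabel_add distrib_left distrib_right limit_trace_add)
qed

lemma limit_trace_Inr: "limit_trace (relabel Inr Q) = word_linear \<beta> Q"
  by (induction Q rule: ncpoly_induct) (simp_all add: relabel_add limit_trace_def word_linear_add parse_Inr)

lemma B_poly_lim: "(\<lambda>n. mat_ntrace (ncp_mat n (B n) Q)) \<longlonglongrightarrow> limit_trace (relabel Inr Q)"
proof -
  have "(\<lambda>n. word_linear (\<lambda>w. mat_ntrace (mat_word n (B n) w)) Q) \<longlonglongrightarrow> word_linear \<beta> Q"
    unfolding word_linear_def by (intro tendsto_sum tendsto_mult tendsto_const B_lim)
  moreover have "\<forall>\<^sub>F n in sequentially. word_linear (\<lambda>w. mat_ntrace (mat_word n (B n) w)) Q = mat_ntrace (ncp_mat n (B n) Q)"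
    by (intro eventually_sequentiallyI[of 1]) (simp add: ncp_mat_ntrace[of "B n" n for n, OF B])
  ultimately show ?thesis unfolding limit_trace_Inr by (rule Lim_transform_eventually)
qed

lemma model_poly:
  assumes "1 \<le> n" "\<omega> \<in> space M"
  shows "ncp_mat n (model n \<omega>) (relabel Inl P) = ncp_mat n (A n) P"
    and "ncp_mat n (model n \<omega>) (relabel Inr Q) = conj_mat (U n \<omega>) (ncp_mat n (B n) Q)"
  unfolding ncp_mat_relabel[of "model n \<omega>" n, OF model_carrier[OF assms]]
    ncp_mat_conj[OF U_unitary[OF assms] B[OF assms(1)], symmetric]
  by (simp_all add: model_def conj_family_def)

text \<open>\<open>limit_trace\<close> of the product is zero, so its first-order limit is the limit
  of an unnormalized alternating trace with matrices \<open>P(A)\<close> and \<open>Q(B)\<close>, to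
  which the factorization applies directly. In the comparison term the trace of the product of the
  \<open>P(A)\<close> is bounded, while the normalized traces of the \<open>Q(B)\<close> tend to
  zero.\<close>

lemma limit_trace'_alternating:
  assumes ne: "qs \<noteq> []"
    and qs: "\<And>P Q. (P, Q) \<in> set qs \<Longrightarrow> Poly_Mapping.lookup P [] = 0 \<and> limit_trace (relabel Inr Q) = 0"
  shows "limit_trace' (\<Prod>(P, Q)\<leftarrow>qs. relabel Inl P * relabel Inr Q) = 0"
proof -
  let ?R = "\<lambda>qs. (\<Prod>(P, Q)\<leftarrow>qs. relabel Inl P * relabel Inr Q) :: ('k + 'l) ncpoly"
  let ?seq = "\<lambda>(P, Q). ((\<lambda>n. ncp_mat n (A n) P), (\<lambda>n. ncp_mat n (B n) Q))"
  obtain P0 Q0 qs' where qs': "qs = (P0, Q0) # qs'" using ne by (cases qs) auto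
  have trace0: "limit_trace (?R qs) = 0"
    using limit_trace_mixed[of P0 1 "relabel Inr Q0 * ?R qs'"] qs[of P0 Q0] qs' by (simp add: mult.assoc)
  have eval: "ncp_mat n (model n \<omega>) (?R ps) = alternating n (U n \<omega>) (at_stage n (map ?seq ps))"
    if "1 \<le> n" "\<omega> \<in> space M" for n \<omega> ps
    by (induction ps)
      (auto simp: alternating_def at_stage_def model_poly[OF that]
        ncp_mat_one[of "model n \<omega>" n, OF model_carrier[OF that]]
        ncp_mat_mult[of "model n \<omega>" n, OF model_carrier[OF that]])
  have P0: "(\<lambda>n. mat_trace (mat_prod n (map (\<lambda>(A, W). A n) (map ?seq qs)))
      * (\<Prod>(A, W)\<leftarrow>map ?seq qs. mat_ntrace (W n))) \<longlonglongrightarrow> 0"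
  proof (rule Bfun_mult_tendsto_zero)
    have "trace_bounded (\<lambda>n. mat_prod n (map (\<lambda>A. A n) (map (\<lambda>(P, Q) n. ncp_mat n (A n) P) qs)))"
      using ne qs by (intro trace_bounded_mat_prod) (auto intro!: trace_bounded_ncp_mat)
    moreover have "map (\<lambda>A. A n) (map (\<lambda>(P, Q) n. ncp_mat n (A n) P) qs) = map (\<lambda>(A, W). A n) (map ?seq qs)" for n
      by (simp add: case_prod_unfold o_def)
    ultimately have "trace_bounded (\<lambda>n. mat_prod n (map (\<lambda>(A, W). A n) (map ?seq qs)))"
      by (simp only:)
    then obtain c where
      "\<And>n. 1 \<le> n \<Longrightarrow> cmod (mat_trace (mat_prod n (map (\<lambda>(A, W). A n) (map ?seq qs)))) \<le> c"
      unfolding trace_bounded_def by blast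
    then show "Bfun (\<lambda>n. mat_trace (mat_prod n (map (\<lambda>(A, W). A n) (map ?seq qs)))) sequentially"
      by (intro BfunI[of _ c] eventually_sequentiallyI[of 1])
    have "(\<lambda>n. \<Prod>(A, W)\<leftarrow>map ?seq ps. mat_ntrace (W n)) \<longlonglongrightarrow> (\<Prod>(P, Q)\<leftarrow>ps. limit_trace (relabel Inr Q))" for ps
      by (induction ps) (auto simp: case_prod_unfold intro!: tendsto_mult B_poly_lim)
    from this[of qs] show "(\<lambda>n. \<Prod>(A, W)\<leftarrow>map ?seq qs. mat_ntrace (W n)) \<longlonglongrightarrow> 0"
      using qs[of P0 Q0] qs' by simp
  qed
  have "AE \<omega> in M. (\<lambda>n. mat_trace (alternating n (U n \<omega>) (at_stage n ([] @ map ?seq qs)))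
      - mat_trace (mat_prod n (map (\<lambda>(A, W). A n) ([] @ map ?seq qs)))
        * (\<Prod>(A, W)\<leftarrow>[] @ map ?seq qs. mat_ntrace (W n))) \<longlonglongrightarrow> 0"
    using qs by (intro AE_alternating_factorization) (auto intro: trace_bounded_ncp_mat moment_bounded_ncp_mat)
  then have "AE \<omega> in M. (\<lambda>n. mat_trace (alternating n (U n \<omega>) (at_stage n (map ?seq qs)))) \<longlonglongrightarrow> 0"
  proof eventually_elim
    case (elim \<omega>)
    from tendsto_add[OF this P0] show ?case by simp
  qed
  then have "AE \<omega> in M. (\<lambda>n. mat_trace (alternating n (U n \<omega>) (at_stage n (map ?seq qs)))) \<longlonglongrightarrow> 0 \<and>
     (\<lambda>n. of_nat n * (mat_ntrace (ncp_mat n (model n \<omega>) (?R qs)) - limit_trace (?R qs))) \<longlonglongrightarrow> limit_trace' (?R qs)"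
    using AE_limit_trace'[of "?R qs"] by simp
  then obtain \<omega> where \<omega>: "\<omega> \<in> space M"
    and 1: "(\<lambda>n. mat_trace (alternating n (U n \<omega>) (at_stage n (map ?seq qs)))) \<longlonglongrightarrow> 0"
    and 2: "(\<lambda>n. of_nat n * (mat_ntrace (ncp_mat n (model n \<omega>) (?R qs)) - limit_trace (?R qs))) \<longlonglongrightarrow> limit_trace' (?R qs)"
    by (rule AE_ex) blast
  have "\<forall>\<^sub>F n in sequentially. mat_trace (alternating n (U n \<omega>) (at_stage n (map ?seq qs)))
      = of_nat n * (mat_ntrace (ncp_mat n (model n \<omega>) (?R qs)) - limit_trace (?R qs))"
  proof (rule eventually_sequentiallyI[of 1])
    fix n :: nat assume n: "1 \<le> n"
    have "dim_row (ncp_mat n (model n \<omega>) (?R qs)) = n" by (simp add: ncp_mat_def)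
    then show "mat_trace (alternating n (U n \<omega>) (at_stage n (map ?seq qs)))
      = of_nat n * (mat_ntrace (ncp_mat n (model n \<omega>) (?R qs)) - limit_trace (?R qs))"
      using n by (simp add: mat_ntrace_def trace0 eval[OF n \<omega>, symmetric])
  qed
  then have "(\<lambda>n. of_nat n * (mat_ntrace (ncp_mat n (model n \<omega>) (?R qs)) - limit_trace (?R qs))) \<longlonglongrightarrow> 0"
    using 1 by (auto intro: Lim_transform_eventually)
  with 2 show ?thesis by (rule LIMSEQ_unique)
qed

text \<open>Expanding the factors \<open>a - s a\<close>, every term that keeps some
  \<open>a\<close> lies in the ideal generated by the \<open>x\<close> and is annihilated, so only
  the scalars \<open>- s a\<close> survive. The left factor \<open>X\<close> carries the already
  treated \<open>g b\<close> through the induction.\<close>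

lemma limit_trace_peel:
  assumes "\<And>a b. (a, b) \<in> set ps \<Longrightarrow> \<exists>P. Poly_Mapping.lookup P [] = 0 \<and> a = relabel Inl P"
  shows "limit_trace (X * (\<Prod>(a, b)\<leftarrow>ps. (a - ncp_scale (s a) 1) * g b))
    = (\<Prod>(a, b)\<leftarrow>ps. - s a) * limit_trace (X * (\<Prod>(a, b)\<leftarrow>ps. g b))"
  using assms
proof (induction ps arbitrary: X)
  case (Cons p ps)
  obtain a b where p: "p = (a, b)" by (cases p)
  let ?R = "\<Prod>(a, b)\<leftarrow>ps. (a - ncp_scale (s a) 1) * g b"
  have a: "limit_trace (X * a * (g b * ?R)) = 0" using Cons.prems[of a b] p limit_trace_mixed by auto
  have "X * ((a - ncp_scale (s a) 1) * g b * ?R) = X * a * (g b * ?R) + ncp_scale (- s a) (X * g b * ?R)"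
  proof -
    have m: "ncp_scale (- s a) 1 = - ncp_scale (s a) (1 :: ('k + 'l) ncpoly)"
      by (rule poly_mapping_eqI) simp
    have "ncp_scale (- s a) (X * g b * ?R) = X * (ncp_scale (- s a) 1 * (g b * ?R))"
      by (simp add: ncp_scale_mult_left ncp_scale_mult_right mult.assoc)
    then show ?thesis unfolding m by (simp add: algebra_simps)
  qed
  then have "limit_trace (X * ((a - ncp_scale (s a) 1) * g b * ?R)) = - s a * limit_trace (X * g b * ?R)"
    by (simp only: limit_trace_add limit_trace_scale a add_0)
  also have "limit_trace (X * g b * ?R)
      = (\<Prod>(a, b)\<leftarrow>ps. - s a) * limit_trace (X * g b * (\<Prod>(a, b)\<leftarrow>ps. g b))"
    using Cons.prems by (intro Cons.IH) auto
  finally show ?case by (simp add: p mult.assoc)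
qed simp

end

section \<open>Infinitesimal freeness\<close>

lemma eventually_at_zero_nonzero: "\<forall>\<^sub>F t in at (0::real). t \<noteq> 0"
  by (simp add: eventually_at_filter)

text \<open>Continuity at \<open>0\<close> of a path of polynomials, tested by linear functionals
  instead of a topology. Quantifying over all of them, not just the two limit functionals, is what
  makes the property survive multiplication.\<close>

definition weakly_continuous :: "(real \<Rightarrow> 'v ncpoly) \<Rightarrow> bool" where
  "weakly_continuous F \<longleftrightarrow> (\<forall>f. (\<forall>P Q. f (P + Q) = f P + f Q) \<and> (\<forall>c P. f (ncp_scale c P) = c * f P) \<longrightarrow>
     ((\<lambda>t. f (F t)) \<longlongrightarrow> (f (F 0) :: complex)) (at 0))"

lemma weakly_continuous_const: "weakly_continuous (\<lambda>t. P)"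
  by (simp add: weakly_continuous_def)

text \<open>If \<open>f\<close> is a test functional, then so is \<open>f\<close> after right
  multiplication by the fixed \<open>x\<close>; the scalar term only involves \<open>f\<close>
  itself and the continuous coefficient \<open>c\<close>.\<close>

lemma weakly_continuous_mult:
  fixes F :: "real \<Rightarrow> 'v ncpoly"
  assumes F: "weakly_continuous F" and c: "(c \<longlongrightarrow> c 0) (at 0)"
  shows "weakly_continuous (\<lambda>t. F t * (x - ncp_scale (c t) 1))"
  unfolding weakly_continuous_def
proof (intro allI impI, elim conjE)
  fix f :: "'v ncpoly \<Rightarrow> complex"
  assume f: "\<forall>P Q. f (P + Q) = f P + f Q" "\<forall>c P. f (ncp_scale c P) = c * f P"
  have eq: "f (F t * (x - ncp_scale (c t) 1)) = f (F t * x) + (- c t) * f (F t)" for t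
  proof -
    have "F t * (x - ncp_scale (c t) 1) = F t * x + ncp_scale (- c t) (F t)"
      by (rule poly_mapping_eqI) (simp add: right_diff_distrib ncp_scale_mult_right lookup_add lookup_minus)
    then show ?thesis using f by simp
  qed
  have "((\<lambda>t. f (F t * x)) \<longlongrightarrow> f (F 0 * x)) (at 0)"
    using F[unfolded weakly_continuous_def, rule_format, of "\<lambda>P. f (P * x)"] f
    by (simp add: distrib_right ncp_scale_mult_left)
  moreover have "((\<lambda>t. f (F t)) \<longlongrightarrow> f (F 0)) (at 0)"
    using F[unfolded weakly_continuous_def, rule_format, of f] f by simp
  ultimately show "((\<lambda>t. f (F t * (x - ncp_scale (c t) 1))) \<longlongrightarrow> f (F 0 * (x - ncp_scale (c 0) 1))) (at 0)"
    unfolding eq by (intro tendsto_add tendsto_mult tendsto_minus c)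
qed

context matrix_model
begin

text \<open>\<open>F t\<close> is the centred product and \<open>G t\<close> its part from the
  second family. After division by \<open>t\<close>, the contribution of \<open>limit_trace'\<close>
  tends to its value on \<open>F 0\<close>, and \<open>limit_trace_peel\<close> extracts one power
  of \<open>t\<close> per pair from that of \<open>limit_trace\<close>; both limits are shown to be
  zero.\<close>

theorem inf_free_families_limit:
  "inf_free_families ncp_scale ncp_star limit_trace' limit_trace (\<lambda>i. ncp_var (Inl i)) (\<lambda>j. ncp_var (Inr j))"
  unfolding inf_free_families_def inf_free_def Let_def ncp_eval_relabel
proof (intro allI impI)
  fix ps :: "(('k + 'l) ncpoly \<times> ('k + 'l) ncpoly) list"
  assume "ps \<noteq> [] \<and> set ps \<subseteq> {relabel Inl P | P. Poly_Mapping.lookup P [] = 0} \<times> range (relabel Inr)"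
  then have ne: "ps \<noteq> []"
    and ps: "set ps \<subseteq> {relabel Inl P | P. Poly_Mapping.lookup P [] = 0} \<times> range (relabel Inr)" by auto
  define T where "T t c = limit_trace c + of_real t * limit_trace' c" for t :: real and c
  define F where "F t = (\<Prod>(a, b)\<leftarrow>ps. (a - ncp_scale (T t a) 1) * (b - ncp_scale (T t b) 1))" for t
  define G where "G t = (\<Prod>(a, b)\<leftarrow>ps. b - ncp_scale (T t b) 1)" for t
  have T_lim: "((\<lambda>t. T t c) \<longlongrightarrow> T 0 c) (at 0)" for c
    unfolding T_def by (intro tendsto_intros)
  have "weakly_continuous (\<lambda>t. \<Prod>(a, b)\<leftarrow>qs. (a - ncp_scale (T t a) 1) * (b - ncp_scale (T t b) 1))" for qs
    by (induction qs rule: rev_induct)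
      (auto simp: mult.assoc[symmetric] intro!: weakly_continuous_mult T_lim weakly_continuous_const)
  then have "weakly_continuous F" by (simp add: F_def[abs_def])
  then have F_lim: "((\<lambda>t. limit_trace' (F t)) \<longlongrightarrow> limit_trace' (F 0)) (at 0)"
    unfolding weakly_continuous_def using limit_trace'_add limit_trace'_scale by blast
  have "weakly_continuous (\<lambda>t. \<Prod>(a, b)\<leftarrow>qs. b - ncp_scale (T t b) 1)"
    for qs :: "(('k + 'l) ncpoly \<times> ('k + 'l) ncpoly) list"
    by (induction qs rule: rev_induct)
      (auto intro!: weakly_continuous_mult T_lim weakly_continuous_const)
  then have "weakly_continuous G" by (simp add: G_def[abs_def])
  then have G_lim: "((\<lambda>t. limit_trace (G t)) \<longlongrightarrow> limit_trace (G 0)) (at 0)"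
    unfolding weakly_continuous_def using limit_trace_add limit_trace_scale by blast
  have x_zero: "limit_trace a = 0" if "(a, b) \<in> set ps" for a b
    using that ps limit_trace_mixed[of _ 1 1] by auto

  \<comment> \<open>At \<open>t = 0\<close> the centring constants are values of
    \<open>limit_trace\<close> itself, and those of the first family vanish, so \<open>F 0\<close>
    is an alternating product of the kind treated in
    \<open>limit_trace'_alternating\<close>.\<close>
  have "limit_trace' (F 0) = 0"
  proof -
    let ?I = "\<lambda>(P, Q). (relabel Inl P, relabel Inr Q)"
    have "\<exists>qs. ps = map ?I qs \<and> (\<forall>(P, Q)\<in>set qs. Poly_Mapping.lookup P [] = 0)"
      using ps
    proof (induction ps)
      case (Cons p ps)
      then obtain qs where "ps = map ?I qs" "\<forall>(P, Q)\<in>set qs. Poly_Mapping.lookup P [] = 0" by auto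
      moreover obtain P Q where "p = ?I (P, Q)" "Poly_Mapping.lookup P [] = 0" using Cons.prems by auto
      ultimately show ?case by (intro exI[of _ "(P, Q) # qs"]) simp
    qed simp
    then obtain qs where qs: "ps = map ?I qs" and P: "\<And>P Q. (P, Q) \<in> set qs \<Longrightarrow> Poly_Mapping.lookup P [] = 0"
      by blast
    \<comment> \<open>The centring is carried out on the polynomial before renaming, so the centred
      factor is again of the form \<open>relabel Inr\<close>.\<close>
    let ?C = "\<lambda>Q. Q + Poly_Mapping.single [] (- limit_trace (relabel Inr Q))"
    let ?rs = "map (\<lambda>(P, Q). (P, ?C Q)) qs"
    have rel: "relabel Inr (?C Q) = relabel Inr Q - ncp_scale (limit_trace (relabel Inr Q)) 1" for Q
      unfolding relabel_add relabel_single by (simp add: ncp_one single_uminus)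
    have "F 0 = (\<Prod>(P, Q)\<leftarrow>?rs. relabel Inl P * relabel Inr Q)"
      unfolding F_def qs
    proof (simp only: map_map o_def, intro arg_cong[of _ _ prod_list] map_cong refl)
      fix q assume q: "q \<in> set qs"
      obtain P Q where PQ: "q = (P, Q)" by (cases q)
      have "limit_trace (relabel Inl P) = 0" using x_zero[of "relabel Inl P" "relabel Inr Q"] q PQ qs by force
      moreover have "ncp_scale 0 (1 :: ('k + 'l) ncpoly) = 0" by (rule poly_mapping_eqI) simp
      ultimately show "(case ?I q of (a, b) \<Rightarrow> (a - ncp_scale (T 0 a) 1) * (b - ncp_scale (T 0 b) 1))
        = (case case q of (P, Q) \<Rightarrow> (P, ?C Q) of (P, Q) \<Rightarrow> relabel Inl P * relabel Inr Q)"
        by (simp add: PQ T_def rel)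
    qed
    also have "limit_trace' \<dots> = 0"
    proof (rule limit_trace'_alternating)
      show "?rs \<noteq> []" using ne qs by simp
      fix P R assume "(P, R) \<in> set ?rs"
      then obtain Q where Q: "(P, Q) \<in> set qs" "R = ?C Q" by auto
      have "limit_trace (relabel Inr R) = limit_trace (relabel Inr Q) + limit_trace (Poly_Mapping.single [] (- limit_trace (relabel Inr Q)))"
        unfolding Q(2) relabel_add limit_trace_add by simp
      also have "\<dots> = 0" by (simp add: limit_trace_def[of] beta_Nil)
      finally show "Poly_Mapping.lookup P [] = 0 \<and> limit_trace (relabel Inr R) = 0" using P[OF Q(1)] by simp
    qed
    finally show ?thesis .
  qed
  with F_lim have F'0: "((\<lambda>t. limit_trace' (F t)) \<longlongrightarrow> 0) (at 0)" by simp

  obtain m where m: "length ps = Suc m" using ne by (cases ps) auto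
  let ?c = "\<Prod>(a, b)\<leftarrow>ps. - limit_trace' a"
  \<comment> \<open>Since \<open>limit_trace a = 0\<close> for the first family, the centring
    constant of \<open>a\<close> at time \<open>t\<close> is
    \<open>t * limit_trace' a\<close>.\<close>
  have F_eq: "limit_trace (F t) = of_real t ^ Suc m * ?c * limit_trace (G t)" for t
  proof -
    have "limit_trace (1 * F t) = (\<Prod>(a, b)\<leftarrow>ps. - T t a) * limit_trace (1 * G t)"
      unfolding F_def G_def
      using limit_trace_peel[of ps 1 "T t" "\<lambda>b. b - ncp_scale (T t b) 1"] ps by (auto simp: subset_iff)
    moreover have "(\<Prod>(a, b)\<leftarrow>qs. - T t a) = of_real t ^ length qs * (\<Prod>(a, b)\<leftarrow>qs. - limit_trace' a)"
      if "set qs \<subseteq> set ps" for qs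
      using that by (induction qs) (auto simp: T_def x_zero algebra_simps)
    ultimately show ?thesis using m by simp
  qed
  have G0: "((\<lambda>t. of_real t ^ m * ?c * limit_trace (G t)) \<longlongrightarrow> 0) (at 0)"
  proof -
    have "((\<lambda>t. of_real t ^ m * ?c * limit_trace (G t)) \<longlongrightarrow> of_real 0 ^ m * ?c * limit_trace (G 0)) (at 0)"
      by (intro tendsto_intros G_lim)
    \<comment> \<open>With two or more pairs a power of \<open>t\<close> is left over after
      division. With a single pair (\<open>m = 0\<close>) none is left, but then \<open>G 0\<close>
      is \<open>b\<close> centred by \<open>limit_trace\<close> and has value zero.\<close>
    moreover have "of_real 0 ^ m * ?c * limit_trace (G 0) = 0"
    proof (cases m)
      case 0
      then obtain a b where "ps = [(a, b)]" using m by (cases ps) auto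
      then have "G 0 = b + ncp_scale (- limit_trace b) 1"
        by (simp add: G_def T_def poly_mapping_eq_iff fun_eq_iff lookup_add lookup_minus)
      then have "limit_trace (G 0) = 0" by (simp only: limit_trace_add limit_trace_scale limit_trace_one) simp
      then show ?thesis by simp
    qed simp
    ultimately show ?thesis by (simp only:)
  qed
  have "((\<lambda>t. T t (F t) / of_real t) \<longlongrightarrow> 0) (at 0)"
  proof (rule Lim_transform_eventually)
    show "((\<lambda>t. of_real t ^ m * ?c * limit_trace (G t) + limit_trace' (F t)) \<longlongrightarrow> 0) (at 0)"
      using tendsto_add[OF G0 F'0] by simp
    show "\<forall>\<^sub>F t in at 0. of_real t ^ m * ?c * limit_trace (G t) + limit_trace' (F t) = T t (F t) / of_real t"
      by (rule eventually_mono[OF eventually_at_zero_nonzero]) (simp add: T_def F_eq field_simps)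
  qed
  then have "(\<lambda>t. T t (F t)) \<in> o[at 0](\<lambda>t. of_real t)"
    by (rule smalloI_tendsto) (rule eventually_mono[OF eventually_at_zero_nonzero], simp)
  then show "(\<lambda>t. limit_trace (\<Prod>(a, b)\<leftarrow>ps. (a - ncp_scale (limit_trace a + of_real t * limit_trace' a) 1)
        * (b - ncp_scale (limit_trace b + of_real t * limit_trace' b) 1))
      + of_real t * limit_trace' (\<Prod>(a, b)\<leftarrow>ps. (a - ncp_scale (limit_trace a + of_real t * limit_trace' a) 1)
        * (b - ncp_scale (limit_trace b + of_real t * limit_trace' b) 1))) \<in> o[at 0](\<lambda>t. of_real t)"
    unfolding T_def F_def .
qed

end

theorem corollary4p5:
  fixes M :: "'w measure"
    and U :: "nat \<Rightarrow> 'w \<Rightarrow> complex mat"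
    and A :: "nat \<Rightarrow> 'k::finite \<Rightarrow> complex mat"
    and B :: "nat \<Rightarrow> 'l::finite \<Rightarrow> complex mat"
    and a :: "'k \<Rightarrow> 'h::{complex_hilbert_space, second_countable_topology} \<Rightarrow> 'h"
    and scl :: "complex \<Rightarrow> 'c::ring_1 \<Rightarrow> 'c" and star :: "'c \<Rightarrow> 'c"
    and \<phi>' \<phi> :: "'c \<Rightarrow> complex" and b :: "'l \<Rightarrow> 'c"
  assumes "prob_space M"
    and "\<And>n i. n \<ge> 1 \<Longrightarrow> A n i \<in> carrier_mat n n"
    and "\<And>n j. n \<ge> 1 \<Longrightarrow> B n j \<in> carrier_mat n n"
    and "\<And>n. n \<ge> 1 \<Longrightarrow> haar_unitary n M (U n)"
    and "\<And>i. trace_class (a i)"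
    and "conv_in_distr_Tr A a"
    and "infinitesimal_ncps scl star \<phi>' \<phi>"
    and "conv_first_order B scl star \<phi>' \<phi> b"
  shows "\<exists>\<tau> \<tau>' :: ('k + 'l) ncpoly \<Rightarrow> complex.
      (\<forall>P. AE \<omega> in M.
         (\<lambda>n. mat_ntrace (ncp_mat n (conj_family (A n) (B n) (U n \<omega>)) P)) \<longlonglongrightarrow> \<tau> P) \<and>
      (\<forall>P. AE \<omega> in M.
         (\<lambda>n. (mat_ntrace (ncp_mat n (conj_family (A n) (B n) (U n \<omega>)) P) - \<tau> P) / (1 / of_nat n))
           \<longlonglongrightarrow> \<tau>' P) \<and>
      infinitesimal_ncps ncp_scale ncp_star \<tau>' \<tau> \<and>
      inf_free_families ncp_scale ncp_star \<tau>' \<tau> (\<lambda>i. ncp_var (Inl i)) (\<lambda>j. ncp_var (Inr j))"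
proof -
  let ?\<alpha> = "\<lambda>w. op_trace (word_val (\<circ>) id op_adj a w)"
  let ?\<beta> = "\<lambda>u. \<phi> (word_val (*) 1 star b u)"
  let ?\<beta>' = "\<lambda>u. \<phi>' (word_val (*) 1 star b u)"
  interpret infinitesimal_ncps scl star \<phi>' \<phi> by fact
  interpret matrix_model M U A B ?\<alpha> ?\<beta> ?\<beta>'
  proof (rule matrix_model.intro)
    show "haar_sequence M U"
      using assms(1,4) by (simp add: haar_sequence_def haar_sequence_axioms_def)
    show "matrix_model_axioms A B ?\<alpha> ?\<beta> ?\<beta>'"
    proof
      fix n :: nat and i j assume "1 \<le> n"
      then show "A n i \<in> carrier_mat n n" "B n j \<in> carrier_mat n n" using assms(2,3) by auto
    next
      fix w :: "'k letter list" assume "w \<noteq> []"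
      then show "(\<lambda>n. mat_trace (mat_word n (A n) w)) \<longlonglongrightarrow> ?\<alpha> w"
        using assms(6) by (simp add: conv_in_distr_Tr_def)
    next
      fix u :: "'l letter list"
      show "(\<lambda>n. mat_ntrace (mat_word n (B n) u)) \<longlonglongrightarrow> ?\<beta> u"
      \<comment> \<open>Convergence in distribution concerns nonempty words; the empty word has
        normalized trace \<open>1\<close> for \<open>n \<ge> 1\<close>, in accordance with
        \<open>\<phi> 1 = 1\<close>.\<close>
      proof (cases "u = []")
        case True
        then show ?thesis
          using \<tau>_one by (intro tendsto_eventually eventually_sequentiallyI[of 1])
            (simp add: mat_word_def mat_ntrace_def mat_trace_one)
      next
        case False
        then show ?thesis using assms(8) by (simp add: conv_first_order_def conv_in_distr_tr_def)
      qed
      \<comment> \<open>First-order convergence is stated for polynomials; the monomial with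
        coefficient \<open>1\<close> specializes it to the word \<open>u\<close>.\<close>
      let ?Q = "Poly_Mapping.single u 1 :: 'l ncpoly"
      have e: "ncp_eval scl star b ?Q = word_val (*) 1 star b u" by (simp add: ncp_eval_def)
      have "(\<lambda>n. of_nat n * (mat_ntrace (ncp_mat n (B n) ?Q) - ?\<beta> u)) \<longlonglongrightarrow> ?\<beta>' u"
        using assms(8) unfolding conv_first_order_def by (metis e)
      moreover have "\<forall>\<^sub>F n in sequentially. of_nat n * (mat_ntrace (ncp_mat n (B n) ?Q) - ?\<beta> u)
          = of_nat n * (mat_ntrace (mat_word n (B n) u) - ?\<beta> u)"
        using assms(3)
        by (intro eventually_sequentiallyI[of 1]) (simp add: ncp_mat_ntrace)
      ultimately show "(\<lambda>n. of_nat n * (mat_ntrace (mat_word n (B n) u) - ?\<beta> u)) \<longlonglongrightarrow> ?\<beta>' u"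
        by (rule Lim_transform_eventually)
    qed
  qed
  \<comment> \<open>Also valid at \<open>n = 0\<close>, where both sides are \<open>0\<close> by the
    convention for division by zero.\<close>
  have scaled: "x / (1 / of_nat n) = of_nat n * x" for x :: complex and n by simp
  show ?thesis
    using AE_limit_trace AE_limit_trace' infinitesimal_ncps_limit inf_free_families_limit
    unfolding scaled model_def[symmetric] by blast
qed

end
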